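(* Let $n\ge1$, $m_1,\dots,m_n\in\mathbb Z_{\ge0}$ and $\lambda=m_1\omega_1+\dots+m_n\omega_n$. Then $$\operatorname{ch}_q\mathcal V_0(\lambda)=\sum_{\mathbf s\in FFLV^{\mathbb Z}_{2n+1}(\lambda)}e^{\lambda-\operatorname{wt}(\mathbf s)}\,q^{\deg(\mathbf s)}.$$
   Context: **Odd symplectic Lie algebra.** Let $V=\mathbb C^{2n+1}$ with basis $e_1,\dots,e_{2n+1}$ and coordinates $x_1,\dots,x_{2n+1}$, and let $\omega=\sum_{i=1}^n dx_i\wedge dx_{n+i}$, a skew-symmetric form of maximal rank $2n$. $\mathfrak{sp}_{2n+1}$ is the Lie algebra of the subgroup of $GL(V)$ preserving $\omega$. In the basis above it consists of block matrices $\begin{bmatrix} A&0\\ b&z\end{bmatrix}$ with $A\in\mathfrak{sp}_{2n}$, $b\in\mathbb C^{2n}$ a row, $z\in\mathbb C$. Let $E_{i,j}$ be matrix units. Let $\mathfrak h\subset\mathfrak{sp}_{2n}$ be the diagonal Cartan subalgebra, spanned by $E_{i,i}-E_{n+i,n+i}$, and $\tilde{\mathfrak h}=\mathfrak h\oplus\mathbb C E_{2n+1,2n+1}$; let $\varepsilon_1,\dots,\varepsilon_n,\delta$ be the basis of $\tilde{\mathfrak h}^*$ dual to $E_{1,1}-E_{n+1,n+1},\dots,E_{n,n}-E_{2n,2n},E_{2n+1,2n+1}$. Put $\alpha_i=\varepsilon_i-\varepsilon_{i+1}$ ($i<n$), $\alpha_n=2\varepsilon_n$, $\omega_i=\varepsilon_1+\dots+\varepsilon_i$.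 Positive roots of $\mathfrak{sp}_{2n}$: $\alpha_{i,j}=\alpha_i+\dots+\alpha_j$ ($1\le i\le j\le n-1$) and $\alpha_{i,\overline j}=\alpha_i+\alpha_{i+1}+\dots+\alpha_n+\alpha_{n-1}+\dots+\alpha_j$ ($1\le i\le j\le n$). In addition, for $1\le i\le n$ set $\alpha_{i,n}=\alpha_i+\dots+\alpha_n-\tilde\alpha_{n+1}$, where $\tilde\alpha_{n+1}=\varepsilon_n+\delta$ is the weight of $E_{2n+1,2n}$; thus $\alpha_{i,n}=\varepsilon_i-\delta$ and $E_{2n+1,i}$ has weight $-\alpha_{i,n}$. Let $\mathfrak{sp}_{2n}=\mathfrak n^+\oplus\mathfrak h\oplus\mathfrak n^-$ be the Cartan decomposition and $\tilde{\mathfrak n}^-=\mathfrak n^-\oplus\bigoplus_{i=1}^n\mathbb C E_{2n+1,i}$. **The representation $\mathcal V_0(\lambda)$.** Identify $\lambda=\sum m_i\omega_i$ with the Young diagram $(\lambda_1\ge\dots\ge\lambda_n\ge0)$, $\lambda_i=m_i+\dots+m_n$, $|\lambda|=\sum\lambda_i$. Let $V^\lambda\subset V^{\otimes|\lambda|}$ be the irreducible $GL(V)$-subrepresentation of highest weight $\lambda$ given as the image of the Young symmetrizer $c_\lambda$. A tensor in $V^{\otimes k}$ is trace-free if all its $k(k-1)/2$ contractions with $\omega$ (in pairs of tensor positions) vanish. $\mathcal V_0(\lambda)$ is the subspace of trace-free tensors in $V^\lambda$; it is a representation of $\mathfrak{sp}_{2n+1}$. The highest weight vector $v_\lambda\in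 V^\lambda$ (nonzero, of $GL(V)$-weight $(\lambda_1,\dots,\lambda_n,0,\dots,0)$) lies in $\mathcal V_0(\lambda)$. **PBW filtration and $q$-character.** $U^s(\mathfrak g)\subset U(\mathfrak g)$ is the span of products of at most $s$ elements of $\mathfrak g$. The PBW filtration is $\mathcal V_0(\lambda)^s=U^s(\tilde{\mathfrak n}^-)v_\lambda$. The $q$-character is $\operatorname{ch}_q\mathcal V_0(\lambda)=\sum_{\mu,s}\dim\big((\mathcal V_0(\lambda)^{s})^{\mu}/(\mathcal V_0(\lambda)^{s-1})^{\mu}\big)\,e^\mu q^s$, where the superscript $\mu$ denotes the $\tilde{\mathfrak h}$-weight space of weight $\mu$. **Polytope.** Consider the poset whose elements are $\alpha_{i,j}$ and $\alpha_{i,\overline j}$ ($1\le i\le j\le n$), arranged in rows $i=1,\dots,n$, with arrows $\alpha_{i,i}\to\alpha_{i,i+1}\to\dots\to\alpha_{i,n}\to\alpha_{i,\overline n}\to\alpha_{i,\overline{n-1}}\to\dots\to\alpha_{i,\overline i}$ along each row and vertical arrows $\alpha_{i,j}\to\alpha_{i+1,j}$, $\alpha_{i,\overline j}\to\alpha_{i+1,\overline j}$ for $i+1\le j\le n$. A symplectic Dyck path is a sequence $p=(p(0),\dots,p(k))$ ($k\ge0$), each $p(t)\to p(t+1)$ being an arrow, with $p(0)=\alpha_{i,i}$ for some $i$ and $p(k)=\alpha_{j,j}$ or $p(k)=\alpha_{j,\overline j}$ for some $j\ge i$. $FFLV_{2n+1}(\lambda)\subset\mathbb R_{\ge0}^{n(n+1)}$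 is the set of $\mathbf s=(s_\alpha)$, indexed by the elements of the poset, such that for each symplectic Dyck path $p$: $\sum_{\alpha\in p}s_\alpha\le m_i+\dots+m_j$ if $p(0)=\alpha_{i,i},p(k)=\alpha_{j,j}$; and $\sum_{\alpha\in p}s_\alpha\le m_i+\dots+m_n$ if $p(0)=\alpha_{i,i},p(k)=\alpha_{j,\overline j}$. $FFLV^{\mathbb Z}_{2n+1}(\lambda)$ is its set of integral points. For such $\mathbf s$, $\operatorname{wt}(\mathbf s)=\sum_\alpha s_\alpha\alpha$ and $\deg(\mathbf s)=\sum_\alpha s_\alpha$, sums over all elements of the poset. *)

theory Defs
  imports
    Complex_Main
    "HOL-Library.Function_Algebras"
    "HOL-Library.Poly_Mapping"
    "HOL-Combinatorics.Permutations"
    "HOL-Computational_Algebra.Polynomial"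
begin

section \<open>Complex vector spaces of functions\<close>

text \<open>
  All vector spaces below are spaces of complex functions on an index type: vectors
  (indices), matrices (pairs of indices), tensors (words of indices) and weights (indices).
\<close>

definition fscale :: "complex \<Rightarrow> ('a \<Rightarrow> complex) \<Rightarrow> 'a \<Rightarrow> complex"  (infixr "*\<^sub>C" 75)
  where "c *\<^sub>C f = (\<lambda>x. c * f x)"

lemma fscale_apply [simp]: "(c *\<^sub>C f) x = c * f x"
  by (simp add: fscale_def)

global_interpretation cfun: vector_space "fscale :: complex \<Rightarrow> ('a \<Rightarrow> complex) \<Rightarrow> _"
  by standard (auto simp: fun_eq_iff algebra_simps)

definition unit_vec :: "'a \<Rightarrow> 'a \<Rightarrow> complex"
  where "unit_vec a = (\<lambda>b. if b = a then 1 else 0)"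

text \<open>
  \<open>S\<close> is a basis of \<open>A\<close> modulo \<open>B\<close>: the cosets of the elements of \<open>S\<close> are
  distinct and form a basis of the quotient space \<open>A / B\<close>.
\<close>

definition basis_mod :: "('a \<Rightarrow> complex) set \<Rightarrow> ('a \<Rightarrow> complex) set \<Rightarrow> ('a \<Rightarrow> complex) set \<Rightarrow> bool"
  where "basis_mod A B S \<longleftrightarrow>
    finite S \<and> S \<subseteq> A \<and>
    (\<forall>c. (\<Sum>x\<in>S. c x *\<^sub>C x) \<in> B \<longrightarrow> (\<forall>x\<in>S. c x = 0)) \<and>
    A \<subseteq> {x + y |x y. x \<in> cfun.span S \<and> y \<in> B}"

definition quot_dim :: "('a \<Rightarrow> complex) set \<Rightarrow> ('a \<Rightarrow> complex) set \<Rightarrow> nat"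
  where "quot_dim A B = (THE d. \<exists>S. basis_mod A B S \<and> card S = d)"

lemma basis_mod_card:
  assumes B: "cfun.subspace B" and sub: "B \<subseteq> A" and A: "cfun.subspace A"
    and fin: "finite F" "A \<subseteq> cfun.span F" and bm: "basis_mod A B S"
  shows "cfun.dim B + card S = cfun.dim A"
proof -
  from bm have S: "finite S" "S \<subseteq> A"
    and ind: "\<And>c. (\<Sum>x\<in>S. c x *\<^sub>C x) \<in> B \<Longrightarrow> \<forall>x\<in>S. c x = 0"
    and gen: "A \<subseteq> {x + y |x y. x \<in> cfun.span S \<and> y \<in> B}"
    unfolding basis_mod_def by auto
  obtain C where C: "C \<subseteq> B" "cfun.independent C" "B \<subseteq> cfun.span C" "card C = cfun.dim B"
    by (rule cfun.basis_exists[of B])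
  have "C \<subseteq> cfun.span F" using C(1) sub fin by blast
  hence finC: "finite C" using cfun.independent_span_bound[OF fin(1) C(2)] by simp
  have inB: "cfun.span C \<subseteq> B" using C(1) B by (simp add: cfun.span_minimal)
  have disj: "S \<inter> C = {}"
  proof (rule ccontr)
    assume "S \<inter> C \<noteq> {}"
    then obtain a where a: "a \<in> S" "a \<in> C" by blast
    have "(\<Sum>x\<in>S. (if x = a then 1 else 0) *\<^sub>C x) = (\<Sum>x\<in>S. if x = a then a else 0)"
      by (rule sum.cong) auto
    also have "\<dots> = a" using a(1) S(1) by simp
    finally have "(\<Sum>x\<in>S. (if x = a then 1 else 0) *\<^sub>C x) \<in> B" using a(2) C(1) by auto
    from ind[OF this] a(1) show False by auto
  qed
  have indep: "cfun.independent (S \<union> C)"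
  proof (rule cfun.independent_if_scalars_zero)
    show "finite (S \<union> C)" using S finC by simp
    fix f x assume z: "(\<Sum>x\<in>S \<union> C. f x *\<^sub>C x) = 0" and x: "x \<in> S \<union> C"
    have s: "(\<Sum>x\<in>S. f x *\<^sub>C x) + (\<Sum>x\<in>C. f x *\<^sub>C x) = 0"
      using z S(1) finC disj by (simp add: sum.union_disjoint)
    have "(\<Sum>x\<in>C. f x *\<^sub>C x) \<in> B"
      using C(1) B by (intro cfun.subspace_sum cfun.subspace_scale) auto
    moreover have "(\<Sum>x\<in>S. f x *\<^sub>C x) = - (\<Sum>x\<in>C. f x *\<^sub>C x)"
      using s by (simp add: eq_neg_iff_add_eq_0)
    ultimately have "(\<Sum>x\<in>S. f x *\<^sub>C x) \<in> B" using B by (simp add: cfun.subspace_neg)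
    from ind[OF this] have zS: "\<forall>x\<in>S. f x = 0" .
    hence "(\<Sum>x\<in>S. f x *\<^sub>C x) = 0" by (intro sum.neutral) auto
    with s have "(\<Sum>x\<in>C. f x *\<^sub>C x) = 0" by simp
    hence "\<forall>x\<in>C. f x = 0"
      by (intro ballI) (rule cfun.independentD[OF C(2) finC order_refl])
    with zS x show "f x = 0" by blast
  qed
  have span: "A \<subseteq> cfun.span (S \<union> C)"
  proof
    fix a assume "a \<in> A"
    then obtain x y where "a = x + y" "x \<in> cfun.span S" "y \<in> B" using gen by blast
    moreover have "x \<in> cfun.span (S \<union> C)" "y \<in> cfun.span (S \<union> C)"
      using calculation C(3) cfun.span_mono[of S "S \<union> C"] cfun.span_mono[of C "S \<union> C"] by auto
    ultimately show "a \<in> cfun.span (S \<union> C)" by (simp add: cfun.span_add)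
  qed
  have "card (S \<union> C) = cfun.dim A"
    using S(2) C(1) sub span indep by (intro cfun.basis_card_eq_dim) auto
  thus ?thesis using S(1) finC disj C(4) by (simp add: card_Un_disjoint)
qed

lemma basis_mod_exists:
  assumes B: "cfun.subspace B" and sub: "B \<subseteq> A" and A: "cfun.subspace A"
    and fin: "finite F" "A \<subseteq> cfun.span F"
  shows "\<exists>S. basis_mod A B S"
proof -
  obtain C where C: "C \<subseteq> B" "cfun.independent C" "B \<subseteq> cfun.span C"
    by (rule cfun.basis_exists[of B])
  obtain D where D: "C \<subseteq> D" "D \<subseteq> A" "cfun.independent D" "A \<subseteq> cfun.span D"
    by (rule cfun.maximal_independent_subset_extend[OF order_trans[OF C(1) sub] C(2)])
  have finD: "finite D"
    using cfun.independent_span_bound[OF fin(1) D(3)] D(2) fin(2) by blast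
  have inB: "cfun.span C = B"
    using C B by (intro equalityI) (auto simp: cfun.span_minimal)
  have "basis_mod A B (D - C)"
    unfolding basis_mod_def
  proof (intro conjI allI impI ballI)
    show "finite (D - C)" using finD by simp
    show "D - C \<subseteq> A" using D by blast
  next
    fix c x assume h: "(\<Sum>x\<in>D - C. c x *\<^sub>C x) \<in> B" and x: "x \<in> D - C"
    have finC: "finite C" using D(1) finD finite_subset by blast
    from h inB obtain u where u: "(\<Sum>x\<in>D - C. c x *\<^sub>C x) = (\<Sum>x\<in>C. u x *\<^sub>C x)"
      using cfun.span_finite[OF finC] by auto
    define f where "f = (\<lambda>x. if x \<in> C then - u x else c x)"
    have "(\<Sum>x\<in>D. f x *\<^sub>C x) = (\<Sum>x\<in>D - C. f x *\<^sub>C x) + (\<Sum>x\<in>C. f x *\<^sub>C x)"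
      using finD D(1) by (simp add: sum.subset_diff)
    also have "(\<Sum>x\<in>D - C. f x *\<^sub>C x) = (\<Sum>x\<in>D - C. c x *\<^sub>C x)"
      by (rule sum.cong) (auto simp: f_def)
    also have "(\<Sum>x\<in>C. f x *\<^sub>C x) = - (\<Sum>x\<in>C. u x *\<^sub>C x)"
      unfolding sum_negf[symmetric] by (rule sum.cong) (auto simp: f_def)
    finally have "(\<Sum>x\<in>D. f x *\<^sub>C x) = 0" by (simp only: u right_minus)
    hence "f x = 0" using x by (intro cfun.independentD[OF D(3) finD order_refl]) auto
    thus "c x = 0" using x by (simp add: f_def)
  next
    have "D - C \<union> C = D" using D(1) by blast
    with D(4) have "A \<subseteq> cfun.span ((D - C) \<union> C)" by simp
    thus "A \<subseteq> {x + y |x y. x \<in> cfun.span (D - C) \<and> y \<in> B}"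
      unfolding cfun.span_Un inB .
  qed
  thus ?thesis by blast
qed

lemma quot_dim_eq:
  assumes "cfun.subspace B" "B \<subseteq> A" "cfun.subspace A" "finite F" "A \<subseteq> cfun.span F"
  shows "cfun.dim B + quot_dim A B = cfun.dim A"
proof -
  obtain S where S: "basis_mod A B S" using basis_mod_exists[OF assms] by blast
  have "quot_dim A B = card S"
    unfolding quot_dim_def
  proof (rule the_equality)
    show "\<exists>S'. basis_mod A B S' \<and> card S' = card S" using S by blast
    fix d assume "\<exists>S. basis_mod A B S \<and> card S = d"
    then obtain S' where "basis_mod A B S'" "card S' = d" by blast
    with basis_mod_card[OF assms, of S'] basis_mod_card[OF assms S] show "d = card S" by linarith
  qed
  with basis_mod_card[OF assms S] show ?thesis by simp
qed


section \<open>The Lie algebra\<close>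

type_synonym matrix = "nat \<times> nat \<Rightarrow> complex"

definition gl :: "nat \<Rightarrow> matrix set"
  where "gl N = {X. \<forall>i j. X (i, j) \<noteq> 0 \<longrightarrow> i \<in> {1..N} \<and> j \<in> {1..N}}"

definition mat_mul :: "nat \<Rightarrow> matrix \<Rightarrow> matrix \<Rightarrow> matrix"
  where "mat_mul N X Y = (\<lambda>(i, j). \<Sum>k=1..N. X (i, k) * Y (k, j))"

definition bracket :: "nat \<Rightarrow> matrix \<Rightarrow> matrix \<Rightarrow> matrix"
  where "bracket N X Y = mat_mul N X Y - mat_mul N Y X"

definition mat_vec :: "nat \<Rightarrow> matrix \<Rightarrow> (nat \<Rightarrow> complex) \<Rightarrow> nat \<Rightarrow> complex"
  where "mat_vec N X u = (\<lambda>i. \<Sum>j=1..N. X (i, j) * u j)"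

definition symp_form :: "nat \<Rightarrow> (nat \<Rightarrow> complex) \<Rightarrow> (nat \<Rightarrow> complex) \<Rightarrow> complex"
  where "symp_form n u w = (\<Sum>i=1..n. u i * w (n + i) - u (n + i) * w i)"

definition odd_sp :: "nat \<Rightarrow> matrix set"
  where "odd_sp n = {X \<in> gl (2 * n + 1). \<forall>u w.
    symp_form n (mat_vec (2 * n + 1) X u) w + symp_form n u (mat_vec (2 * n + 1) X w) = 0}"

text \<open>\<open>\<ss>\<pp>\<^sub>2\<^sub>n\<close> as the upper left block of \<open>\<ss>\<pp>\<^sub>2\<^sub>n\<^sub>+\<^sub>1\<close>.\<close>

definition even_sp :: "nat \<Rightarrow> matrix set"
  where "even_sp n = odd_sp n \<inter> gl (2 * n)"

definition cartan :: "nat \<Rightarrow> matrix set"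
  where "cartan n = cfun.span {unit_vec (i, i) - unit_vec (n + i, n + i) |i. i \<in> {1..n}}"

definition ext_cartan :: "nat \<Rightarrow> matrix set"
  where "ext_cartan n =
    cfun.span ({unit_vec (i, i) - unit_vec (n + i, n + i) |i. i \<in> {1..n}} \<union> {unit_vec (2 * n + 1, 2 * n + 1)})"

text \<open>
  Weights, i.e. elements of the dual of the extended Cartan subalgebra, are given by their
  coordinates in the dual basis: index \<open>i \<in> {1..n}\<close> stands for \<open>\<epsilon>\<^sub>i\<close> and
  index \<open>n + 1\<close> for \<open>\<delta>\<close>.
\<close>

type_synonym weight = "nat \<Rightarrow> complex"

definition eps :: "nat \<Rightarrow> weight"
  where "eps i = unit_vec i"

definition del_wt :: "nat \<Rightarrow> weight"
  where "del_wt n = unit_vec (n + 1)"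

definition weights :: "nat \<Rightarrow> weight set"
  where "weights n = cfun.span (eps ` {1..n} \<union> {del_wt n})"

definition pairing :: "nat \<Rightarrow> weight \<Rightarrow> matrix \<Rightarrow> complex"
  where "pairing n \<mu> H =
    (\<Sum>i=1..n. \<mu> i * H (i, i)) + \<mu> (n + 1) * H (2 * n + 1, 2 * n + 1)"

definition simple_root :: "nat \<Rightarrow> nat \<Rightarrow> weight"
  where "simple_root n i = (if i < n then eps i - eps (i + 1) else 2 *\<^sub>C eps n)"

definition ext_root :: "nat \<Rightarrow> weight"
  where "ext_root n = eps n + del_wt n"

definition fund_weight :: "nat \<Rightarrow> weight"
  where "fund_weight i = (\<Sum>k=1..i. eps k)"

text \<open>
  The poset elements \<open>\<alpha>\<^sub>i\<^sub>,\<^sub>j\<close> (\<open>Plain i j\<close>) and their barred versions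
  (\<open>Bar i j\<close>).
\<close>

datatype elt = Plain nat nat | Bar nat nat

definition poset :: "nat \<Rightarrow> elt set"
  where "poset n = {Plain i j |i j. 1 \<le> i \<and> i \<le> j \<and> j \<le> n} \<union> {Bar i j |i j. 1 \<le> i \<and> i \<le> j \<and> j \<le> n}"

fun elt_weight :: "nat \<Rightarrow> elt \<Rightarrow> weight"
  where
    "elt_weight n (Plain i j) =
      (if j < n then \<Sum>k=i..j. simple_root n k else (\<Sum>k=i..n. simple_root n k) - ext_root n)"
  | "elt_weight n (Bar i j) = (\<Sum>k=i..n. simple_root n k) + (\<Sum>k=j..<n. simple_root n k)"

text \<open>The elements \<open>Plain i n\<close> are not roots of \<open>\<ss>\<pp>\<^sub>2\<^sub>n\<close>.\<close>

definition pos_roots :: "nat \<Rightarrow> weight set"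
  where "pos_roots n = elt_weight n ` (poset n - {Plain i n |i. True})"

definition root_space :: "nat \<Rightarrow> weight \<Rightarrow> matrix set"
  where "root_space n \<alpha> =
    {X \<in> even_sp n. \<forall>H\<in>cartan n. bracket (2 * n + 1) H X = pairing n \<alpha> H *\<^sub>C X}"

definition n_minus :: "nat \<Rightarrow> matrix set"
  where "n_minus n = cfun.span (\<Union>\<alpha>\<in>pos_roots n. root_space n (- \<alpha>))"

definition ext_n_minus :: "nat \<Rightarrow> matrix set"
  where "ext_n_minus n = cfun.span (n_minus n \<union> {unit_vec (2 * n + 1, i) |i. i \<in> {1..n}})"


section \<open>Tensors and the representation\<close>

text \<open>
  A tensor in \<open>V\<^sup>\<otimes>\<^sup>k\<close>, \<open>dim V = N\<close>, is given by its coordinates: \<open>T w\<close> is the coefficient of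
  the basis tensor \<open>e\<^bsub>w!0\<^esub> \<otimes> \<dots> \<otimes> e\<^bsub>w!(k-1)\<^esub>\<close>.
\<close>

type_synonym tensor = "nat list \<Rightarrow> complex"

definition tensor_words :: "nat \<Rightarrow> nat \<Rightarrow> nat list set"
  where "tensor_words N k = {w. length w = k \<and> set w \<subseteq> {1..N}}"

definition tensors :: "nat \<Rightarrow> nat \<Rightarrow> tensor set"
  where "tensors N k = {T. \<forall>w. w \<notin> tensor_words N k \<longrightarrow> T w = 0}"

text \<open>The action of \<open>GL(V)\<close> on the tensor power, where \<open>g e\<^sub>j = (\<Sum>i. g\<^sub>i\<^sub>j e\<^sub>i)\<close>.\<close>

definition group_act :: "nat \<Rightarrow> matrix \<Rightarrow> tensor \<Rightarrow> tensor"
  where "group_act N g T =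
    (\<lambda>w. \<Sum>u\<in>tensor_words N (length w). (\<Prod>p<length w. g (w ! p, u ! p)) * T u)"

text \<open>The corresponding derivation action of its Lie algebra.\<close>

definition lie_act :: "nat \<Rightarrow> matrix \<Rightarrow> tensor \<Rightarrow> tensor"
  where "lie_act N X T =
    (\<lambda>w. \<Sum>p<length w. \<Sum>j=1..N. X (w ! p, j) * T (w[p := j]))"

text \<open>
  The right action of the symmetric group by place permutation,
  \<open>(v\<^sub>0 \<otimes> \<dots> \<otimes> v\<^bsub>k-1\<^esub>) \<cdot> \<sigma> = v\<^bsub>\<sigma>(0)\<^esub> \<otimes> \<dots> \<otimes> v\<^bsub>\<sigma>(k-1)\<^esub>\<close>.
\<close>

definition perm_act :: "tensor \<Rightarrow> (nat \<Rightarrow> nat) \<Rightarrow> tensor"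
  where "perm_act T \<sigma> = (\<lambda>w. T (permute_list (inv \<sigma>) w))"

text \<open>The Young diagram of \<open>\<lambda> = m\<^sub>1\<omega>\<^sub>1 + \<dots> + m\<^sub>n\<omega>\<^sub>n\<close>.\<close>

definition part :: "nat \<Rightarrow> (nat \<Rightarrow> nat) \<Rightarrow> nat \<Rightarrow> nat"
  where "part n m i = (\<Sum>j=i..n. m j)"

definition part_size :: "nat \<Rightarrow> (nat \<Rightarrow> nat) \<Rightarrow> nat"
  where "part_size n m = (\<Sum>i=1..n. part n m i)"

text \<open>
  The boxes of the Young diagram as pairs (row, column), listed row by row: the list
  assigns to each tensor position its box in the row reading tableau.
\<close>

definition boxes :: "nat \<Rightarrow> (nat \<Rightarrow> nat) \<Rightarrow> (nat \<times> nat) list"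
  where "boxes n m = concat (map (\<lambda>i. map (\<lambda>j. (i, j)) [0..<part n m i]) [1..<n + 1])"

definition row_stab :: "nat \<Rightarrow> (nat \<Rightarrow> nat) \<Rightarrow> (nat \<Rightarrow> nat) set"
  where "row_stab n m = {\<sigma>. \<sigma> permutes {..<part_size n m} \<and>
    (\<forall>p<part_size n m. fst (boxes n m ! \<sigma> p) = fst (boxes n m ! p))}"

definition col_stab :: "nat \<Rightarrow> (nat \<Rightarrow> nat) \<Rightarrow> (nat \<Rightarrow> nat) set"
  where "col_stab n m = {\<sigma>. \<sigma> permutes {..<part_size n m} \<and>
    (\<forall>p<part_size n m. snd (boxes n m ! \<sigma> p) = snd (boxes n m ! p))}"

text \<open>
  The Young symmetrizer \<open>c\<^sub>\<lambda> = (\<Sum>\<sigma>. \<sigma>) (\<Sum>\<tau>. sgn \<tau> \<tau>)\<close> acting from the right: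
  rows are symmetrized first, then columns are antisymmetrized.
\<close>

definition young_symmetrizer :: "nat \<Rightarrow> (nat \<Rightarrow> nat) \<Rightarrow> tensor \<Rightarrow> tensor"
  where "young_symmetrizer n m T =
    (\<Sum>\<sigma>\<in>row_stab n m. \<Sum>\<tau>\<in>col_stab n m. of_int (sign \<tau>) *\<^sub>C perm_act T (\<sigma> \<circ> \<tau>))"

definition schur_module :: "nat \<Rightarrow> (nat \<Rightarrow> nat) \<Rightarrow> tensor set"
  where "schur_module n m = young_symmetrizer n m ` tensors (2 * n + 1) (part_size n m)"

definition insert_at :: "nat \<Rightarrow> 'a \<Rightarrow> 'a list \<Rightarrow> 'a list"
  where "insert_at p x xs = take p xs @ x # drop p xs"

text \<open>Contraction with \<open>\<omega>\<close> in tensor positions \<open>p < q\<close>.\<close>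

definition contraction :: "nat \<Rightarrow> nat \<Rightarrow> nat \<Rightarrow> tensor \<Rightarrow> tensor"
  where "contraction n p q T =
    (\<lambda>w. \<Sum>a=1..2 * n + 1. \<Sum>b=1..2 * n + 1.
      symp_form n (unit_vec a) (unit_vec b) * T (insert_at q b (insert_at p a w)))"

definition trace_free_module :: "nat \<Rightarrow> (nat \<Rightarrow> nat) \<Rightarrow> tensor set"
  where "trace_free_module n m =
    {T \<in> schur_module n m. \<forall>p q. p < q \<and> q < part_size n m \<longrightarrow> contraction n p q T = 0}"

text \<open>
  Nonzero, and \<open>diag(t\<^sub>1,\<dots>,t\<^bsub>2n+1\<^esub>)\<close> acts by
  \<open>t\<^sub>1^\<lambda>\<^sub>1 \<cdots> t\<^sub>n^\<lambda>\<^sub>n\<close>; this determines the vector up to a scalar.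
\<close>

definition highest_weight_vector :: "nat \<Rightarrow> (nat \<Rightarrow> nat) \<Rightarrow> tensor \<Rightarrow> bool"
  where "highest_weight_vector n m v \<longleftrightarrow>
    v \<in> schur_module n m \<and> v \<noteq> 0 \<and>
    (\<forall>t :: nat \<Rightarrow> complex. (\<forall>i\<in>{1..2 * n + 1}. t i \<noteq> 0) \<longrightarrow>
      group_act (2 * n + 1) (\<lambda>(i, j). if i = j then t i else 0) v =
        (\<Prod>i=1..n. t i ^ part n m i) *\<^sub>C v)"

definition weight_space :: "nat \<Rightarrow> tensor set \<Rightarrow> weight \<Rightarrow> tensor set"
  where "weight_space n W \<mu> =
    {T \<in> W. \<forall>H\<in>ext_cartan n. lie_act (2 * n + 1) H T = pairing n \<mu> H *\<^sub>C T}"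

text \<open>\<open>U\<^sup>s(\<nn>) v\<close> for the extended \<open>\<nn>\<close>: the span of all \<open>x\<^sub>1 \<cdots> x\<^sub>r v\<close> with \<open>r \<le> s\<close>.\<close>

definition pbw_filtration :: "nat \<Rightarrow> tensor \<Rightarrow> nat \<Rightarrow> tensor set"
  where "pbw_filtration n v s =
    cfun.span {foldr (lie_act (2 * n + 1)) xs v |xs. set xs \<subseteq> ext_n_minus n \<and> length xs \<le> s}"

text \<open>
  The \<open>\<mu>\<close>-weight space of the \<open>s\<close>-th piece of the filtration of a representation \<open>W\<close>
  generated from \<open>v\<close>, i.e. of the part of \<open>U\<^sup>s(\<nn>) v\<close> of weight \<open>\<mu>\<close>.
\<close>

definition pbw_weight_space :: "nat \<Rightarrow> tensor set \<Rightarrow> tensor \<Rightarrow> weight \<Rightarrow> nat \<Rightarrow> tensor set"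
  where "pbw_weight_space n W v \<mu> s = weight_space n W \<mu> \<inter> pbw_filtration n v s"

definition pbw_multiplicity :: "nat \<Rightarrow> tensor set \<Rightarrow> tensor \<Rightarrow> weight \<Rightarrow> nat \<Rightarrow> nat"
  where "pbw_multiplicity n W v \<mu> s =
    quot_dim (pbw_weight_space n W v \<mu> s)
      (case s of 0 \<Rightarrow> {0} | Suc r \<Rightarrow> pbw_weight_space n W v \<mu> r)"

text \<open>
  Characters are elements of the group ring of the weights over \<open>\<int>[q]\<close>:
  \<open>e\<^sup>\<mu> q\<^sup>s\<close> is \<open>char_monom \<mu> s\<close>. The \<open>-1\<close>st piece of the filtration is zero.
\<close>

definition char_monom :: "weight \<Rightarrow> nat \<Rightarrow> weight \<Rightarrow>\<^sub>0 int poly"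
  where "char_monom \<mu> s = Poly_Mapping.single \<mu> (monom 1 s)"

definition q_character :: "nat \<Rightarrow> tensor set \<Rightarrow> tensor \<Rightarrow> weight \<Rightarrow>\<^sub>0 int poly"
  where "q_character n W v =
    (\<Sum>(\<mu>, s) | \<mu> \<in> weights n \<and> pbw_multiplicity n W v \<mu> s \<noteq> 0.
      of_nat (pbw_multiplicity n W v \<mu> s) * char_monom \<mu> s)"


section \<open>The polytope\<close>

inductive arrow :: "nat \<Rightarrow> elt \<Rightarrow> elt \<Rightarrow> bool" for n
  where
    row_plain: "1 \<le> i \<Longrightarrow> i \<le> j \<Longrightarrow> j + 1 \<le> n \<Longrightarrow> arrow n (Plain i j) (Plain i (j + 1))"
  | row_middle: "1 \<le> i \<Longrightarrow> i \<le> n \<Longrightarrow> arrow n (Plain i n) (Bar i n)"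
  | row_bar: "1 \<le> i \<Longrightarrow> i \<le> j \<Longrightarrow> j + 1 \<le> n \<Longrightarrow> arrow n (Bar i (j + 1)) (Bar i j)"
  | col_plain: "1 \<le> i \<Longrightarrow> i + 1 \<le> j \<Longrightarrow> j \<le> n \<Longrightarrow> arrow n (Plain i j) (Plain (i + 1) j)"
  | col_bar: "1 \<le> i \<Longrightarrow> i + 1 \<le> j \<Longrightarrow> j \<le> n \<Longrightarrow> arrow n (Bar i j) (Bar (i + 1) j)"

definition arrow_path :: "nat \<Rightarrow> elt list \<Rightarrow> elt \<Rightarrow> elt \<Rightarrow> bool"
  where "arrow_path n p a b \<longleftrightarrow>
    p \<noteq> [] \<and> set p \<subseteq> poset n \<and> hd p = a \<and> last p = b \<and> successively (arrow n) p"

text \<open>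
  Symplectic Dyck paths are the paths from some \<open>Plain i i\<close> to \<open>Plain j j\<close> or \<open>Bar j j\<close>
  with \<open>i \<le> j\<close>. Points are extended by zero outside the poset.
\<close>

definition FFLV :: "nat \<Rightarrow> (nat \<Rightarrow> nat) \<Rightarrow> (elt \<Rightarrow> real) set"
  where "FFLV n m = {s.
    (\<forall>\<alpha>. \<alpha> \<notin> poset n \<longrightarrow> s \<alpha> = 0) \<and> (\<forall>\<alpha>. s \<alpha> \<ge> 0) \<and>
    (\<forall>i j p. i \<le> j \<and> arrow_path n p (Plain i i) (Plain j j) \<longrightarrow>
      (\<Sum>\<alpha>\<leftarrow>p. s \<alpha>) \<le> (\<Sum>k=i..j. real (m k))) \<and>
    (\<forall>i j p. i \<le> j \<and> arrow_path n p (Plain i i) (Bar j j) \<longrightarrow>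
      (\<Sum>\<alpha>\<leftarrow>p. s \<alpha>) \<le> (\<Sum>k=i..n. real (m k)))}"

definition FFLV_int :: "nat \<Rightarrow> (nat \<Rightarrow> nat) \<Rightarrow> (elt \<Rightarrow> nat) set"
  where "FFLV_int n m = {s. (\<lambda>\<alpha>. real (s \<alpha>)) \<in> FFLV n m}"

definition pt_wt :: "nat \<Rightarrow> (elt \<Rightarrow> nat) \<Rightarrow> weight"
  where "pt_wt n s = (\<Sum>\<alpha>\<in>poset n. of_nat (s \<alpha>) *\<^sub>C elt_weight n \<alpha>)"

definition pt_deg :: "nat \<Rightarrow> (elt \<Rightarrow> nat) \<Rightarrow> nat"
  where "pt_deg n s = (\<Sum>\<alpha>\<in>poset n. s \<alpha>)"

definition highest_weight :: "nat \<Rightarrow> (nat \<Rightarrow> nat) \<Rightarrow> weight"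
  where "highest_weight n m = (\<Sum>i=1..n. of_nat (m i) *\<^sub>C fund_weight i)"

end

theory Submission
  imports Defs "HOL-Library.Multiset"
begin

text \<open>
  Up to a scalar, \<open>v\<close> is the tensor product over the columns of the Young diagram of the vectors
  \<open>e\<^sub>1 \<and> \<dots> \<and> e\<^sub>h\<close>, where \<open>h\<close> is the height of the column.

  Spanning: a rank one matrix \<open>X\<close> with \<open>X\<^sup>2 = 0\<close> acts with square zero on every column, so \<open>X\<^sup>D v = 0\<close> as
  soon as \<open>D\<close> exceeds the number of columns not killed by \<open>X\<close>. Modulo lower filtration pieces \<open>X\<close> may be
  replaced by its strictly lower triangular part, whose coordinate at a root is a product \<open>\<eta>\<^sub>i \<eta>\<^sub>c\<close> of
  free parameters. Comparing coefficients of monomials in the \<open>\<eta>\<close> gives relations between the PBW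
  monomials with a given multiset of letters. Among those the one supported on a chain, in
  particular on a Dyck path, corresponds to a nested matching of the letters and is the unique one
  minimising the sum of the \<open>i \<cdot> c\<close>. Hence a monomial violating the inequality of a Dyck path is a
  combination of monomials with a larger sum, and the monomials in the polytope span.

  Independence: by the transfer map, a lattice point of the polytope splits into antichains, one for
  each column of the diagram. Replacing in each column the letters of the rows of the antichain by
  those of its columns gives a word, and the coordinate at this word vanishes on every other
  monomial of smaller degree, or of the same degree and at least the same sum, by the
  rearrangement inequality.
\<close>

text \<open>Both halves use one order on monomials: degree first, then the sum of the products
  \<open>i * c\<close>. Straightening moves upwards in this order, and the test coordinate of a
  lattice point vanishes at every other monomial of its degree with at least its sum, so a relation
  is refuted at its top-degree term of least sum. Pairs of letters appear because X belongs to the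
  algebra exactly when \<omega>(u, X w) is a symmetric form: a square of a vector gives an element
  of rank one whose coordinates are products of two coordinates of the vector. The product
  \<open>i * c\<close> serves both halves. Exchanging partners changes the sum by a product of two
  differences of letters, so nested matchings are strict minima and monotone matchings strict
  maxima. It is also symmetric, as it must be, since a barred root vector has two entries with row
  and column letters exchanged. Squares only kill the columns shorter than i. The smaller bound for
  paths ending at an unbarred \<open>Plain j j\<close> with j < n requires killing the columns
  taller than j too. This is done inside gl(n), embedded as diag(A, -A^T), where a traceless rank
  one matrix annihilates every column whose span it preserves.\<close>

declare One_nat_def [simp del]

section \<open>Matrices of the odd symplectic Lie algebra\<close>

text \<open>
  The basis of \<open>V\<close> is reordered as \<open>e\<^sub>1, \<dots>, e\<^sub>n, e\<^bsub>2n+1\<^esub>, e\<^bsub>2n\<^esub>, \<dots>, e\<^bsub>n+1\<^esub>\<close>; \<open>place\<close> is the position in this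
  order, in which the extended \<open>\<nn>\<^sup>-\<close> consists of the strictly lower triangular matrices of \<open>\<ss>\<pp>\<^bsub>2n+1\<^esub>\<close>.
\<close>

definition place :: "nat \<Rightarrow> nat \<Rightarrow> nat"
  where "place n a = (if a \<le> n then a else if a \<le> 2 * n then 3 * n + 2 - a else n + 1)"

text \<open>The partner of a basis vector under \<omega>. The radical index \<open>2 * n + 1\<close>
  is its own partner and gets \<open>idx_sign\<close> 0, so sums over all indices treat it
  uniformly.\<close>

definition dual_idx :: "nat \<Rightarrow> nat \<Rightarrow> nat"
  where "dual_idx n a = (if a \<le> n then n + a else if a \<le> 2 * n then a - n else a)"

definition idx_sign :: "nat \<Rightarrow> nat \<Rightarrow> complex"
  where "idx_sign n a = (if a \<le> n then 1 else if a \<le> 2 * n then - 1 else 0)"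

lemma dual_idx_in: "a \<in> {1..2 * n + 1} \<Longrightarrow> dual_idx n a \<in> {1..2 * n + 1}"
  by (auto simp: dual_idx_def)

lemma dual_idx_dual_idx [simp]: "a \<in> {1..2 * n + 1} \<Longrightarrow> dual_idx n (dual_idx n a) = a"
  by (auto simp: dual_idx_def)

lemma idx_sign_dual [simp]: "a \<in> {1..2 * n + 1} \<Longrightarrow> idx_sign n (dual_idx n a) = - idx_sign n a"
  by (auto simp: idx_sign_def dual_idx_def)

lemma bij_dual_idx: "bij_betw (dual_idx n) {1..2 * n + 1} {1..2 * n + 1}"
  by (rule bij_betw_byWitness[where f' = "dual_idx n"]) (use dual_idx_in in \<open>blast intro: dual_idx_dual_idx\<close>)+

lemma sum_dual_idx: "(\<Sum>a=1..2 * n + 1. f (dual_idx n a)) = (\<Sum>a=1..2 * n + 1. f a)"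
  using sum.reindex_bij_betw[OF bij_dual_idx, of f n] by simp

lemma sum_three_blocks:
  fixes g :: "nat \<Rightarrow> 'b::comm_monoid_add"
  shows "(\<Sum>a=1..2 * n + 1. g a) = (\<Sum>i=1..n. g i) + (\<Sum>i=1..n. g (n + i)) + g (2 * n + 1)"
proof -
  have "(\<Sum>a=1..2*n+1. g a) = (\<Sum>a=1..2*n. g a) + g (2*n+1)" by (simp add: One_nat_def)
  also have "(\<Sum>a=1..2*n. g a) = (\<Sum>a=1..n. g a) + (\<Sum>a=n+1..2*n. g a)"
    using sum.ub_add_nat[of 1 n g n] by (simp add: mult_2)
  also have "(\<Sum>a=n+1..2*n. g a) = (\<Sum>i=1..n. g (n + i))"
    using sum.shift_bounds_cl_nat_ivl[of g 1 n n] by (simp add: mult_2 add.commute)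
  finally show ?thesis .
qed

lemma symp_form_alt:
  "symp_form n u w = (\<Sum>a=1..2 * n + 1. idx_sign n a * u a * w (dual_idx n a))"
proof -
  have "(\<Sum>i=1..n. idx_sign n i * u i * w (dual_idx n i)) = (\<Sum>i=1..n. u i * w (n + i))"
    by (rule sum.cong) (auto simp: idx_sign_def dual_idx_def)
  moreover have "(\<Sum>i=1..n. idx_sign n (n + i) * u (n + i) * w (dual_idx n (n + i))) = (\<Sum>i=1..n. - (u (n + i) * w i))"
    by (rule sum.cong) (auto simp: idx_sign_def dual_idx_def)
  moreover have "idx_sign n (2 * n + 1) = 0" by (simp add: idx_sign_def)
  ultimately show ?thesis unfolding sum_three_blocks symp_form_def
    by (simp add: sum_subtractf sum_negf)
qed

lemma symp_form_alt':
  "symp_form n u w = - (\<Sum>a=1..2 * n + 1. idx_sign n a * u (dual_idx n a) * w a)"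
proof -
  have "symp_form n u w = (\<Sum>a=1..2 * n + 1. idx_sign n (dual_idx n a) * u (dual_idx n a) * w (dual_idx n (dual_idx n a)))"
    unfolding symp_form_alt by (rule sum_dual_idx[symmetric])
  also have "\<dots> = (\<Sum>a=1..2 * n + 1. - (idx_sign n a * u (dual_idx n a) * w a))"
    by (rule sum.cong) (auto simp del: atLeastAtMost_iff)
  finally show ?thesis by (simp add: sum_negf)
qed

lemma symp_form_matrix:
  "symp_form n (mat_vec (2 * n + 1) X u) w + symp_form n u (mat_vec (2 * n + 1) X w) =
    (\<Sum>a=1..2 * n + 1. \<Sum>b=1..2 * n + 1.
      (idx_sign n b * X (dual_idx n b, a) - idx_sign n a * X (dual_idx n a, b)) * u b * w a)"
proof -
  have 1: "symp_form n (mat_vec (2 * n + 1) X u) w = - (\<Sum>a=1..2 * n + 1. \<Sum>b=1..2 * n + 1. idx_sign n a * X (dual_idx n a, b) * u b * w a)"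
    unfolding symp_form_alt' mat_vec_def by (simp only: sum_distrib_left sum_distrib_right mult.assoc)
  have "symp_form n u (mat_vec (2 * n + 1) X w) = (\<Sum>b=1..2 * n + 1. \<Sum>a=1..2 * n + 1. idx_sign n b * u b * (X (dual_idx n b, a) * w a))"
    unfolding symp_form_alt mat_vec_def by (simp only: sum_distrib_left)
  also have "\<dots> = (\<Sum>a=1..2 * n + 1. \<Sum>b=1..2 * n + 1. idx_sign n b * u b * (X (dual_idx n b, a) * w a))"
    by (rule sum.swap)
  finally show ?thesis unfolding 1
    by (simp only: sum_subtractf[symmetric] add.commute[of "- _"] diff_conv_add_uminus[symmetric]) (simp add: algebra_simps)
qed

lemma sum_unit_vec2:
  assumes "finite A" "a \<in> A" "b \<in> A"
  shows "(\<Sum>a'\<in>A. \<Sum>b'\<in>A. f a' b' * unit_vec b b' * unit_vec a a') = f a b"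
proof -
  have "(\<Sum>a'\<in>A. \<Sum>b'\<in>A. f a' b' * unit_vec b b' * unit_vec a a') =
      (\<Sum>a'\<in>A. if a' = a then \<Sum>b'\<in>A. if b' = b then f a b else 0 else 0)"
    by (intro sum.cong refl) (auto simp: unit_vec_def intro!: sum.cong)
  thus ?thesis using assms by simp
qed

text \<open>Invariance is bilinear, so it can be tested on unit vectors. The left-hand entry is
  \<omega>(e_a, X e_b), and the condition says that this form is symmetric in a and b. For a = 2n+1
  it forces the last column to vanish off the diagonal.\<close>

lemma odd_sp_iff:
  "X \<in> odd_sp n \<longleftrightarrow> X \<in> gl (2 * n + 1) \<and>
    (\<forall>a\<in>{1..2 * n + 1}. \<forall>b\<in>{1..2 * n + 1}.
      idx_sign n a * X (dual_idx n a, b) = idx_sign n b * X (dual_idx n b, a))"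
proof safe
  assume X: "X \<in> odd_sp n"
  thus "X \<in> gl (2 * n + 1)" by (simp add: odd_sp_def)
  fix a b assume a: "a \<in> {1..2 * n + 1}" and b: "b \<in> {1..2 * n + 1}"
  let ?f = "\<lambda>a b. idx_sign n b * X (dual_idx n b, a) - idx_sign n a * X (dual_idx n a, b)"
  have "0 = (\<Sum>a'=1..2 * n + 1. \<Sum>b'=1..2 * n + 1. ?f a' b' * unit_vec b b' * unit_vec a a')"
    using X unfolding symp_form_matrix[symmetric] by (simp add: odd_sp_def)
  also have "\<dots> = ?f a b" using a b by (intro sum_unit_vec2) simp_all
  finally show "idx_sign n a * X (dual_idx n a, b) = idx_sign n b * X (dual_idx n b, a)" by simp
next
  assume X: "X \<in> gl (2 * n + 1)" and *: "\<forall>a\<in>{1..2 * n + 1}. \<forall>b\<in>{1..2 * n + 1}.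
      idx_sign n a * X (dual_idx n a, b) = idx_sign n b * X (dual_idx n b, a)"
  have "symp_form n (mat_vec (2 * n + 1) X u) w + symp_form n u (mat_vec (2 * n + 1) X w) = 0" for u w
    unfolding symp_form_matrix using * by (intro sum.neutral ballI) (simp del: atLeastAtMost_iff)
  with X show "X \<in> odd_sp n" by (simp add: odd_sp_def)
qed

lemma subspace_gl: "cfun.subspace (gl N)"
proof (rule cfun.subspaceI)
  fix X Y c assume "X \<in> gl N"
  thus "c *\<^sub>C X \<in> gl N" unfolding gl_def by auto
  assume "Y \<in> gl N"
  show "X + Y \<in> gl N" unfolding gl_def
  proof (intro CollectI allI impI)
    fix i j assume "(X + Y) (i, j) \<noteq> 0"
    hence "X (i, j) \<noteq> 0 \<or> Y (i, j) \<noteq> 0" by auto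
    thus "i \<in> {1..N} \<and> j \<in> {1..N}" using \<open>X \<in> gl N\<close> \<open>Y \<in> gl N\<close> unfolding gl_def by blast
  qed
qed (simp add: gl_def)

lemma subspace_odd_sp: "cfun.subspace (odd_sp n)"
proof (rule cfun.subspaceI)
  show "0 \<in> odd_sp n" using cfun.subspace_0[OF subspace_gl] unfolding odd_sp_iff by simp
  fix X Y c assume X: "X \<in> odd_sp n"
  show "c *\<^sub>C X \<in> odd_sp n"
    using X cfun.subspace_scale[OF subspace_gl] unfolding odd_sp_iff
    by (simp add: mult.left_commute[of _ c] del: atLeastAtMost_iff)
  assume Y: "Y \<in> odd_sp n"
  show "X + Y \<in> odd_sp n"
    using X Y cfun.subspace_add[OF subspace_gl] unfolding odd_sp_iff
    by (simp add: algebra_simps del: atLeastAtMost_iff)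
qed

lemma mat_mul_gl:
  assumes "X \<in> gl N" "Y \<in> gl N" shows "mat_mul N X Y \<in> gl N"
  unfolding gl_def
proof (intro CollectI allI impI)
  fix i j assume "mat_mul N X Y (i, j) \<noteq> 0"
  then obtain k where "X (i, k) * Y (k, j) \<noteq> 0"
    unfolding mat_mul_def by (auto elim: sum.not_neutral_contains_not_neutral)
  thus "i \<in> {1..N} \<and> j \<in> {1..N}" using assms unfolding gl_def by auto
qed

lemma bracket_apply:
  "bracket N X Y (a, b) = (\<Sum>k=1..N. X (a, k) * Y (k, b)) - (\<Sum>k=1..N. Y (a, k) * X (k, b))"
  by (simp add: bracket_def mat_mul_def)

lemma bracket_odd_sp:
  assumes X: "X \<in> odd_sp n" and Y: "Y \<in> odd_sp n"
  shows "bracket (2 * n + 1) X Y \<in> odd_sp n"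
proof -
  let ?N = "2 * n + 1"
  have XY: "X \<in> gl ?N" "Y \<in> gl ?N" using X Y by (auto simp: odd_sp_def)
  have gl: "bracket ?N X Y \<in> gl ?N"
    unfolding bracket_def using mat_mul_gl[OF XY] mat_mul_gl[OF XY(2,1)] cfun.subspace_diff[OF subspace_gl] by blast
  \<comment> \<open>This is \<omega>(e_a, X Y e_b) = - \<omega>(e_b, Y X e_a): both factors are
    moved across the form. Antisymmetrising in X and Y gives the symmetry required of the
    bracket.\<close>
  have key: "idx_sign n a * (\<Sum>k=1..?N. X (dual_idx n a, k) * Y (k, b)) =
      - idx_sign n b * (\<Sum>k=1..?N. Y (dual_idx n b, k) * X (k, a))"
    if X: "X \<in> odd_sp n" and Y: "Y \<in> odd_sp n" and a: "a \<in> {1..?N}" and b: "b \<in> {1..?N}" for X Y a b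
  proof -
    have "idx_sign n a * (\<Sum>k=1..?N. X (dual_idx n a, k) * Y (k, b)) =
      (\<Sum>k=1..?N. (idx_sign n k * X (dual_idx n k, a)) * Y (k, b))"
      unfolding sum_distrib_left mult.assoc[symmetric]
      by (rule sum.cong) (use X a in \<open>auto simp: odd_sp_iff simp del: atLeastAtMost_iff\<close>)
    also have "\<dots> = (\<Sum>k=1..?N. (idx_sign n (dual_idx n k) * X (dual_idx n (dual_idx n k), a)) * Y (dual_idx n k, b))"
      by (rule sum_dual_idx[symmetric])
    also have "\<dots> = (\<Sum>k=1..?N. - (X (k, a) * (idx_sign n k * Y (dual_idx n k, b))))"
      by (rule sum.cong) (auto simp del: atLeastAtMost_iff)
    also have "\<dots> = (\<Sum>k=1..?N. - (X (k, a) * (idx_sign n b * Y (dual_idx n b, k))))"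
      by (rule sum.cong) (use Y b in \<open>auto simp: odd_sp_iff simp del: atLeastAtMost_iff\<close>)
    also have "\<dots> = - idx_sign n b * (\<Sum>k=1..?N. Y (dual_idx n b, k) * X (k, a))"
      by (simp add: sum_distrib_left sum_negf mult_ac)
    finally show ?thesis .
  qed
  show ?thesis unfolding odd_sp_iff
  proof (intro conjI ballI)
    fix a b assume ab: "a \<in> {1..?N}" "b \<in> {1..?N}"
    show "idx_sign n a * bracket ?N X Y (dual_idx n a, b) = idx_sign n b * bracket ?N X Y (dual_idx n b, a)"
      using key[OF X Y ab] key[OF Y X ab] unfolding bracket_apply right_diff_distrib by simp
  qed (rule gl)
qed

section \<open>Splitting into strictly lower and weakly upper triangular matrices\<close>

definition lower_sp :: "nat \<Rightarrow> matrix set"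
  where "lower_sp n = {X \<in> odd_sp n. \<forall>a b. X (a, b) \<noteq> 0 \<longrightarrow> place n b < place n a}"

definition upper_sp :: "nat \<Rightarrow> matrix set"
  where "upper_sp n = {X \<in> odd_sp n. \<forall>a b. X (a, b) \<noteq> 0 \<longrightarrow> place n a \<le> place n b}"

lemma lower_sp_odd_sp: "X \<in> lower_sp n \<Longrightarrow> X \<in> odd_sp n"
  by (simp add: lower_sp_def)

lemma upper_sp_odd_sp: "X \<in> upper_sp n \<Longrightarrow> X \<in> odd_sp n"
  by (simp add: upper_sp_def)

lemma subspace_lower_sp: "cfun.subspace (lower_sp n)"
  using subspace_odd_sp[of n] unfolding cfun.subspace_def lower_sp_def
  by auto (metis add.right_neutral)

lemma bracket_lower_sp:
  assumes X: "X \<in> lower_sp n" and Y: "Y \<in> lower_sp n"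
  shows "bracket (2 * n + 1) X Y \<in> lower_sp n"
proof -
  have *: "place n b < place n a" if "(\<Sum>k=1..2*n+1. X (a, k) * Y (k, b)) \<noteq> 0"
    "X \<in> lower_sp n" "Y \<in> lower_sp n" for X Y a b
  proof -
    from that obtain k where "X (a, k) * Y (k, b) \<noteq> 0"
      by (meson sum.not_neutral_contains_not_neutral)
    with that have "place n k < place n a" "place n b < place n k" by (auto simp: lower_sp_def)
    thus ?thesis by simp
  qed
  show ?thesis unfolding lower_sp_def
  proof (intro CollectI conjI allI impI)
    show "bracket (2 * n + 1) X Y \<in> odd_sp n" using X Y bracket_odd_sp unfolding lower_sp_def by blast
    fix a b assume "bracket (2 * n + 1) X Y (a, b) \<noteq> 0"
    hence "(\<Sum>k=1..2*n+1. X (a, k) * Y (k, b)) \<noteq> 0 \<or> (\<Sum>k=1..2*n+1. Y (a, k) * X (k, b)) \<noteq> 0"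
      unfolding bracket_apply by auto
    thus "place n b < place n a" using *[of X a Y b] *[of Y a X b] X Y by blast
  qed
qed

definition lower_part :: "nat \<Rightarrow> matrix \<Rightarrow> matrix"
  where "lower_part n X = (\<lambda>(a, b). if place n b < place n a then X (a, b) else 0)"

lemma place_dual:
  "a \<in> {1..2 * n + 1} \<Longrightarrow> place n (dual_idx n a) = 2 * n + 2 - place n a"
  by (auto simp: place_def dual_idx_def)

lemma place_in: "a \<in> {1..2 * n + 1} \<Longrightarrow> place n a \<in> {1..2 * n + 1}"
  by (auto simp: place_def)

text \<open>Duality reverses the order of places. Hence the symplectic relation pairs entries below
  the diagonal only with entries below the diagonal, and \<open>lower_part\<close> stays inside the
  algebra.\<close>

lemma place_dual_less:
  assumes "a \<in> {1..2 * n + 1}" "b \<in> {1..2 * n + 1}"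
  shows "place n b < place n (dual_idx n a) \<longleftrightarrow> place n a < place n (dual_idx n b)"
  using place_in[OF assms(1)] place_in[OF assms(2)] unfolding place_dual[OF assms(1)] place_dual[OF assms(2)]
  by auto

lemma lower_part_in: "X \<in> odd_sp n \<Longrightarrow> lower_part n X \<in> lower_sp n"
  by (auto simp: lower_sp_def odd_sp_iff lower_part_def gl_def place_dual_less
      simp del: atLeastAtMost_iff split: if_splits)

lemma upper_part_in:
  assumes "X \<in> odd_sp n" shows "X - lower_part n X \<in> upper_sp n"
proof -
  have "X - lower_part n X \<in> odd_sp n"
    using cfun.subspace_diff[OF subspace_odd_sp assms] lower_part_in[OF assms] lower_sp_odd_sp by blast
  thus ?thesis by (auto simp: upper_sp_def lower_part_def split: if_splits)
qed

section \<open>Root vectors\<close>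

text \<open>
  A poset element is encoded by its row \<open>i\<close> and its column \<open>c\<close> in the alphabet of the weights
  \<open>\<epsilon>\<^sub>1, \<dots>, \<epsilon>\<^sub>n, -\<delta>, -\<epsilon>\<^sub>n, \<dots>, -\<epsilon>\<^sub>1\<close> (numbered from 1), so that its weight is the sum of letters \<open>i\<close> and \<open>c\<close>.
  Then \<open>i \<le> c \<le> 2n + 1 - i\<close>, and an arrow lowers \<open>c\<close> or raises \<open>i\<close> by one.
\<close>

fun elt_row :: "elt \<Rightarrow> nat" where
  "elt_row (Plain i j) = i" | "elt_row (Bar i j) = i"

fun elt_col :: "nat \<Rightarrow> elt \<Rightarrow> nat" where
  "elt_col n (Plain i j) = 2 * n + 1 - j" | "elt_col n (Bar i j) = j"

lemma elt_bounds:
  assumes "\<alpha> \<in> poset n"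
  shows "1 \<le> elt_row \<alpha>" "elt_row \<alpha> \<le> n" "elt_row \<alpha> \<le> elt_col n \<alpha>" "elt_row \<alpha> + elt_col n \<alpha> \<le> 2 * n + 1"
  using assms by (auto simp: poset_def)

definition mk_elt :: "nat \<Rightarrow> nat \<Rightarrow> nat \<Rightarrow> elt"
  where "mk_elt n i c = (if c \<le> n then Bar i c else Plain i (2 * n + 1 - c))"

lemma mk_elt_in:
  "1 \<le> i \<Longrightarrow> i \<le> n \<Longrightarrow> i \<le> c \<Longrightarrow> i + c \<le> 2 * n + 1 \<Longrightarrow> mk_elt n i c \<in> poset n"
  by (auto simp: mk_elt_def poset_def)

lemma mk_elt_row [simp]: "elt_row (mk_elt n i c) = i"
  by (auto simp: mk_elt_def)

lemma mk_elt_col [simp]: "c \<le> 2 * n + 1 \<Longrightarrow> elt_col n (mk_elt n i c) = c"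
  by (auto simp: mk_elt_def)

lemma mk_elt_eq [simp]: "\<alpha> \<in> poset n \<Longrightarrow> mk_elt n (elt_row \<alpha>) (elt_col n \<alpha>) = \<alpha>"
  by (auto simp: mk_elt_def poset_def)

lemma elt_eqI:
  "\<alpha> \<in> poset n \<Longrightarrow> \<beta> \<in> poset n \<Longrightarrow> elt_row \<alpha> = elt_row \<beta> \<Longrightarrow> elt_col n \<alpha> = elt_col n \<beta> \<Longrightarrow> \<alpha> = \<beta>"
  by (metis mk_elt_eq)

lemma finite_poset [simp]: "finite (poset n)"
proof -
  have "poset n \<subseteq> (\<lambda>(i, c). mk_elt n i c) ` ({0..n} \<times> {0..2*n+1})"
  proof
    fix \<alpha> assume a: "\<alpha> \<in> poset n"
    hence "\<alpha> = (\<lambda>(i, c). mk_elt n i c) (elt_row \<alpha>, elt_col n \<alpha>)" by simp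
    moreover have "(elt_row \<alpha>, elt_col n \<alpha>) \<in> {0..n} \<times> {0..2*n+1}" using elt_bounds[OF a] by auto
    ultimately show "\<alpha> \<in> (\<lambda>(i, c). mk_elt n i c) ` ({0..n} \<times> {0..2*n+1})" by blast
  qed
  thus ?thesis by (rule finite_subset) simp
qed

text \<open>The basis vector whose weight is minus the letter \<open>c\<close>: a lowering operator
  of row i and column c sends e_i to the vector with this index.\<close>

definition col_idx :: "nat \<Rightarrow> nat \<Rightarrow> nat"
  where "col_idx n c = (if c \<le> n then n + c else if c = n + 1 then 2 * n + 1 else 2 * n + 2 - c)"

lemma col_idx_in: "c \<in> {1..2 * n + 1} \<Longrightarrow> col_idx n c \<in> {1..2 * n + 1}"
  by (auto simp: col_idx_def)

lemma place_col_idx: "c \<in> {1..2 * n + 1} \<Longrightarrow> place n (col_idx n c) = 2 * n + 2 - c"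
  by (auto simp: col_idx_def place_def)

lemma col_idx_place: "a \<in> {1..2 * n + 1} \<Longrightarrow> col_idx n (2 * n + 2 - place n a) = a"
  by (auto simp: col_idx_def place_def)

lemma col_idx_inj: "c \<in> {1..2 * n + 1} \<Longrightarrow> c' \<in> {1..2 * n + 1} \<Longrightarrow> col_idx n c = col_idx n c' \<longleftrightarrow> c = c'"
  by (auto simp: col_idx_def split: if_splits)

lemma elt_col_in: "\<alpha> \<in> poset n \<Longrightarrow> elt_col n \<alpha> \<in> {1..2 * n + 1}"
  using elt_bounds[of \<alpha> n] by auto

text \<open>The first entry sends e_i to the vector of letter c; the second is its mirror image
  forced by the symplectic relation. For c = i the two coincide, and for c = n + 1 there is no
  second one because the radical index has sign 0.\<close>

definition neg_vec :: "nat \<Rightarrow> elt \<Rightarrow> matrix"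
  where "neg_vec n \<alpha> = (\<lambda>(a, b).
    if a = col_idx n (elt_col n \<alpha>) \<and> b = elt_row \<alpha> then 1
    else if elt_col n \<alpha> \<noteq> n + 1 \<and> a = n + elt_row \<alpha> \<and> b = dual_idx n (col_idx n (elt_col n \<alpha>)) then idx_sign n b
    else 0)"

lemma neg_vec_Bar:
  assumes "1 \<le> i" "i \<le> j" "j \<le> n"
  shows "neg_vec n (Bar i j) = (\<lambda>(a, b). if a = n + j \<and> b = i \<or> a = n + i \<and> b = j then 1 else 0)"
proof -
  have e: "elt_row (Bar i j) = i" "elt_col n (Bar i j) = j" "col_idx n j = n + j" "dual_idx n (n + j) = j"
      "idx_sign n j = 1" "(j \<noteq> n + 1) = True"
    using assms by (simp_all add: col_idx_def dual_idx_def idx_sign_def)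
  have "neg_vec n (Bar i j) (a, b) = (if a = n + j \<and> b = i \<or> a = n + i \<and> b = j then 1 else 0)" for a b
    unfolding neg_vec_def e by (use e(5) in \<open>auto simp only: prod.case simp_thms split: if_split\<close>)
  thus ?thesis by (simp add: fun_eq_iff)
qed

lemma neg_vec_Plain:
  assumes "1 \<le> i" "i \<le> j" "j < n"
  shows "neg_vec n (Plain i j) =
    (\<lambda>(a, b). if a = j + 1 \<and> b = i then 1 else if a = n + i \<and> b = n + j + 1 then - 1 else 0)"
proof -
  have e: "elt_row (Plain i j) = i" "elt_col n (Plain i j) = 2 * n + 1 - j" "col_idx n (2 * n + 1 - j) = j + 1"
      "dual_idx n (j + 1) = n + j + 1" "idx_sign n (n + j + 1) = - 1" "(2 * n + 1 - j \<noteq> n + 1) = True"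
    using assms by (auto simp: col_idx_def dual_idx_def idx_sign_def)
  have "neg_vec n (Plain i j) (a, b) =
      (if a = j + 1 \<and> b = i then 1 else if a = n + i \<and> b = n + j + 1 then - 1 else 0)" for a b
    unfolding neg_vec_def e by (use e(5) in \<open>auto simp only: prod.case simp_thms split: if_split\<close>)
  thus ?thesis by (simp add: fun_eq_iff)
qed

lemma neg_vec_Plain_last:
  "neg_vec n (Plain i n) = unit_vec (2 * n + 1, i)"
proof -
  have e: "elt_row (Plain i n) = i" "elt_col n (Plain i n) = n + 1" "col_idx n (n + 1) = 2 * n + 1"
    by (simp_all add: col_idx_def)
  show ?thesis unfolding neg_vec_def e by (auto simp: unit_vec_def)
qed

lemma poset_cases:
  assumes "\<alpha> \<in> poset n"
  obtains (Bar) i j where "\<alpha> = Bar i j" "1 \<le> i" "i \<le> j" "j \<le> n"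
    | (Plain) i j where "\<alpha> = Plain i j" "1 \<le> i" "i \<le> j" "j < n"
    | (last) i where "\<alpha> = Plain i n" "1 \<le> i" "i \<le> n"
  using assms unfolding poset_def by (auto simp: le_less)

lemma idx_cases:
  fixes a n :: nat
  assumes "a \<in> {1..2 * n + 1}"
  obtains (low) "1 \<le> a" "a \<le> n" | (mid) i where "a = n + i" "1 \<le> i" "i \<le> n" | (rad) "a = 2 * n + 1"
proof -
  show ?thesis
  proof (cases "a \<le> n")
    case True
    thus ?thesis using assms by (intro low) auto
  next
    case F: False
    show ?thesis
    proof (cases "a \<le> 2 * n")
      case True
      show ?thesis by (rule mid[of "a - n"]) (use True F in auto)
    next
      case False
      thus ?thesis using assms by (intro rad) auto
    qed
  qed
qed

lemma neg_vec_lower: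
  assumes a: "\<alpha> \<in> poset n"
  shows "neg_vec n \<alpha> \<in> lower_sp n"
  using a
proof (cases rule: poset_cases)
  case (Bar i j)
  show ?thesis unfolding Bar(1) neg_vec_Bar[OF Bar(2-4)] lower_sp_def odd_sp_iff
  proof (intro CollectI conjI ballI allI impI)
    fix x y assume "x \<in> {1..2*n+1}" "y \<in> {1..2*n+1}"
    thus "idx_sign n x * (case (dual_idx n x, y) of (a, b) \<Rightarrow> if a = n + j \<and> b = i \<or> a = n + i \<and> b = j then 1 else 0) =
      idx_sign n y * (case (dual_idx n y, x) of (a, b) \<Rightarrow> if a = n + j \<and> b = i \<or> a = n + i \<and> b = j then 1 else 0)"
      using Bar by (elim idx_cases) (auto simp: dual_idx_def idx_sign_def)
  qed (use Bar in \<open>auto simp: gl_def place_def split: if_splits\<close>)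
next
  case (Plain i j)
  show ?thesis unfolding Plain(1) neg_vec_Plain[OF Plain(2-4)] lower_sp_def odd_sp_iff
  proof (intro CollectI conjI ballI allI impI)
    fix x y assume "x \<in> {1..2*n+1}" "y \<in> {1..2*n+1}"
    thus "idx_sign n x * (case (dual_idx n x, y) of (a, b) \<Rightarrow> if a = j + 1 \<and> b = i then 1 else if a = n + i \<and> b = n + j + 1 then - 1 else 0) =
      idx_sign n y * (case (dual_idx n y, x) of (a, b) \<Rightarrow> if a = j + 1 \<and> b = i then 1 else if a = n + i \<and> b = n + j + 1 then - 1 else 0)"
      using Plain by (elim idx_cases) (auto simp: dual_idx_def idx_sign_def)
  qed (use Plain in \<open>auto simp: gl_def place_def split: if_splits\<close>)
next
  case (last i)
  show ?thesis unfolding last(1) neg_vec_Plain_last lower_sp_def odd_sp_iff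
  proof (intro CollectI conjI ballI allI impI)
    fix x y assume "x \<in> {1..2*n+1}" "y \<in> {1..2*n+1}"
    thus "idx_sign n x * unit_vec (2 * n + 1, i) (dual_idx n x, y) =
      idx_sign n y * unit_vec (2 * n + 1, i) (dual_idx n y, x)"
      using last by (elim idx_cases) (auto simp: dual_idx_def idx_sign_def unit_vec_def)
  qed (use last in \<open>auto simp: gl_def place_def unit_vec_def split: if_splits\<close>)
qed

lemma sum_fun_apply: "(\<Sum>i\<in>A. f i) x = (\<Sum>i\<in>A. f i x)"
  by (induction A rule: infinite_finite_induct) auto

lemma place_row: "1 \<le> i \<Longrightarrow> i \<le> n \<Longrightarrow> place n i = i" by (simp add: place_def)

text \<open>A lower triangular symplectic matrix is determined by its entries on one side of the
  antidiagonal, the antidiagonal included. There each root vector has only its main entry, so the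
  coefficients can be read off.\<close>

lemma lower_sp_expand:
  assumes X: "X \<in> lower_sp n"
  shows "X = (\<Sum>\<alpha>\<in>poset n. X (col_idx n (elt_col n \<alpha>), elt_row \<alpha>) *\<^sub>C neg_vec n \<alpha>)" (is "X = ?Y")
proof -
  have Y: "?Y \<in> lower_sp n"
    by (intro cfun.subspace_sum cfun.subspace_scale subspace_lower_sp neg_vec_lower)
  have main: "X (a, b) = ?Y (a, b)" if ab: "place n b < place n a" "a \<in> {1..2 * n + 1}" "b \<in> {1..n}" 
    "place n a + b \<ge> 1" "b \<le> 2 * n + 2 - place n a" for a b
  proof -
    define \<beta> where "\<beta> = mk_elt n b (2 * n + 2 - place n a)"
    have pb: "place n b = b" using ab by (simp add: place_def)
    have pa: "place n a \<in> {1..2 * n + 1}" using place_in ab by blast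
    have \<beta>: "\<beta> \<in> poset n" unfolding \<beta>_def using ab pa pb by (intro mk_elt_in) auto
    have rc: "elt_row \<beta> = b" "elt_col n \<beta> = 2 * n + 2 - place n a"
      unfolding \<beta>_def using pa by auto
    have ca: "col_idx n (elt_col n \<beta>) = a" unfolding rc using col_idx_place ab by blast
    have "X (col_idx n (elt_col n \<alpha>), elt_row \<alpha>) * neg_vec n \<alpha> (a, b) = (if \<alpha> = \<beta> then X (a, b) else 0)"
      if \<alpha>: "\<alpha> \<in> poset n" for \<alpha>
    proof (cases "\<alpha> = \<beta>")
      case True
      thus ?thesis using ca rc by (simp add: neg_vec_def)
    next
      case False
      have "neg_vec n \<alpha> (a, b) = 0"
      proof (rule ccontr)
        assume "neg_vec n \<alpha> (a, b) \<noteq> 0"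
        then consider "a = col_idx n (elt_col n \<alpha>)" "b = elt_row \<alpha>"
          | "elt_col n \<alpha> \<noteq> n + 1" "a = n + elt_row \<alpha>" "b = dual_idx n (col_idx n (elt_col n \<alpha>))"
          unfolding neg_vec_def prod.case by (metis (full_types))
        thus False
        proof cases
          case 1
          hence "elt_col n \<alpha> = elt_col n \<beta>"
            using ca col_idx_inj[OF elt_col_in[OF \<alpha>] elt_col_in[OF \<beta>]] by metis
          with 1 rc False elt_eqI[OF \<alpha> \<beta>] show False by metis
        next
          case 2
          have "elt_col n \<alpha> = b \<and> elt_row \<alpha> = 2 * n + 2 - place n a"
            using \<alpha>
          proof (cases rule: poset_cases)
            case (Bar i j)
            thus ?thesis using 2 by (simp add: dual_idx_def col_idx_def place_def)
          next
            case (Plain i j)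
            have "col_idx n (elt_col n \<alpha>) = j + 1" using Plain by (auto simp: col_idx_def)
            hence "b = n + (j + 1)" using 2(3) Plain by (simp add: dual_idx_def)
            thus ?thesis using ab(3) by simp
          next
            case (last i)
            thus ?thesis using 2 by simp
          qed
          hence "elt_row \<alpha> = b" "elt_col n \<alpha> = 2 * n + 2 - place n a"
            using elt_bounds[OF \<alpha>] ab by linarith+
          with rc False elt_eqI[OF \<alpha> \<beta>] show False by metis
        qed
      qed
      with False show ?thesis by simp
    qed
    hence "?Y (a, b) = (\<Sum>\<alpha>\<in>poset n. if \<alpha> = \<beta> then X (a, b) else 0)"
      by (simp add: sum_fun_apply)
    thus ?thesis using \<beta> by simp
  qed
  have "X (a, b) = ?Y (a, b)" for a b
  proof (cases "place n b < place n a \<and> a \<in> {1..2 * n + 1} \<and> b \<in> {1..2 * n + 1}")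
    case False
    have "Z (a, b) = 0" if "Z \<in> lower_sp n" for Z
      using that False unfolding lower_sp_def odd_sp_def gl_def by blast
    thus ?thesis using X Y by metis
  next
    case True
    hence ab: "place n b < place n a" "a \<in> {1..2 * n + 1}" "b \<in> {1..2 * n + 1}" by auto
    have pa: "place n a \<in> {1..2 * n + 1}" "place n b \<in> {1..2 * n + 1}" using place_in ab by auto
    show ?thesis
    proof (cases "place n b \<le> 2 * n + 2 - place n a")
      case True
      have "b \<in> {1..n}" using True ab pa by (auto simp: place_def split: if_splits)
      moreover have "place n b = b" using calculation by (simp add: place_def)
      ultimately show ?thesis using main[of b a] ab True by auto
    next
      case gt: False
      \<comment> \<open>Reflection in the antidiagonal moves the entry into the half treated by
        \<open>main\<close>; \<open>rel\<close> carries the equality back for both matrices.\<close>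
      let ?a = "dual_idx n b" and ?b = "dual_idx n a"
      have in': "?a \<in> {1..2*n+1}" "?b \<in> {1..2*n+1}" using ab dual_idx_in by blast+
      have p: "place n ?a = 2 * n + 2 - place n b" "place n ?b = 2 * n + 2 - place n a"
        using ab place_dual by blast+
      have lt: "place n ?b < place n ?a" using p ab pa by auto
      have le: "place n ?b \<le> 2 * n + 2 - place n ?a" using gt p pa by auto
      have "place n ?b \<le> n" using le lt by linarith
      hence bn: "?b \<in> {1..n}" using in' by (auto simp: place_def split: if_splits)
      have e: "X (?a, ?b) = ?Y (?a, ?b)"
        using main[of ?b ?a] lt in' bn le by (auto simp: place_row)
      have a: "n < a" "a \<le> 2 * n" using bn ab by (auto simp: dual_idx_def split: if_splits)
      have rel: "Z (a, b) = - idx_sign n b * Z (?a, ?b) * (-1)" if Z: "Z \<in> odd_sp n" for Z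
      proof -
        have "idx_sign n ?b * Z (dual_idx n ?b, b) = idx_sign n b * Z (?a, ?b)"
          using Z in' ab by (auto simp: odd_sp_iff simp del: atLeastAtMost_iff)
        moreover have "dual_idx n ?b = a" using ab by simp
        moreover have "idx_sign n ?b = 1" using ab a by (auto simp: idx_sign_def dual_idx_def)
        ultimately show ?thesis by simp
      qed
      show ?thesis using rel[OF lower_sp_odd_sp[OF X]] rel[OF lower_sp_odd_sp[OF Y]] e by simp
    qed
  qed
  thus ?thesis by (intro ext) (metis prod.collapse)
qed


lemma neg_vec_cases:
  assumes "\<alpha> \<in> poset n" "neg_vec n \<alpha> (a, b) \<noteq> 0"
  shows "a = col_idx n (elt_col n \<alpha>) \<and> b = elt_row \<alpha> \<or>
    a = dual_idx n (elt_row \<alpha>) \<and> b = dual_idx n (col_idx n (elt_col n \<alpha>)) \<and> elt_col n \<alpha> \<noteq> n + 1"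
proof -
  have "dual_idx n (elt_row \<alpha>) = n + elt_row \<alpha>" using elt_bounds[OF assms(1)] by (simp add: dual_idx_def)
  thus ?thesis using assms(2) unfolding neg_vec_def prod.case by (metis (full_types))
qed

lemma neg_vec_in_span: "X \<in> lower_sp n \<Longrightarrow> X \<in> cfun.span (neg_vec n ` poset n)"
  by (subst lower_sp_expand, assumption) (intro cfun.span_sum cfun.span_scale cfun.span_base imageI)

lemma sum_simple_root:
  assumes "i \<le> j" "j \<le> n"
  shows "(\<Sum>k=i..<j. simple_root n k) = eps i - eps j"
  using assms
proof (induction j rule: dec_induct)
  case (step k)
  have "(\<Sum>k=i..<Suc k. simple_root n k) = (\<Sum>k=i..<k. simple_root n k) + simple_root n k"
    using step.hyps by simp
  also have "(\<Sum>k=i..<k. simple_root n k) = eps i - eps k" using step.hyps step.prems by (intro step.IH) simp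
  also have "simple_root n k = eps k - eps (Suc k)" using step by (simp add: simple_root_def Suc_eq_plus1)
  finally show ?case by simp
qed simp

lemma elt_weight_Plain: "1 \<le> i \<Longrightarrow> i \<le> j \<Longrightarrow> j < n \<Longrightarrow> elt_weight n (Plain i j) = eps i - eps (j + 1)"
  using sum_simple_root[of i "j + 1" n] by (simp add: atLeastLessThanSuc_atLeastAtMost flip: Suc_eq_plus1)

lemma sum_simple_root_last: "i \<le> n \<Longrightarrow> (\<Sum>k=i..n. simple_root n k) = eps i + eps n"
proof -
  assume i: "i \<le> n"
  have "(\<Sum>k=i..n. simple_root n k) = (\<Sum>k=i..<n. simple_root n k) + simple_root n n"
    using i by (metis sum.last_plus add.commute)
  also have "\<dots> = eps i + eps n" unfolding sum_simple_root[OF i order_refl]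
    by (simp add: simple_root_def fun_eq_iff)
  finally show ?thesis .
qed

lemma elt_weight_Plain_last: "i \<le> n \<Longrightarrow> elt_weight n (Plain i n) = eps i - del_wt n"
  using sum_simple_root_last[of i n] by (simp add: ext_root_def)

lemma elt_weight_Bar: "i \<le> j \<Longrightarrow> j \<le> n \<Longrightarrow> elt_weight n (Bar i j) = eps i + eps j"
  using sum_simple_root_last[of i n] sum_simple_root[of j n n] by simp

lemma pairing_add: "pairing n (\<mu> + \<nu>) H = pairing n \<mu> H + pairing n \<nu> H"
  by (simp add: pairing_def algebra_simps sum.distrib)

lemma pairing_diff: "pairing n (\<mu> - \<nu>) H = pairing n \<mu> H - pairing n \<nu> H"
  by (simp add: pairing_def algebra_simps sum_subtractf)

lemma pairing_minus: "pairing n (- \<mu>) H = - pairing n \<mu> H"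
  by (simp add: pairing_def sum_negf)

lemma pairing_scale: "pairing n (c *\<^sub>C \<mu>) H = c * pairing n \<mu> H"
  by (simp add: pairing_def algebra_simps sum_distrib_left)

lemma pairing_sum: "pairing n (\<Sum>x\<in>A. \<mu> x) H = (\<Sum>x\<in>A. pairing n (\<mu> x) H)"
proof (induction A rule: infinite_finite_induct)
  case (insert x F)
  show ?case unfolding sum.insert[OF insert.hyps] pairing_add insert.IH ..
qed (simp_all add: pairing_def)

lemma pairing_eps: "i \<in> {1..n} \<Longrightarrow> pairing n (eps i) H = H (i, i)"
  by (auto simp: pairing_def eps_def unit_vec_def if_distrib[of "\<lambda>x. x * _"] cong: if_cong)

lemma pairing_del: "pairing n (del_wt n) H = H (2 * n + 1, 2 * n + 1)"
  by (auto simp: pairing_def del_wt_def unit_vec_def intro!: sum.neutral)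

lemma ext_cartanD:
  assumes "H \<in> ext_cartan n"
  shows "H (a, b) \<noteq> 0 \<Longrightarrow> a = b \<and> a \<in> {1..2 * n + 1}" "j \<in> {1..n} \<Longrightarrow> H (n + j, n + j) = - H (j, j)"
proof -
  define P where "P = {H :: matrix. (\<forall>a b. \<not> (a = b \<and> a \<in> {1..2 * n + 1}) \<longrightarrow> H (a, b) = 0) \<and> (\<forall>j\<in>{1..n}. H (n + j, n + j) = - H (j, j))}"
  have "cfun.subspace P" unfolding P_def cfun.subspace_def by (auto simp del: atLeastAtMost_iff)
  moreover have "{unit_vec (i, i) - unit_vec (n + i, n + i) |i. i \<in> {1..n}} \<union> {unit_vec (2 * n + 1, 2 * n + 1)} \<subseteq> P"
    unfolding P_def by (auto simp: unit_vec_def)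
  ultimately have "ext_cartan n \<subseteq> P" unfolding ext_cartan_def by (intro cfun.span_minimal)
  thus "H (a, b) \<noteq> 0 \<Longrightarrow> a = b \<and> a \<in> {1..2 * n + 1}" "j \<in> {1..n} \<Longrightarrow> H (n + j, n + j) = - H (j, j)"
    using assms unfolding P_def by blast+
qed

lemma cartan_sub: "cartan n \<subseteq> ext_cartan n"
  unfolding cartan_def ext_cartan_def by (intro cfun.span_mono) blast

lemma ext_cartan_dual:
  "H \<in> ext_cartan n \<Longrightarrow> a \<in> {1..2 * n} \<Longrightarrow> H (dual_idx n a, dual_idx n a) = - H (a, a)"
  using ext_cartanD(2)[of H n a] ext_cartanD(2)[of H n "a - n"] by (auto simp: dual_idx_def Suc_le_eq One_nat_def)

lemma bracket_cartan:
  assumes H: "H \<in> ext_cartan n" and X: "X \<in> gl (2 * n + 1)"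
  shows "bracket (2 * n + 1) H X (a, b) = (H (a, a) - H (b, b)) * X (a, b)"
proof (cases "a \<in> {1..2 * n + 1} \<and> b \<in> {1..2 * n + 1}")
  case True
  have "(\<Sum>k=1..2 * n + 1. H (a, k) * X (k, b)) = (\<Sum>k=1..2 * n + 1. if k = a then H (a, a) * X (a, b) else 0)"
    by (rule sum.cong) (use ext_cartanD(1)[OF H] in auto)
  moreover have "(\<Sum>k=1..2 * n + 1. X (a, k) * H (k, b)) = (\<Sum>k=1..2 * n + 1. if k = b then X (a, b) * H (b, b) else 0)"
    by (rule sum.cong) (use ext_cartanD(1)[OF H] in auto)
  ultimately show ?thesis using True unfolding bracket_apply by (simp add: algebra_simps)
next
  case False
  have z: "X (a, b) = 0" using X False by (auto simp: gl_def)
  have "H (a, k) * X (k, b) = 0" "X (a, k) * H (k, b) = 0" for k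
    using ext_cartanD(1)[OF H, of a k] ext_cartanD(1)[OF H, of k b] z by auto
  hence "(\<Sum>k=1..2 * n + 1. H (a, k) * X (k, b)) = 0" "(\<Sum>k=1..2 * n + 1. X (a, k) * H (k, b)) = 0"
    by (simp_all add: sum.neutral del: mult_eq_0_iff)
  thus ?thesis unfolding bracket_apply z by simp
qed

lemma pairing_elt_weight:
  assumes H: "H \<in> ext_cartan n" and \<alpha>: "\<alpha> \<in> poset n"
  shows "pairing n (elt_weight n \<alpha>) H =
    H (elt_row \<alpha>, elt_row \<alpha>) - H (col_idx n (elt_col n \<alpha>), col_idx n (elt_col n \<alpha>))"
  using \<alpha>
proof (cases rule: poset_cases)
  case (Bar i j)
  thus ?thesis using ext_cartanD(2)[OF H, of j] unfolding Bar(1) elt_weight_Bar[OF Bar(3,4)] pairing_add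
    by (simp add: pairing_eps col_idx_def)
next
  case (Plain i j)
  have "col_idx n (elt_col n (Plain i j)) = j + 1" using Plain by (auto simp: col_idx_def)
  thus ?thesis unfolding Plain(1) elt_weight_Plain[OF Plain(2-4)] pairing_diff using Plain
    by (simp add: pairing_eps)
next
  case (last i)
  thus ?thesis unfolding last(1) elt_weight_Plain_last[OF last(3)] pairing_diff
    by (simp add: pairing_eps pairing_del col_idx_def)
qed

lemma bracket_neg_vec:
  assumes H: "H \<in> ext_cartan n" and \<alpha>: "\<alpha> \<in> poset n"
  shows "bracket (2 * n + 1) H (neg_vec n \<alpha>) = - pairing n (elt_weight n \<alpha>) H *\<^sub>C neg_vec n \<alpha>"
proof -
  have gl: "neg_vec n \<alpha> \<in> gl (2 * n + 1)"
    using lower_sp_odd_sp[OF neg_vec_lower[OF \<alpha>]] by (simp add: odd_sp_def)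
  have "bracket (2 * n + 1) H (neg_vec n \<alpha>) (a, b) = (- pairing n (elt_weight n \<alpha>) H *\<^sub>C neg_vec n \<alpha>) (a, b)" for a b
  proof (cases "neg_vec n \<alpha> (a, b) = 0")
    case False
    let ?r = "col_idx n (elt_col n \<alpha>)" and ?i = "elt_row \<alpha>"
    have "H (a, a) - H (b, b) = H (?r, ?r) - H (?i, ?i)"
      using neg_vec_cases[OF \<alpha> False]
    proof (elim disjE conjE)
      assume *: "a = dual_idx n ?i" "b = dual_idx n ?r" "elt_col n \<alpha> \<noteq> n + 1"
      have "?i \<in> {1..2 * n}" using elt_bounds[OF \<alpha>] by auto
      moreover have "?r \<in> {1..2 * n}" using *(3) elt_bounds[OF \<alpha>] by (auto simp: col_idx_def)
      ultimately show ?thesis using ext_cartan_dual[OF H] * by simp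
    qed simp
    hence "H (a, a) - H (b, b) = - pairing n (elt_weight n \<alpha>) H" unfolding pairing_elt_weight[OF H \<alpha>] by simp
    thus ?thesis unfolding bracket_cartan[OF H gl] by simp
  qed (simp add: bracket_cartan[OF H gl])
  thus ?thesis by (intro ext) (metis prod.collapse)
qed

text \<open>One grading element suffices. Its adjoint eigenvalue at entry (a, b) is
  \<open>place n b - place n a\<close>, and on the root space this is a fixed negative number, so
  all nonzero entries lie strictly below the diagonal.\<close>

lemma root_space_lower:
  assumes \<alpha>: "\<alpha> \<in> poset n - {Plain i n |i. True}"
  shows "root_space n (- elt_weight n \<alpha>) \<subseteq> lower_sp n"
proof
  fix X assume X: "X \<in> root_space n (- elt_weight n \<alpha>)"
  \<comment> \<open>On this element of the Cartan subalgebra every diagonal entry is \<open>n + 1\<close> minus its place.\<close>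
  define H where "H = (\<Sum>i=1..n. of_nat (n + 1 - i) *\<^sub>C (unit_vec (i, i) - unit_vec (n + i, n + i)))"
  have H: "H \<in> cartan n" unfolding H_def cartan_def
    by (intro cfun.span_sum cfun.span_scale cfun.span_base) auto
  hence He: "H \<in> ext_cartan n" using cartan_sub by blast
  have Hi: "H (a, a) = of_nat (n + 1 - a)" if "a \<in> {1..n}" for a
  proof -
    have "H (a, a) = (\<Sum>i=1..n. if i = a then of_nat (n + 1 - a) else 0)"
      unfolding H_def sum_fun_apply by (rule sum.cong) (use that in \<open>auto simp: unit_vec_def\<close>)
    thus ?thesis using that by simp
  qed
  have Hp: "H (a, a) = of_int (int n + 1 - int (place n a))" if "a \<in> {1..2 * n}" for a
  proof (cases "a \<le> n")
    case True
    thus ?thesis using Hi[of a] that by (simp add: place_def of_nat_diff)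
  next
    case False
    hence "H (a, a) = - H (a - n, a - n)" using ext_cartanD(2)[OF He, of "a - n"] that by (auto simp: Suc_le_eq One_nat_def)
    also have "H (a - n, a - n) = of_nat (n + 1 - (a - n))" using False that by (intro Hi) auto
    also have "- of_nat (n + 1 - (a - n)) = (of_int (int n + 1 - int (3 * n + 2 - a)) :: complex)"
    proof -
      have "- int (n + 1 - (a - n)) = int n + 1 - int (3 * n + 2 - a)" using False that by auto
      thus ?thesis by (metis of_int_minus of_int_of_nat_eq)
    qed
    finally show ?thesis using False that by (simp add: place_def)
  qed
  have X': "X \<in> odd_sp n" "X \<in> gl (2 * n)" and br: "bracket (2 * n + 1) H X = pairing n (- elt_weight n \<alpha>) H *\<^sub>C X"
    using X H by (auto simp: root_space_def even_sp_def)
  have gl: "X \<in> gl (2 * n + 1)" using X' by (simp add: odd_sp_def)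
  have a: "\<alpha> \<in> poset n" "elt_col n \<alpha> \<noteq> n + 1"
    using \<alpha> by (auto simp: poset_def)
  let ?r = "col_idx n (elt_col n \<alpha>)" and ?i = "elt_row \<alpha>"
  have r: "?r \<in> {1..2 * n}" using a elt_bounds[OF a(1)] by (auto simp: col_idx_def)
  have i: "?i \<in> {1..2 * n}" using elt_bounds[OF a(1)] by auto
  have lt: "place n ?i < place n ?r"
    using elt_bounds[OF a(1)] place_col_idx[OF elt_col_in[OF a(1)]] by (simp add: place_def)
  show "X \<in> lower_sp n" unfolding lower_sp_def
  proof (intro CollectI conjI allI impI X'(1))
    fix a b assume nz: "X (a, b) \<noteq> 0"
    hence ab: "a \<in> {1..2 * n}" "b \<in> {1..2 * n}" using X'(2) by (auto simp: gl_def)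
    have "(H (a, a) - H (b, b)) * X (a, b) = - (H (?i, ?i) - H (?r, ?r)) * X (a, b)"
      using fun_cong[OF br, of "(a, b)"]
      unfolding bracket_cartan[OF He gl] pairing_minus pairing_elt_weight[OF He \<open>\<alpha> \<in> poset n\<close>] by simp
    hence "H (a, a) - H (b, b) = - (H (?i, ?i) - H (?r, ?r))" using nz by simp
    hence "(of_int (int (place n b) - int (place n a)) :: complex) = of_int (int (place n ?i) - int (place n ?r))"
      unfolding Hp[OF ab(1)] Hp[OF ab(2)] Hp[OF r] Hp[OF i] by simp
    hence "int (place n b) - int (place n a) = int (place n ?i) - int (place n ?r)"
      unfolding of_int_eq_iff .
    thus "place n b < place n a" using lt by linarith
  qed
qed

text \<open>Trades the definition through root spaces for a triangularity condition, which is
  visibly closed under brackets and is the target of \<open>lower_part\<close>.\<close>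

lemma ext_n_minus_eq: "ext_n_minus n = lower_sp n"
proof
  have "n_minus n \<subseteq> lower_sp n" unfolding n_minus_def pos_roots_def
    using root_space_lower[of _ n] by (intro cfun.span_minimal subspace_lower_sp) blast
  moreover have "unit_vec (2 * n + 1, i) \<in> lower_sp n" if "i \<in> {1..n}" for i
    using neg_vec_lower[of "Plain i n" n] that by (auto simp: neg_vec_Plain_last poset_def)
  ultimately show "ext_n_minus n \<subseteq> lower_sp n" unfolding ext_n_minus_def
    by (intro cfun.span_minimal subspace_lower_sp) blast
next
  have "neg_vec n \<alpha> \<in> ext_n_minus n" if a: "\<alpha> \<in> poset n" for \<alpha>
  proof (cases "\<exists>i. \<alpha> = Plain i n")
    case True
    then obtain i where i: "\<alpha> = Plain i n" "i \<in> {1..n}" using a by (auto simp: poset_def)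
    thus ?thesis unfolding ext_n_minus_def i(1) neg_vec_Plain_last by (intro cfun.span_base) blast
  next
    case False
    have o: "neg_vec n \<alpha> \<in> odd_sp n" using a neg_vec_lower lower_sp_odd_sp by blast
    have "neg_vec n \<alpha> \<in> gl (2 * n)"
    proof -
      have "a \<in> {1..2 * n} \<and> b \<in> {1..2 * n}" if nz: "neg_vec n \<alpha> (a, b) \<noteq> 0" for a b
      proof -
        let ?r = "col_idx n (elt_col n \<alpha>)" and ?i = "elt_row \<alpha>"
        have c: "elt_col n \<alpha> \<noteq> n + 1" using a False by (auto simp: poset_def)
        have "?r \<in> {1..2 * n}" "?i \<in> {1..2 * n}" using c elt_bounds[OF a] by (auto simp: col_idx_def)
        moreover have "dual_idx n x \<in> {1..2 * n}" if "x \<in> {1..2 * n}" for x using that by (auto simp: dual_idx_def)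
        ultimately show ?thesis using neg_vec_cases[OF a nz] by metis
      qed
      thus ?thesis unfolding gl_def by blast
    qed
    hence "neg_vec n \<alpha> \<in> root_space n (- elt_weight n \<alpha>)"
      using o bracket_neg_vec[OF _ a] cartan_sub unfolding root_space_def even_sp_def pairing_minus by blast
    moreover have "elt_weight n \<alpha> \<in> pos_roots n" using a False by (auto simp: pos_roots_def)
    ultimately have "neg_vec n \<alpha> \<in> n_minus n" unfolding n_minus_def by (intro cfun.span_base) blast
    thus ?thesis unfolding ext_n_minus_def by (intro cfun.span_base) blast
  qed
  hence "cfun.span (neg_vec n ` poset n) \<subseteq> ext_n_minus n"
    by (intro cfun.span_minimal) (auto simp: ext_n_minus_def)
  thus "lower_sp n \<subseteq> ext_n_minus n" using neg_vec_in_span by blast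
qed

section \<open>Derivations on tensors\<close>

text \<open>One summand of the derivation. Summands at different positions commute, so they can be
  regrouped by the columns of the diagram.\<close>

definition pos_act :: "nat \<Rightarrow> matrix \<Rightarrow> nat \<Rightarrow> tensor \<Rightarrow> tensor"
  where "pos_act N X p T = (\<lambda>w. if p < length w then \<Sum>j=1..N. X (w ! p, j) * T (w[p := j]) else 0)"

lemma lie_act_pos_act: "lie_act N X T w = (\<Sum>p<length w. pos_act N X p T w)"
  by (simp add: lie_act_def pos_act_def)

lemma pos_act_add: "pos_act N X p (S + T) = pos_act N X p S + pos_act N X p T"
  by (auto simp: pos_act_def fun_eq_iff algebra_simps sum.distrib)

lemma pos_act_scale: "pos_act N X p (c *\<^sub>C T) = c *\<^sub>C pos_act N X p T"
  by (auto simp: pos_act_def fun_eq_iff algebra_simps sum_distrib_left)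

lemma pos_act_0: "pos_act N X p 0 = 0"
  by (auto simp: pos_act_def fun_eq_iff)

lemma pos_act_sum: "pos_act N X p (\<Sum>x\<in>A. T x) = (\<Sum>x\<in>A. pos_act N X p (T x))"
proof (induction A rule: infinite_finite_induct)
  case (insert x F)
  show ?case unfolding sum.insert[OF insert.hyps] pos_act_add insert.IH ..
qed (simp_all only: sum.infinite sum.empty not_False_eq_True pos_act_0)

lemma pos_act_commute:
  assumes "p \<noteq> q"
  shows "pos_act N X p (pos_act N Y q T) = pos_act N Y q (pos_act N X p T)"
proof
  fix w :: "nat list"
  have "pos_act N X p (pos_act N Y q T) w = (if p < length w \<and> q < length w
      then \<Sum>j=1..N. \<Sum>l=1..N. X (w ! p, j) * Y (w ! q, l) * T (w[p := j, q := l]) else 0)"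
    using assms by (auto simp: pos_act_def sum_distrib_left mult_ac intro!: sum.cong)
  also have "\<dots> = (if p < length w \<and> q < length w
      then \<Sum>l=1..N. \<Sum>j=1..N. X (w ! p, j) * Y (w ! q, l) * T (w[p := j, q := l]) else 0)"
    by (subst sum.swap) (rule refl)
  also have "\<dots> = pos_act N Y q (pos_act N X p T) w"
    using assms by (auto simp: pos_act_def sum_distrib_left mult_ac list_update_swap intro!: sum.cong)
  finally show "pos_act N X p (pos_act N Y q T) w = pos_act N Y q (pos_act N X p T) w" .
qed

lemma pos_act_same: "pos_act N X p (pos_act N Y p T) = pos_act N (mat_mul N X Y) p T"
proof
  fix w :: "nat list"
  have "(\<Sum>j=1..N. X (w ! p, j) * (\<Sum>l=1..N. Y (j, l) * T (w[p := l]))) =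
      (\<Sum>j=1..N. \<Sum>l=1..N. X (w ! p, j) * Y (j, l) * T (w[p := l]))"
    by (simp add: sum_distrib_left mult_ac)
  also have "\<dots> = (\<Sum>l=1..N. (\<Sum>j=1..N. X (w ! p, j) * Y (j, l)) * T (w[p := l]))"
    by (subst sum.swap) (simp add: sum_distrib_right)
  finally show "pos_act N X p (pos_act N Y p T) w = pos_act N (mat_mul N X Y) p T w"
    by (simp add: pos_act_def mat_mul_def)
qed

lemma pos_act_diff_matrix: "pos_act N (X - Y) p T = pos_act N X p T - pos_act N Y p T"
  by (auto simp: pos_act_def fun_eq_iff algebra_simps sum_subtractf)

lemma lie_act_lie_act: "lie_act N X (lie_act N Y T) w =
    (\<Sum>p<length w. \<Sum>q<length w. pos_act N X p (pos_act N Y q T) w)"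
proof -
  have "pos_act N X p (lie_act N Y T) w = (\<Sum>q<length w. pos_act N X p (pos_act N Y q T) w)" for p
  proof (cases "p < length w")
    case True
    have "pos_act N X p (lie_act N Y T) w = (\<Sum>j=1..N. \<Sum>q<length w. X (w ! p, j) * pos_act N Y q T (w[p := j]))"
      using True by (simp add: pos_act_def lie_act_def sum_distrib_left)
    also have "\<dots> = (\<Sum>q<length w. \<Sum>j=1..N. X (w ! p, j) * pos_act N Y q T (w[p := j]))"
      by (rule sum.swap)
    finally show ?thesis using True by (subst (2) pos_act_def) simp
  qed (simp add: pos_act_def)
  thus ?thesis unfolding lie_act_pos_act[of N X] by simp
qed

text \<open>In the double sum over positions the terms with p \<noteq> q cancel, because actions at
  different positions commute; the diagonal terms compose as matrices.\<close>

lemma lie_act_bracket: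
  "lie_act N (bracket N X Y) T = lie_act N X (lie_act N Y T) - lie_act N Y (lie_act N X T)"
proof
  fix w :: "nat list"
  let ?L = "length w"
  have "lie_act N X (lie_act N Y T) w - lie_act N Y (lie_act N X T) w =
    (\<Sum>p<?L. \<Sum>q<?L. pos_act N X p (pos_act N Y q T) w) - (\<Sum>q<?L. \<Sum>p<?L. pos_act N Y q (pos_act N X p T) w)"
    unfolding lie_act_lie_act ..
  also have "(\<Sum>q<?L. \<Sum>p<?L. pos_act N Y q (pos_act N X p T) w) = (\<Sum>p<?L. \<Sum>q<?L. pos_act N Y q (pos_act N X p T) w)"
    by (rule sum.swap)
  also have "(\<Sum>p<?L. \<Sum>q<?L. pos_act N X p (pos_act N Y q T) w) - \<dots> =
    (\<Sum>p<?L. \<Sum>q<?L. if q = p then pos_act N X p (pos_act N Y p T) w - pos_act N Y p (pos_act N X p T) w else 0)"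
    unfolding sum_subtractf[symmetric]
  proof (intro sum.cong refl)
    fix p q
    show "pos_act N X p (pos_act N Y q T) w - pos_act N Y q (pos_act N X p T) w =
      (if q = p then pos_act N X p (pos_act N Y p T) w - pos_act N Y p (pos_act N X p T) w else 0)"
      using pos_act_commute[of p q N X Y T] by simp
  qed
  also have "\<dots> = (\<Sum>p<?L. pos_act N (bracket N X Y) p T w)"
    by (simp add: bracket_def pos_act_diff_matrix pos_act_same)
  finally show "lie_act N (bracket N X Y) T w = (lie_act N X (lie_act N Y T) - lie_act N Y (lie_act N X T)) w"
    by (simp add: lie_act_pos_act[of N "bracket N X Y"])
qed

lemma lie_act_add: "lie_act N X (S + T) = lie_act N X S + lie_act N X T"
  by (auto simp: lie_act_def fun_eq_iff algebra_simps sum.distrib)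

lemma lie_act_scale: "lie_act N X (c *\<^sub>C T) = c *\<^sub>C lie_act N X T"
  by (auto simp: lie_act_def fun_eq_iff algebra_simps sum_distrib_left)

lemma lie_act_0 [simp]: "lie_act N X 0 = 0"
  by (auto simp: lie_act_def fun_eq_iff)

lemma lie_act_sum: "lie_act N X (\<Sum>x\<in>A. T x) = (\<Sum>x\<in>A. lie_act N X (T x))"
proof (induction A rule: infinite_finite_induct)
  case (insert x F)
  show ?case unfolding sum.insert[OF insert.hyps] lie_act_add insert.IH ..
qed (simp_all only: sum.infinite sum.empty not_False_eq_True lie_act_0)

lemma lie_act_diff: "lie_act N X (S - T) = lie_act N X S - lie_act N X T"
  using lie_act_add[of N X "S - T" T] by (metis add_diff_cancel_right' diff_add_cancel)

lemma lie_act_add_matrix: "lie_act N (X + Y) T = lie_act N X T + lie_act N Y T"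
  by (auto simp: lie_act_def fun_eq_iff algebra_simps sum.distrib)

lemma lie_act_scale_matrix: "lie_act N (c *\<^sub>C X) T = c *\<^sub>C lie_act N X T"
  by (auto simp: lie_act_def fun_eq_iff algebra_simps sum_distrib_left)

lemma lie_act_0_matrix: "lie_act N 0 T = 0"
  by (auto simp: lie_act_def fun_eq_iff)

lemma lie_act_sum_matrix: "lie_act N (\<Sum>x\<in>A. X x) T = (\<Sum>x\<in>A. lie_act N (X x) T)"
proof (induction A rule: infinite_finite_induct)
  case (insert x F)
  show ?case unfolding sum.insert[OF insert.hyps] lie_act_add_matrix insert.IH ..
qed (simp_all only: sum.infinite sum.empty not_False_eq_True lie_act_0_matrix)

lemma lie_act_span_in:
  assumes "T \<in> cfun.span S" "cfun.subspace W"
    and "\<And>T. T \<in> S \<Longrightarrow> lie_act N X T \<in> W"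
  shows "lie_act N X T \<in> W"
proof -
  have "cfun.subspace {T. lie_act N X T \<in> W}"
    using assms(2) by (intro cfun.subspaceI)
      (auto simp: lie_act_add lie_act_scale cfun.subspace_0 cfun.subspace_add cfun.subspace_scale)
  thus ?thesis using cfun.span_minimal[of S "{T. lie_act N X T \<in> W}"] assms by blast
qed

lemma subspace_tensors: "cfun.subspace (tensors N k)"
  by (auto simp: cfun.subspace_def tensors_def)

lemma finite_tensor_words: "finite (tensor_words N k)"
proof -
  have "tensor_words N k = {w. set w \<subseteq> {1..N} \<and> length w = k}" by (auto simp: tensor_words_def)
  thus ?thesis using finite_lists_length_eq[of "{1..N}" k] by simp
qed

lemma tensors_span: "tensors N k \<subseteq> cfun.span (unit_vec ` tensor_words N k)"
proof
  fix T assume T: "T \<in> tensors N k"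
  have "T = (\<Sum>u\<in>tensor_words N k. T u *\<^sub>C unit_vec u)"
  proof
    fix w
    have "(\<Sum>u\<in>tensor_words N k. T u *\<^sub>C unit_vec u) w = (\<Sum>u\<in>tensor_words N k. if u = w then T w else 0)"
      unfolding sum_fun_apply by (rule sum.cong) (auto simp: unit_vec_def)
    also have "\<dots> = T w" using T finite_tensor_words[of N k] by (auto simp: tensors_def)
    finally show "T w = (\<Sum>u\<in>tensor_words N k. T u *\<^sub>C unit_vec u) w" by simp
  qed
  also have "\<dots> \<in> cfun.span (unit_vec ` tensor_words N k)"
    by (intro cfun.span_sum cfun.span_scale cfun.span_base) simp
  finally show "T \<in> cfun.span (unit_vec ` tensor_words N k)" .
qed

lemma pos_act_tensors:
  assumes X: "\<And>a b. X (a, b) \<noteq> 0 \<Longrightarrow> a \<in> {1..N}" and T: "T \<in> tensors N k"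
  shows "pos_act N X p T \<in> tensors N k"
proof -
  have "pos_act N X p T w = 0" if w: "w \<notin> tensor_words N k" for w
  proof (rule ccontr)
    assume "pos_act N X p T w \<noteq> 0"
    then obtain j where p: "p < length w" and j: "j \<in> {1..N}" "X (w ! p, j) * T (w[p := j]) \<noteq> 0"
      unfolding pos_act_def by (auto elim: sum.not_neutral_contains_not_neutral split: if_splits)
    hence "w ! p \<in> {1..N}" "w[p := j] \<in> tensor_words N k" using X T by (auto simp: tensors_def)
    moreover have "w = w[p := j, p := w ! p]" by simp
    hence "set w \<subseteq> insert (w ! p) (set (w[p := j]))" by (metis set_update_subset_insert)
    ultimately show False using w by (auto simp: tensor_words_def)
  qed
  thus ?thesis by (simp add: tensors_def)
qed

lemma lie_act_tensors_eq:
  assumes "T \<in> tensors N k"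
  shows "lie_act N X T = (\<Sum>p<k. pos_act N X p T)"
proof
  fix w :: "nat list"
  show "lie_act N X T w = (\<Sum>p<k. pos_act N X p T) w"
  proof (cases "length w = k")
    case True
    thus ?thesis by (simp add: lie_act_pos_act sum_fun_apply)
  next
    case False
    hence "T (w[p := j]) = 0" for p j using assms by (auto simp: tensors_def tensor_words_def)
    thus ?thesis by (auto simp: lie_act_def sum_fun_apply pos_act_def intro!: sum.neutral)
  qed
qed

lemma glD: "X \<in> gl N \<Longrightarrow> X (a, b) \<noteq> 0 \<Longrightarrow> a \<in> {1..N}"
  unfolding gl_def by blast

lemma lie_act_tensors:
  assumes "\<And>a b. X (a, b) \<noteq> 0 \<Longrightarrow> a \<in> {1..N}" "T \<in> tensors N k" shows "lie_act N X T \<in> tensors N k"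
  unfolding lie_act_tensors_eq[OF assms(2)]
  by (intro cfun.subspace_sum subspace_tensors pos_act_tensors assms)

section \<open>The Young diagram\<close>

lemma part_antimono: "i \<le> j \<Longrightarrow> part n m j \<le> part n m i"
  unfolding part_def by (intro sum_mono2) auto

lemma concat_rows:
  assumes "distinct is"
  shows "length (concat (map (\<lambda>i. map (\<lambda>j. (i, j)) [0..<f i]) is)) = (\<Sum>i\<in>set is. f i)"
    "distinct (concat (map (\<lambda>i. map (\<lambda>j. (i, j)) [0..<f i]) is))"
    "set (concat (map (\<lambda>i. map (\<lambda>j. (i, j)) [0..<f i]) is)) = {(i, j). i \<in> set is \<and> j < f i}"
  using assms by (induction "is") (auto simp: distinct_map inj_on_def)

lemma boxes_facts:
  shows length_boxes: "length (boxes n m) = part_size n m"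
    and distinct_boxes: "distinct (boxes n m)"
    and set_boxes: "set (boxes n m) = {(i, j). 1 \<le> i \<and> i \<le> n \<and> j < part n m i}"
proof -
  have "set [1..<n + 1] = {1..n}" by auto
  thus "length (boxes n m) = part_size n m" "distinct (boxes n m)"
    "set (boxes n m) = {(i, j). 1 \<le> i \<and> i \<le> n \<and> j < part n m i}"
    unfolding boxes_def part_size_def using concat_rows[of "[1..<n + 1]" "part n m"] by auto
qed

definition box_row :: "nat \<Rightarrow> (nat \<Rightarrow> nat) \<Rightarrow> nat \<Rightarrow> nat"
  where "box_row n m p = fst (boxes n m ! p)"

definition box_col :: "nat \<Rightarrow> (nat \<Rightarrow> nat) \<Rightarrow> nat \<Rightarrow> nat"
  where "box_col n m p = snd (boxes n m ! p)"

text \<open>The length of column \<open>t\<close>, that is, the conjugate partition; the inserted 0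
  is the value for columns beyond the diagram.\<close>

definition height :: "nat \<Rightarrow> (nat \<Rightarrow> nat) \<Rightarrow> nat \<Rightarrow> nat"
  where "height n m t = Max (insert 0 {i \<in> {1..n}. t < part n m i})"

lemma height_le: "height n m t \<le> n"
  unfolding height_def by (intro Max.boundedI) auto

lemma height_iff:
  assumes "1 \<le> i" "i \<le> n"
  shows "i \<le> height n m t \<longleftrightarrow> t < part n m i"
proof
  assume "t < part n m i"
  thus "i \<le> height n m t" unfolding height_def using assms by (intro Max_ge) auto
next
  assume i: "i \<le> height n m t"
  have "height n m t \<in> insert 0 {i \<in> {1..n}. t < part n m i}"
    unfolding height_def by (rule Max_in) auto
  hence "t < part n m (height n m t)" using i assms by auto
  thus "t < part n m i" using part_antimono[OF i, of n m] by linarith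
qed

lemma box_bounds:
  assumes "p < part_size n m"
  shows "1 \<le> box_row n m p" "box_row n m p \<le> n" "box_col n m p < part n m (box_row n m p)"
    "box_row n m p \<le> height n m (box_col n m p)"
proof -
  have "boxes n m ! p \<in> set (boxes n m)" using assms by (simp add: length_boxes)
  thus *: "1 \<le> box_row n m p" "box_row n m p \<le> n" "box_col n m p < part n m (box_row n m p)"
    unfolding set_boxes box_row_def box_col_def by auto
  thus "box_row n m p \<le> height n m (box_col n m p)" by (simp add: height_iff)
qed

lemma box_exists:
  assumes "1 \<le> i" "i \<le> n" "j < part n m i"
  obtains p where "p < part_size n m" "box_row n m p = i" "box_col n m p = j"
proof -
  have "(i, j) \<in> set (boxes n m)" unfolding set_boxes using assms by auto
  then obtain p where "p < length (boxes n m)" "boxes n m ! p = (i, j)" by (auto simp: in_set_conv_nth)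
  thus ?thesis using that[of p] by (simp add: length_boxes box_row_def box_col_def)
qed

lemma box_inj:
  assumes "p < part_size n m" "q < part_size n m" "box_row n m p = box_row n m q" "box_col n m p = box_col n m q"
  shows "p = q"
proof -
  have "boxes n m ! p = boxes n m ! q" using assms(3,4) unfolding box_row_def box_col_def by (rule prod_eqI)
  thus ?thesis using distinct_boxes[of n m] assms(1,2) by (simp add: nth_eq_iff_index_eq length_boxes)
qed

definition col_set :: "nat \<Rightarrow> (nat \<Rightarrow> nat) \<Rightarrow> nat \<Rightarrow> nat set"
  where "col_set n m t = {p. p < part_size n m \<and> box_col n m p = t}"

lemma finite_col_set [simp]: "finite (col_set n m t)"
  by (simp add: col_set_def)

lemma bij_col_set: "bij_betw (box_row n m) (col_set n m t) {1..height n m t}"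
  unfolding bij_betw_def
proof
  show "inj_on (box_row n m) (col_set n m t)" by (auto simp: inj_on_def col_set_def intro: box_inj)
  show "box_row n m ` col_set n m t = {1..height n m t}"
  proof safe
    fix p assume "p \<in> col_set n m t"
    thus "box_row n m p \<in> {1..height n m t}" using box_bounds[of p n m] by (auto simp: col_set_def)
  next
    fix i assume i: "i \<in> {1..height n m t}"
    hence "1 \<le> i" "i \<le> n" using height_le[of n m t] by auto
    with i obtain p where "p < part_size n m" "box_row n m p = i" "box_col n m p = t"
      using height_iff[of i n m t] by (auto elim: box_exists)
    thus "i \<in> box_row n m ` col_set n m t" by (auto simp: col_set_def)
  qed
qed

lemma card_col_set: "card (col_set n m t) = height n m t"
  using bij_betw_same_card[OF bij_col_set[of n m t]] by simp

lemma sum_col_set: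
  fixes f :: "nat \<Rightarrow> 'b::comm_monoid_add"
  shows "(\<Sum>p<part_size n m. f p) = (\<Sum>t<part n m 1. \<Sum>p\<in>col_set n m t. f p)"
proof -
  have "(\<Sum>t<part n m 1. \<Sum>p\<in>{p \<in> {..<part_size n m}. box_col n m p = t}. f p) = (\<Sum>p<part_size n m. f p)"
  proof (rule sum.group)
    show "box_col n m ` {..<part_size n m} \<subseteq> {..<part n m 1}"
      using box_bounds[of _ n m] part_antimono[of 1 "box_row n m _" n m] by (fastforce intro: less_le_trans)
  qed auto
  thus ?thesis by (simp add: col_set_def)
qed

section \<open>Column-antisymmetric tensors\<close>

text \<open>In coordinates, the tensor product over the columns of the exterior powers of V. It
  contains the Schur module and is stable under the action on a single column, which the Schur
  module need not be.\<close>

definition col_anti :: "nat \<Rightarrow> (nat \<Rightarrow> nat) \<Rightarrow> tensor set"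
  where "col_anti n m = {T \<in> tensors (2 * n + 1) (part_size n m).
    \<forall>p q w. p < part_size n m \<and> q < part_size n m \<and> p \<noteq> q \<and> box_col n m p = box_col n m q \<and>
      length w = part_size n m \<longrightarrow> T (w[p := w ! q, q := w ! p]) = - T w}"

lemma col_antiD:
  assumes "T \<in> col_anti n m" "p \<in> col_set n m t" "q \<in> col_set n m t" "p \<noteq> q" "length w = part_size n m"
  shows "T (w[p := w ! q, q := w ! p]) = - T w"
  using assms unfolding col_anti_def col_set_def by simp

lemma subspace_col_anti: "cfun.subspace (col_anti n m)"
  using subspace_tensors[of "2 * n + 1" "part_size n m"] unfolding cfun.subspace_def col_anti_def by auto

lemma col_anti_tensors: "T \<in> col_anti n m \<Longrightarrow> T \<in> tensors (2 * n + 1) (part_size n m)"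
  by (simp add: col_anti_def)

lemma col_anti_repeat:
  assumes T: "T \<in> col_anti n m" and "p \<in> col_set n m t" "q \<in> col_set n m t" "p \<noteq> q" "w ! p = w ! q"
  shows "T w = 0"
proof (cases "length w = part_size n m")
  case True
  have "w[p := w ! q, q := w ! p] = w" using assms(5) by (metis list_update_id)
  thus ?thesis using col_antiD[OF assms(1-4) True] by simp
next
  case False
  thus ?thesis using T by (auto simp: col_anti_def tensors_def tensor_words_def)
qed

text \<open>Exchanging two letters in one column conjugates the action at r to the action at the
  transposed position. Summed over a whole column this is a reindexing, so \<open>col_act\<close>
  preserves antisymmetry.\<close>

lemma pos_act_swap:
  assumes T: "T \<in> col_anti n m" and pq: "p \<in> col_set n m t" "q \<in> col_set n m t" "p \<noteq> q"
    and w: "length w = part_size n m" and r: "r < part_size n m"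
  shows "pos_act N X r T (w[p := w ! q, q := w ! p]) = - pos_act N X (transpose p q r) T w"
proof -
  have lt: "p < length w" "q < length w" "r < length w" using pq w r by (auto simp: col_set_def)
  have tr: "transpose p q r < length w" using lt by (auto simp: transpose_def)
  have l: "length (w[a := x]) = part_size n m" for a x using w by simp
  have a: "w[p := w ! q, q := w ! p] ! r = w ! transpose p q r"
    using lt pq(3) by (auto simp: transpose_def nth_list_update)
  have "w[p := w ! q, q := w ! p, r := j] =
      w[transpose p q r := j, p := w[transpose p q r := j] ! q, q := w[transpose p q r := j] ! p]" for j
    using lt pq(3) by (auto simp: list_eq_iff_nth_eq nth_list_update transpose_def)
  hence "T (w[p := w ! q, q := w ! p, r := j]) = - T (w[transpose p q r := j])" for j
    using col_antiD[OF T pq l] by metis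
  thus ?thesis using a lt tr by (simp add: pos_act_def sum_negf)
qed

definition col_act :: "nat \<Rightarrow> (nat \<Rightarrow> nat) \<Rightarrow> matrix \<Rightarrow> nat \<Rightarrow> tensor \<Rightarrow> tensor"
  where "col_act n m X t T = (\<Sum>p\<in>col_set n m t. pos_act (2 * n + 1) X p T)"

lemma col_act_anti:
  assumes X: "\<And>a b. X (a, b) \<noteq> 0 \<Longrightarrow> a \<in> {1..2 * n + 1}" and T: "T \<in> col_anti n m"
  shows "col_act n m X s T \<in> col_anti n m"
  unfolding col_anti_def
proof (intro CollectI conjI allI impI; (elim conjE)?)
  show "col_act n m X s T \<in> tensors (2 * n + 1) (part_size n m)" unfolding col_act_def
    by (intro cfun.subspace_sum subspace_tensors pos_act_tensors X col_anti_tensors T)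
  fix p q and w :: "nat list" assume pq: "p < part_size n m" "q < part_size n m" "p \<noteq> q" "box_col n m p = box_col n m q"
    and w: "length w = part_size n m"
  let ?N = "2 * n + 1"
  have "col_act n m X s T (w[p := w ! q, q := w ! p]) =
      (\<Sum>r\<in>col_set n m s. - pos_act ?N X (transpose p q r) T w)"
    unfolding col_act_def sum_fun_apply using pos_act_swap[OF T _ _ pq(3) w, of "box_col n m p"] pq
    by (intro sum.cong refl) (auto simp: col_set_def)
  also have "\<dots> = - (\<Sum>r\<in>col_set n m s. pos_act ?N X (transpose p q r) T w)" by (simp add: sum_negf)
  also have "bij_betw (transpose p q) (col_set n m s) (col_set n m s)"
    by (rule bij_betw_byWitness[where f' = "transpose p q"]) (use pq in \<open>auto simp: col_set_def transpose_def\<close>)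
  hence "(\<Sum>r\<in>col_set n m s. pos_act ?N X (transpose p q r) T w) = (\<Sum>r\<in>col_set n m s. pos_act ?N X r T w)"
    by (rule sum.reindex_bij_betw)
  finally show "col_act n m X s T (w[p := w ! q, q := w ! p]) = - col_act n m X s T w"
    by (simp add: col_act_def sum_fun_apply)
qed

lemma lie_act_col_act:
  "T \<in> tensors (2 * n + 1) (part_size n m) \<Longrightarrow> lie_act (2 * n + 1) X T = (\<Sum>t<part n m 1. col_act n m X t T)"
  unfolding lie_act_tensors_eq col_act_def by (rule sum_col_set)

lemma col_act_add: "col_act n m X t (S + T) = col_act n m X t S + col_act n m X t T"
  unfolding col_act_def pos_act_add by (rule sum.distrib)

lemma col_act_scale: "col_act n m X t (c *\<^sub>C T) = c *\<^sub>C col_act n m X t T"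
  unfolding col_act_def pos_act_scale cfun.scale_sum_right ..

lemma col_act_commute:
  assumes "s \<noteq> t"
  shows "col_act n m X s (col_act n m Y t T) = col_act n m Y t (col_act n m X s T)"
proof -
  let ?N = "2 * n + 1"
  have "col_act n m X s (col_act n m Y t T) =
      (\<Sum>p\<in>col_set n m s. \<Sum>q\<in>col_set n m t. pos_act ?N X p (pos_act ?N Y q T))"
    unfolding col_act_def pos_act_sum ..
  also have "\<dots> = (\<Sum>p\<in>col_set n m s. \<Sum>q\<in>col_set n m t. pos_act ?N Y q (pos_act ?N X p T))"
    by (intro sum.cong refl pos_act_commute) (use assms in \<open>auto simp: col_set_def\<close>)
  also have "\<dots> = (\<Sum>q\<in>col_set n m t. \<Sum>p\<in>col_set n m s. pos_act ?N Y q (pos_act ?N X p T))"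
    by (rule sum.swap)
  also have "\<dots> = col_act n m Y t (col_act n m X s T)"
    unfolding col_act_def pos_act_sum ..
  finally show ?thesis .
qed

text \<open>Terms at one position contain the matrix square, which is the trace times the matrix and
  so vanishes. Terms at two positions contract the symmetric tensor of \<open>\<xi>\<close> with
  itself against an antisymmetric T.\<close>

lemma col_act_square:
  assumes T: "T \<in> col_anti n m" and tr: "(\<Sum>a=1..2 * n + 1. \<xi> a * y a) = 0"
  shows "col_act n m (\<lambda>(a, b). y a * \<xi> b) t (col_act n m (\<lambda>(a, b). y a * \<xi> b) t T) = 0"
proof -
  let ?N = "2 * n + 1" and ?X = "\<lambda>(a, b). y a * \<xi> b"
  have "pos_act ?N ?X p (pos_act ?N ?X q T) w = 0"
    if pq: "p \<in> col_set n m t" "q \<in> col_set n m t" for p q w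
  proof (cases "p = q")
    case True
    have "mat_mul ?N ?X ?X = 0"
    proof
      fix ab :: "nat \<times> nat"
      obtain a b where ab: "ab = (a, b)" by force
      have "mat_mul ?N ?X ?X ab = y a * \<xi> b * (\<Sum>k=1..?N. \<xi> k * y k)"
        unfolding ab mat_mul_def by (simp add: sum_distrib_left mult_ac)
      thus "mat_mul ?N ?X ?X ab = 0 ab" using tr by simp
    qed
    thus ?thesis unfolding True pos_act_same by (simp add: pos_act_def)
  next
    case pq': False
    show ?thesis
    proof (cases "length w = part_size n m")
      case False
      hence "T (w[p := j, q := l]) = 0" for j l
        using T by (auto simp: col_anti_def tensors_def tensor_words_def)
      thus ?thesis by (auto simp: pos_act_def intro!: sum.neutral)
    next
      case True
      have lt: "p < length w" "q < length w" using pq True by (auto simp: col_set_def)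
      define S where "S = (\<Sum>j=1..?N. \<Sum>l=1..?N. \<xi> j * \<xi> l * T (w[p := j, q := l]))"
      have sw: "T (w[p := j, q := l]) = - T (w[p := l, q := j])" for j l
      proof -
        have "w[p := j, q := l] = w[p := l, q := j, p := w[p := l, q := j] ! q, q := w[p := l, q := j] ! p]"
          using lt pq' by (auto simp: list_eq_iff_nth_eq nth_list_update)
        thus ?thesis using col_antiD[OF T pq pq', of "w[p := l, q := j]"] True by (metis length_list_update)
      qed
      have "S = (\<Sum>l=1..?N. \<Sum>j=1..?N. \<xi> j * \<xi> l * T (w[p := j, q := l]))"
        unfolding S_def by (rule sum.swap)
      also have "\<dots> = (\<Sum>l=1..?N. \<Sum>j=1..?N. - (\<xi> l * \<xi> j * T (w[p := l, q := j])))"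
        by (intro sum.cong refl) (subst sw, simp add: mult_ac)
      also have "\<dots> = - S" unfolding S_def by (simp add: sum_negf)
      finally have S0: "S = 0" by simp
      have "pos_act ?N ?X p (pos_act ?N ?X q T) w = y (w ! p) * y (w ! q) * S"
        using lt pq' unfolding S_def by (simp add: pos_act_def sum_distrib_left mult_ac)
      thus ?thesis using S0 by simp
    qed
  qed
  thus ?thesis unfolding col_act_def pos_act_sum by (intro ext) (simp add: sum_fun_apply)
qed

text \<open>The binomial expansion for commuting operators of square zero. Splitting off one
  operator A gives \<open>C^(d+1) = B^(d+1) + (d+1) B^d A\<close>, and induction on the set kills
  both terms. The subspace \<open>W\<close> is there because the squares are only known to vanish on
  column-antisymmetric tensors.\<close>

lemma nilpotent_sum:
  fixes A :: "'t \<Rightarrow> tensor \<Rightarrow> tensor"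
  assumes "finite S"
    and add: "\<And>t T U. A t (T + U) = A t T + A t U" and scale: "\<And>t c T. A t (c *\<^sub>C T) = c *\<^sub>C A t T"
    and comm: "\<And>s t T. s \<noteq> t \<Longrightarrow> A s (A t T) = A t (A s T)"
    and closed: "\<And>t T. T \<in> W \<Longrightarrow> A t T \<in> W" and sub: "cfun.subspace W"
    and sq: "\<And>t T. T \<in> W \<Longrightarrow> A t (A t T) = 0"
    and "T \<in> W" "card S < D"
  shows "((\<lambda>T. \<Sum>t\<in>S. A t T) ^^ D) T = 0"
  using assms(1) \<open>T \<in> W\<close> \<open>card S < D\<close>
proof (induction S arbitrary: D T)
  case empty
  thus ?case by (cases D) simp_all
next
  case (insert x S)
  let ?B = "\<lambda>T. \<Sum>t\<in>S. A t T" and ?C = "\<lambda>T. \<Sum>t\<in>insert x S. A t T"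
  have C: "?C T = A x T + ?B T" for T using insert.hyps by simp
  have A0: "A t 0 = 0" for t using scale[of t 0 0] by simp
  have Asum: "A t (\<Sum>s\<in>S'. f s) = (\<Sum>s\<in>S'. A t (f s))" for t f and S' :: "'t set"
  proof (induction S' rule: infinite_finite_induct)
    case (insert x F)
    show ?case unfolding sum.insert[OF insert.hyps] add insert.IH ..
  qed (simp_all only: sum.infinite sum.empty not_False_eq_True A0)
  have Badd: "?B (T + U) = ?B T + ?B U" for T U by (simp add: add sum.distrib)
  have Bscale: "?B (c *\<^sub>C T) = c *\<^sub>C ?B T" for c T unfolding scale cfun.scale_sum_right ..
  have AB: "A x (?B T) = ?B (A x T)" for T unfolding Asum using insert.hyps by (intro sum.cong refl comm) auto
  have ABn: "A x ((?B ^^ d) T) = (?B ^^ d) (A x T)" for d T by (induction d) (simp_all only: funpow.simps comp_apply id_apply AB)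
  have B0: "(?B ^^ d) 0 = 0" for d
    by (induction d) (simp_all only: funpow.simps comp_apply id_apply A0 sum.neutral_const)
  have formula: "(?C ^^ Suc d) T = (?B ^^ Suc d) T + of_nat (Suc d) *\<^sub>C ((?B ^^ d) (A x T))" if T: "T \<in> W" for d T
  proof (induction d)
    case 0
    show ?case unfolding funpow.simps comp_apply id_apply C by (simp add: add.commute)
  next
    case (Suc d)
    have "(?C ^^ Suc (Suc d)) T = ?C ((?C ^^ Suc d) T)" by (simp only: funpow.simps(2)[of "Suc d"] comp_apply)
    also have "\<dots> = ?C ((?B ^^ Suc d) T + of_nat (Suc d) *\<^sub>C ((?B ^^ d) (A x T)))"
      using Suc.IH by (rule arg_cong)
    also have "\<dots> = A x ((?B ^^ Suc d) T + of_nat (Suc d) *\<^sub>C ((?B ^^ d) (A x T)))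
        + ?B ((?B ^^ Suc d) T + of_nat (Suc d) *\<^sub>C ((?B ^^ d) (A x T)))"
      by (rule C)
    also have "\<dots> = A x ((?B ^^ Suc d) T) + A x (of_nat (Suc d) *\<^sub>C ((?B ^^ d) (A x T)))
        + (?B ((?B ^^ Suc d) T) + ?B (of_nat (Suc d) *\<^sub>C ((?B ^^ d) (A x T))))"
      by (rule arg_cong2[of _ _ _ _ "(+)"], rule add, rule Badd)
    also have "A x ((?B ^^ Suc d) T) = (?B ^^ Suc d) (A x T)" by (rule ABn)
    also have "A x (of_nat (Suc d) *\<^sub>C ((?B ^^ d) (A x T))) = 0"
      unfolding scale ABn sq[OF T] B0 by simp
    also have "?B (of_nat (Suc d) *\<^sub>C ((?B ^^ d) (A x T))) = of_nat (Suc d) *\<^sub>C ((?B ^^ Suc d) (A x T))"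
      unfolding Bscale by simp
    finally have "(?C ^^ Suc (Suc d)) T = (?B ^^ Suc d) (A x T) + 0 +
        (?B ((?B ^^ Suc d) T) + of_nat (Suc d) *\<^sub>C ((?B ^^ Suc d) (A x T)))" .
    thus ?case unfolding funpow.simps(2)[of "Suc d" ?B] comp_apply by (auto simp: fun_eq_iff algebra_simps)
  qed
  obtain d where d: "D = Suc d" using insert.prems by (cases D) auto
  have "card S < d" using insert.prems insert.hyps d by simp
  hence "(?B ^^ Suc d) T = 0" "(?B ^^ d) (A x T) = 0"
    using insert.IH[OF insert.prems(1), of "Suc d"] insert.IH[OF closed[OF insert.prems(1)], of d x] by auto
  thus ?case unfolding d formula[OF insert.prems(1)] by simp
qed


section \<open>The highest weight vector\<close>

lemma permute_list_transpose:
  assumes "p < length w" "q < length w"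
  shows "permute_list (transpose p q) w = w[p := w ! q, q := w ! p]"
proof (rule nth_equalityI)
  fix i assume "i < length (permute_list (transpose p q) w)"
  hence i: "i < length w" by simp
  show "permute_list (transpose p q) w ! i = w[p := w ! q, q := w ! p] ! i"
    by (cases "i = q"; cases "i = p") (use assms i in \<open>simp_all add: permute_list_def transpose_def\<close>)
qed simp

text \<open>The symmetrizer applies the column antisymmetrisation last, so replacing \<tau> by its
  product with a transposition of a column permutes the summands and changes every sign.\<close>

lemma schur_module_anti: "schur_module n m \<subseteq> col_anti n m"
proof
  fix T assume "T \<in> schur_module n m"
  then obtain S where S: "S \<in> tensors (2 * n + 1) (part_size n m)" and T: "T = young_symmetrizer n m S"
    unfolding schur_module_def by blast
  let ?K = "part_size n m" and ?N = "2 * n + 1"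
  have perms: "inv (\<sigma> \<circ> \<tau>) permutes {..<?K}" if "\<sigma> \<in> row_stab n m" "\<tau> \<in> col_stab n m" for \<sigma> \<tau>
    using that by (intro permutes_inv permutes_compose) (auto simp: row_stab_def col_stab_def)
  show "T \<in> col_anti n m" unfolding col_anti_def
  proof (intro CollectI conjI allI impI; (elim conjE)?)
    have "perm_act S (\<sigma> \<circ> \<tau>) \<in> tensors ?N ?K" if st: "\<sigma> \<in> row_stab n m" "\<tau> \<in> col_stab n m" for \<sigma> \<tau>
      unfolding tensors_def perm_act_def
    proof (intro CollectI allI impI)
      fix w assume w: "w \<notin> tensor_words ?N ?K"
      have "permute_list (inv (\<sigma> \<circ> \<tau>)) w \<notin> tensor_words ?N ?K"
      proof (cases "length w = ?K")
        case True
        hence "set (permute_list (inv (\<sigma> \<circ> \<tau>)) w) = set w" using perms[OF st] by (intro set_permute_list) simp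
        thus ?thesis using w True by (simp add: tensor_words_def)
      qed (simp add: tensor_words_def)
      thus "S (permute_list (inv (\<sigma> \<circ> \<tau>)) w) = 0" using S by (simp add: tensors_def)
    qed
    thus "T \<in> tensors ?N ?K" unfolding T young_symmetrizer_def
      by (intro cfun.subspace_sum cfun.subspace_scale subspace_tensors)
  next
    fix p q and w :: "nat list"
    assume pq: "p < ?K" "q < ?K" "p \<noteq> q" "box_col n m p = box_col n m q" and w: "length w = ?K"
    let ?\<theta> = "transpose p q"
    have \<theta>: "?\<theta> permutes {..<?K}" using pq by (intro permutes_swap_id) auto
    have \<theta>c: "box_col n m (?\<theta> r) = box_col n m r" for r using pq(4) by (auto simp: transpose_def)
    have bij: "bij_betw (\<lambda>\<tau>. \<tau> \<circ> ?\<theta>) (col_stab n m) (col_stab n m)"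
    proof (rule bij_betw_byWitness[where f' = "\<lambda>\<tau>. \<tau> \<circ> ?\<theta>"])
      have "\<tau> \<circ> ?\<theta> \<in> col_stab n m" if "\<tau> \<in> col_stab n m" for \<tau>
      proof -
        have \<tau>: "\<tau> permutes {..<?K}" and c: "\<And>r. r < ?K \<Longrightarrow> box_col n m (\<tau> r) = box_col n m r"
          using that by (auto simp: col_stab_def box_col_def)
        have "?\<theta> r < ?K" if "r < ?K" for r using permutes_in_image[OF \<theta>, of r] that by simp
        thus ?thesis unfolding col_stab_def using permutes_compose[OF \<theta> \<tau>] c \<theta>c by (simp add: box_col_def)
      qed
      thus "(\<lambda>\<tau>. \<tau> \<circ> ?\<theta>) ` col_stab n m \<subseteq> col_stab n m" by blast
      thus "(\<lambda>\<tau>. \<tau> \<circ> ?\<theta>) ` col_stab n m \<subseteq> col_stab n m" .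
    qed (auto simp: comp_assoc)
    have term_eq: "of_int (sign \<tau>) * S (permute_list (inv (\<sigma> \<circ> \<tau>)) (permute_list ?\<theta> w)) =
        - (of_int (sign (\<tau> \<circ> ?\<theta>)) * S (permute_list (inv (\<sigma> \<circ> (\<tau> \<circ> ?\<theta>))) w))"
      if st: "\<sigma> \<in> row_stab n m" "\<tau> \<in> col_stab n m" for \<sigma> \<tau>
    proof -
      have b: "bij \<sigma>" "bij \<tau>" "bij ?\<theta>" using st by (auto simp: row_stab_def col_stab_def permutes_bij)
      have i\<theta>: "inv ?\<theta> = ?\<theta>" by simp
      have "inv (\<sigma> \<circ> (\<tau> \<circ> ?\<theta>)) = inv ((\<sigma> \<circ> \<tau>) \<circ> ?\<theta>)" by (simp add: comp_assoc)
      also have "\<dots> = ?\<theta> \<circ> inv (\<sigma> \<circ> \<tau>)" using b by (subst o_inv_distrib) (auto simp: bij_comp)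
      finally have "permute_list (inv (\<sigma> \<circ> (\<tau> \<circ> ?\<theta>))) w = permute_list (inv (\<sigma> \<circ> \<tau>)) (permute_list ?\<theta> w)"
        using permute_list_compose[of "inv (\<sigma> \<circ> \<tau>)" w ?\<theta>] perms[OF st] w by simp
      moreover have "sign (\<tau> \<circ> ?\<theta>) = - sign \<tau>"
      proof -
        have "permutation \<tau>" "permutation ?\<theta>" using st \<theta>
          by (auto simp: col_stab_def permutation_permutes)
        thus ?thesis using pq(3) by (simp add: sign_compose sign_swap_id)
      qed
      ultimately show ?thesis by simp
    qed
    have "T (w[p := w ! q, q := w ! p]) = T (permute_list ?\<theta> w)"
      using permute_list_transpose[of p w q] pq w by simp
    also have "\<dots> = (\<Sum>\<sigma>\<in>row_stab n m. \<Sum>\<tau>\<in>col_stab n m.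
        of_int (sign \<tau>) * S (permute_list (inv (\<sigma> \<circ> \<tau>)) (permute_list ?\<theta> w)))"
      unfolding T young_symmetrizer_def sum_fun_apply by (simp add: perm_act_def)
    also have "\<dots> = (\<Sum>\<sigma>\<in>row_stab n m. - (\<Sum>\<tau>\<in>col_stab n m.
        of_int (sign (\<tau> \<circ> ?\<theta>)) * S (permute_list (inv (\<sigma> \<circ> (\<tau> \<circ> ?\<theta>))) w)))"
      unfolding sum_negf[symmetric] by (intro sum.cong refl term_eq)
    also have "\<dots> = (\<Sum>\<sigma>\<in>row_stab n m. - (\<Sum>\<tau>\<in>col_stab n m.
        of_int (sign \<tau>) * S (permute_list (inv (\<sigma> \<circ> \<tau>)) w)))"
      by (intro sum.cong refl arg_cong[of _ _ uminus] sum.reindex_bij_betw[OF bij, of "\<lambda>\<tau>. of_int (sign \<tau>) * S (permute_list (inv (_ \<circ> \<tau>)) w)"])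
    also have "\<dots> = - T w"
      unfolding T young_symmetrizer_def sum_fun_apply by (simp add: perm_act_def sum_negf)
    finally show "T (w[p := w ! q, q := w ! p]) = - T w" .
  qed
qed

text \<open>In this column v is a multiple of e_1 \<and> ... \<and> e_h. If X preserves the span of
  e_1, ..., e_h, it acts on this top exterior power by its trace. With a zero trace the column is
  killed, which is how columns are discarded in the straightening relations.\<close>

lemma col_act_triangular:
  assumes v: "v \<in> col_anti n m"
    and supp: "\<And>w t. v w \<noteq> 0 \<Longrightarrow> bij_betw (\<lambda>p. w ! p) (col_set n m t) {1..height n m t}"
    and X: "\<And>a b. X (a, b) \<noteq> 0 \<Longrightarrow> a \<in> {1..2 * n + 1}"
    and tri: "\<And>a b. b \<in> {1..height n m t} \<Longrightarrow> X (a, b) \<noteq> 0 \<Longrightarrow> a \<in> {1..height n m t}"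
  shows "col_act n m X t v = (\<Sum>a=1..height n m t. X (a, a)) *\<^sub>C v"
proof
  fix u
  let ?N = "2 * n + 1" and ?C = "col_set n m t"
  show "col_act n m X t v u = ((\<Sum>a=1..height n m t. X (a, a)) *\<^sub>C v) u"
  proof (cases "length u = part_size n m \<and> inj_on (\<lambda>p. u ! p) ?C")
    case False
    have "T u = 0" if T: "T \<in> col_anti n m" for T
    proof (cases "length u = part_size n m")
      case True
      with False obtain p q where "p \<in> ?C" "q \<in> ?C" "p \<noteq> q" "u ! p = u ! q" unfolding inj_on_def by auto
      thus ?thesis by (intro col_anti_repeat[OF T])
    next
      case False
      thus ?thesis using T by (auto simp: col_anti_def tensors_def tensor_words_def)
    qed
    from this[OF v] this[OF col_act_anti[OF X v]] show ?thesis by simp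
  next
    case True
    have hN: "height n m t \<le> ?N" using height_le[of n m t] by simp
    have term_eq: "pos_act ?N X p v u = X (u ! p, u ! p) * v u" if p: "p \<in> ?C" for p
    proof -
      have pl: "p < length u" using p True by (simp add: col_set_def)
      have nz: "j = u ! p \<and> j \<in> {1..?N}" if "X (u ! p, j) * v (u[p := j]) \<noteq> 0" for j
      proof -
        have bij: "bij_betw (\<lambda>r. u[p := j] ! r) ?C {1..height n m t}" using supp that by simp
        have "u[p := j] ! p = j" using pl by simp
        hence j: "j \<in> {1..height n m t}" using bij p unfolding bij_betw_def by force
        hence "u ! p \<in> {1..height n m t}" using tri[OF j, of "u ! p"] that by (metis mult_eq_0_iff)
        then obtain q where q: "q \<in> ?C" "u[p := j] ! q = u ! p" using bij unfolding bij_betw_def by (metis imageE)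
        have "q = p"
        proof (rule ccontr)
          assume "q \<noteq> p"
          hence "u ! q = u ! p" using q by simp
          thus False using True q(1) p \<open>q \<noteq> p\<close> by (auto simp: inj_on_def)
        qed
        thus ?thesis using q pl j hN by auto
      qed
      have "(\<Sum>j=1..?N. X (u ! p, j) * v (u[p := j])) = (\<Sum>j=1..?N. if j = u ! p then X (u ! p, u ! p) * v u else 0)"
        by (rule sum.cong) (use nz in auto)
      also have "\<dots> = X (u ! p, u ! p) * v u"
        using nz[of "u ! p"] by auto
      finally show ?thesis using pl by (simp add: pos_act_def)
    qed
    have "col_act n m X t v u = (\<Sum>p\<in>?C. X (u ! p, u ! p)) * v u"
      unfolding col_act_def sum_fun_apply sum_distrib_right using term_eq by (intro sum.cong) auto
    also have "\<dots> = (\<Sum>a=1..height n m t. X (a, a)) * v u"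
    proof (cases "v u = 0")
      case False
      thus ?thesis using sum.reindex_bij_betw[OF supp[OF False, of t], of "\<lambda>a. X (a, a)"] by simp
    qed simp
    finally show ?thesis by simp
  qed
qed

locale hw_vector =
  fixes n :: nat and m :: "nat \<Rightarrow> nat" and v :: tensor
  assumes n: "n \<ge> 1" and hw: "highest_weight_vector n m v"
begin

lemma v_anti: "v \<in> col_anti n m"
  using hw schur_module_anti by (auto simp: highest_weight_vector_def)

lemma v_length: "v w \<noteq> 0 \<Longrightarrow> length w = part_size n m"
  using v_anti by (auto simp: col_anti_def tensors_def tensor_words_def)

text \<open>The torus element that scales e_a by 2 and fixes the other basis vectors multiplies the
  coordinate at \<open>w\<close> by 2 to the number of letters a; the weight of v fixes this
  power.\<close>

lemma v_content:
  assumes w: "v w \<noteq> 0" and a: "a \<in> {1..2 * n + 1}"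
  shows "card {p. p < part_size n m \<and> w ! p = a} = (if a \<le> n then part n m a else 0)"
proof -
  let ?N = "2 * n + 1" and ?K = "part_size n m"
  have wt: "w \<in> tensor_words ?N ?K" using v_anti w by (auto simp: col_anti_def tensors_def)
  hence len: "length w = ?K" by (simp add: tensor_words_def)
  define t :: "nat \<Rightarrow> complex" where "t = (\<lambda>i. if i = a then 2 else 1)"
  let ?g = "\<lambda>(i, j). if i = j then t i else 0"
  have "group_act ?N ?g v w = (\<Sum>u\<in>tensor_words ?N ?K. if u = w then (\<Prod>p<?K. t (w ! p)) * v w else 0)"
    unfolding group_act_def len
  proof (intro sum.cong refl)
    fix u assume u: "u \<in> tensor_words ?N ?K"
    show "(\<Prod>p<?K. ?g (w ! p, u ! p)) * v u = (if u = w then (\<Prod>p<?K. t (w ! p)) * v w else 0)"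
    proof (cases "u = w")
      case False
      then obtain p where "p < ?K" "w ! p \<noteq> u ! p" using u len by (auto simp: list_eq_iff_nth_eq tensor_words_def)
      hence "(\<Prod>p<?K. ?g (w ! p, u ! p)) = 0" by (intro prod_zero) auto
      thus ?thesis using False by simp
    qed simp
  qed
  also have "\<dots> = (\<Prod>p<?K. t (w ! p)) * v w" using wt finite_tensor_words[of ?N ?K] by simp
  finally have "(\<Prod>i=1..n. t i ^ part n m i) * v w = (\<Prod>p<?K. t (w ! p)) * v w"
    using hw unfolding highest_weight_vector_def by (auto simp: t_def)
  hence "(\<Prod>i=1..n. t i ^ part n m i) = (\<Prod>p<?K. t (w ! p))" using w by simp
  moreover have "(\<Prod>i=1..n. t i ^ part n m i) = (\<Prod>i=1..n. if i = a then 2 ^ part n m a else 1)"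
    by (rule prod.cong) (auto simp: t_def)
  moreover have "(\<Prod>p<?K. t (w ! p)) = (\<Prod>p\<in>{p \<in> {..<?K}. w ! p = a}. 2)"
    unfolding t_def by (rule prod.inter_filter[symmetric]) simp
  moreover have "{p \<in> {..<?K}. w ! p = a} = {p. p < ?K \<and> w ! p = a}" by auto
  ultimately have "(2::complex) ^ card {p. p < ?K \<and> w ! p = a} = (if a \<le> n then 2 ^ part n m a else 1)"
    using a by auto
  hence "(2::complex) ^ card {p. p < ?K \<and> w ! p = a} = 2 ^ (if a \<le> n then part n m a else 0)"
    by simp
  hence "of_nat (2 ^ card {p. p < ?K \<and> w ! p = a}) = (of_nat (2 ^ (if a \<le> n then part n m a else 0)) :: complex)"
    by (simp only: of_nat_power of_nat_numeral)
  hence "(2::nat) ^ card {p. p < ?K \<and> w ! p = a} = 2 ^ (if a \<le> n then part n m a else 0)"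
    by (rule of_nat_eq_iff[THEN iffD1])
  thus ?thesis by simp
qed

lemma v_inj:
  assumes "v w \<noteq> 0" shows "inj_on (\<lambda>p. w ! p) (col_set n m t)"
  using col_anti_repeat[OF v_anti] assms unfolding inj_on_def by blast

text \<open>Induction on the letter a. A column of height less than a already contains all letters
  up to its height and has no room left for a. The occurrences of a thus lie in distinct columns of
  height at least a, and there are as many of them as such columns.\<close>

lemma v_supp:
  assumes w: "v w \<noteq> 0"
  shows "bij_betw (\<lambda>p. w ! p) (col_set n m t) {1..height n m t}"
proof -
  have cover: "\<exists>p\<in>col_set n m t. w ! p = a" if "1 \<le> a" "a \<le> height n m t" for a t
    using that
  proof (induction a arbitrary: t rule: less_induct)
    case (less a)
    have an: "a \<le> n" using less.prems height_le[of n m t] by simp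
    let ?P = "{p. p < part_size n m \<and> w ! p = a}"
    have "inj_on (box_col n m) ?P"
    proof (rule inj_onI)
      fix p q assume "p \<in> ?P" "q \<in> ?P" "box_col n m p = box_col n m q"
      hence "p \<in> col_set n m (box_col n m p)" "q \<in> col_set n m (box_col n m p)" "w ! p = w ! q"
        by (simp_all add: col_set_def)
      thus "p = q" using v_inj[OF w] unfolding inj_on_def by blast
    qed
    moreover have "box_col n m ` ?P \<subseteq> {..<part n m a}"
    proof (intro image_subsetI)
      fix p assume "p \<in> ?P"
      hence p: "p < part_size n m" "w ! p = a" by simp_all
      let ?t = "box_col n m p"
      show "?t \<in> {..<part n m a}"
      proof (rule ccontr)
        assume "?t \<notin> {..<part n m a}"
        hence h: "height n m ?t < a" using height_iff[OF less.prems(1) an, of m ?t] by simp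
        have "{1..height n m ?t} \<subseteq> (\<lambda>p. w ! p) ` (col_set n m ?t - {p})"
        proof
          fix b assume b: "b \<in> {1..height n m ?t}"
          hence "\<exists>q\<in>col_set n m ?t. w ! q = b" using h by (intro less.IH) auto
          thus "b \<in> (\<lambda>p. w ! p) ` (col_set n m ?t - {p})" using b h p by auto
        qed
        hence "height n m ?t \<le> card ((\<lambda>p. w ! p) ` (col_set n m ?t - {p}))"
          using card_mono[of "(\<lambda>p. w ! p) ` (col_set n m ?t - {p})" "{1..height n m ?t}"] by simp
        also have "\<dots> \<le> card (col_set n m ?t - {p})" by (intro card_image_le) simp
        also have "\<dots> < card (col_set n m ?t)" using p by (intro psubset_card_mono) (auto simp: col_set_def)
        finally show False by (simp add: card_col_set)
      qed
    qed
    moreover have "card ?P = part n m a" using v_content[OF w, of a] less.prems an by simp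
    ultimately have "box_col n m ` ?P = {..<part n m a}"
      by (intro card_subset_eq) (simp_all add: card_image)
    moreover have "t < part n m a" using less.prems an height_iff by blast
    ultimately have "t \<in> box_col n m ` ?P" by simp
    then obtain p where "p < part_size n m" "w ! p = a" "box_col n m p = t" by auto
    thus ?case by (intro bexI[of _ p]) (simp_all add: col_set_def)
  qed
  have "{1..height n m t} \<subseteq> (\<lambda>p. w ! p) ` col_set n m t" using cover[of _ t] by fastforce
  moreover have "card ((\<lambda>p. w ! p) ` col_set n m t) = height n m t"
    using card_image[OF v_inj[OF w, of t]] by (simp add: card_col_set)
  ultimately have "{1..height n m t} = (\<lambda>p. w ! p) ` col_set n m t"
    by (intro card_subset_eq) simp_all
  thus ?thesis using v_inj[OF w, of t] by (simp add: bij_betw_def)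
qed

lemma v_letters:
  assumes "v w \<noteq> 0" "p < part_size n m"
  shows "w ! p \<in> {1..height n m (box_col n m p)}"
  using v_supp[OF assms(1), of "box_col n m p"] assms(2) unfolding bij_betw_def col_set_def by blast

lemma v_sum_letters:
  assumes w: "v w \<noteq> 0"
  shows "(\<Sum>p<part_size n m. f (w ! p)) = (\<Sum>a=1..n. of_nat (part n m a) * (f a :: complex))"
proof -
  let ?K = "part_size n m"
  have eq: "(\<Sum>a=1..n. \<Sum>p\<in>{p \<in> {..<?K}. w ! p = a}. f (w ! p)) = (\<Sum>p<?K. f (w ! p))"
  proof (rule sum.group)
    show "(\<lambda>p. w ! p) ` {..<?K} \<subseteq> {1..n}"
      using v_letters[OF w] height_le[of n m] by (fastforce intro: order_trans)
  qed auto
  have "(\<Sum>p\<in>{p \<in> {..<?K}. w ! p = a}. f (w ! p)) = of_nat (part n m a) * f a" if "a \<in> {1..n}" for a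
  proof -
    have "(\<Sum>p\<in>{p \<in> {..<?K}. w ! p = a}. f (w ! p)) = (\<Sum>p\<in>{p \<in> {..<?K}. w ! p = a}. f a)"
      by (rule sum.cong) auto
    thus ?thesis using v_content[OF w, of a] that by simp
  qed
  thus ?thesis unfolding eq[symmetric] by (intro sum.cong refl)
qed

definition row_word :: "nat list"
  where "row_word = map (box_row n m) [0..<part_size n m]"

text \<open>Within each column the letters of a nonzero coordinate are a permutation of the row
  numbers. Exchanging letters only changes the sign, and each exchange puts one more letter in
  place.\<close>

lemma v_row_word: "v row_word \<noteq> 0"
proof -
  let ?K = "part_size n m"
  obtain w where w: "v w \<noteq> 0" using hw unfolding highest_weight_vector_def by (auto simp: fun_eq_iff)
  have "v w \<noteq> 0 \<Longrightarrow> v row_word \<noteq> 0" for w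
  proof (induction "card {p. p < ?K \<and> w ! p \<noteq> box_row n m p}" arbitrary: w rule: less_induct)
    case (less w)
    have len: "length w = ?K" using v_length less.prems by blast
    show ?case
    proof (cases "\<exists>p<?K. w ! p \<noteq> box_row n m p")
      case False
      hence "w = row_word" using len by (auto simp: row_word_def list_eq_iff_nth_eq)
      thus ?thesis using less.prems by simp
    next
      case True
      then obtain p where p: "p < ?K" "w ! p \<noteq> box_row n m p" by blast
      let ?t = "box_col n m p"
      have pC: "p \<in> col_set n m ?t" using p by (simp add: col_set_def)
      have "box_row n m p \<in> {1..height n m ?t}" using box_bounds[OF p(1)] by simp
      then obtain q where q: "q \<in> col_set n m ?t" "w ! q = box_row n m p"
        using v_supp[OF less.prems, of ?t] unfolding bij_betw_def by (metis imageE)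
      have pq: "p \<noteq> q" using p q by auto
      have qK: "q < ?K" using q by (simp add: col_set_def)
      have rq: "box_row n m q \<noteq> box_row n m p" using box_inj[of q n m p] q p pq by (auto simp: col_set_def)
      let ?w = "w[p := w ! q, q := w ! p]"
      have "v ?w = - v w" by (rule col_antiD[OF v_anti pC q(1) pq len])
      hence nz: "v ?w \<noteq> 0" using less.prems by simp
      have "{r. r < ?K \<and> ?w ! r \<noteq> box_row n m r} \<subset> {r. r < ?K \<and> w ! r \<noteq> box_row n m r}"
      proof (rule psubsetI)
        show "{r. r < ?K \<and> ?w ! r \<noteq> box_row n m r} \<subseteq> {r. r < ?K \<and> w ! r \<noteq> box_row n m r}"
          using p q qK len rq pq by (auto simp: nth_list_update)
        have "p \<notin> {r. r < ?K \<and> ?w ! r \<noteq> box_row n m r}" using p q len pq by simp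
        thus "{r. r < ?K \<and> ?w ! r \<noteq> box_row n m r} \<noteq> {r. r < ?K \<and> w ! r \<noteq> box_row n m r}" using p by blast
      qed
      hence "card {r. r < ?K \<and> ?w ! r \<noteq> box_row n m r} < card {r. r < ?K \<and> w ! r \<noteq> box_row n m r}"
        by (intro psubset_card_mono) auto
      thus ?thesis using less.hyps nz by blast
    qed
  qed
  thus ?thesis using w by blast
qed

end

text \<open>The pointwise rules would eta-expand sums of tensors inside membership statements.\<close>

declare plus_fun_apply [simp del] minus_apply [simp del] zero_fun_apply [simp del] uminus_apply [simp del]

lemmas fun_apply = plus_fun_apply minus_apply zero_fun_apply uminus_apply

section \<open>The PBW filtration\<close>

context hw_vector
begin

abbreviation "act \<equiv> lie_act (2 * n + 1)"
abbreviation "filt \<equiv> pbw_filtration n v"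

definition lower_filt :: "nat \<Rightarrow> tensor set"
  where "lower_filt s = (case s of 0 \<Rightarrow> {0} | Suc r \<Rightarrow> filt r)"

lemma subspace_filt: "cfun.subspace (filt s)"
  by (simp add: pbw_filtration_def)

lemma subspace_lower_filt: "cfun.subspace (lower_filt s)"
  by (simp add: lower_filt_def subspace_filt split: nat.split)

lemma filt_mono: "s \<le> s' \<Longrightarrow> filt s \<subseteq> filt s'"
  unfolding pbw_filtration_def by (intro cfun.span_mono) auto

lemma foldr_filt: "set xs \<subseteq> lower_sp n \<Longrightarrow> length xs \<le> s \<Longrightarrow> foldr act xs v \<in> filt s"
  unfolding pbw_filtration_def ext_n_minus_eq by (intro cfun.span_base) blast

lemma v_filt: "v \<in> filt s"
  using foldr_filt[of "[]" s] by simp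

lemma filt_step:
  assumes "X \<in> lower_sp n" "T \<in> filt s" shows "act X T \<in> filt (Suc s)"
proof (rule lie_act_span_in[OF _ subspace_filt])
  show "T \<in> cfun.span {foldr act xs v |xs. set xs \<subseteq> lower_sp n \<and> length xs \<le> s}"
    using assms(2) unfolding pbw_filtration_def ext_n_minus_eq .
  fix T assume "T \<in> {foldr act xs v |xs. set xs \<subseteq> lower_sp n \<and> length xs \<le> s}"
  then obtain xs where "T = foldr act xs v" "set xs \<subseteq> lower_sp n" "length xs \<le> s" by blast
  thus "act X T \<in> filt (Suc s)" using foldr_filt[of "X # xs" "Suc s"] assms(1) by simp
qed

lemma odd_sp_gl: "X \<in> odd_sp n \<Longrightarrow> X (a, b) \<noteq> 0 \<Longrightarrow> a \<in> {1..2 * n + 1}"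
  by (rule glD) (simp_all add: odd_sp_def)

text \<open>In the order given by \<open>place\<close> the vectors e_1, ..., e_n come first, so an
  upper triangular matrix preserves the span belonging to every column and acts on v by a
  scalar.\<close>

lemma upper_v:
  assumes B: "B \<in> upper_sp n"
  shows "act B v \<in> filt 0"
proof -
  have gl: "a \<in> {1..2 * n + 1}" if "B (a, b) \<noteq> 0" for a b
    using odd_sp_gl[OF upper_sp_odd_sp[OF B] that] .
  have "col_act n m B t v = (\<Sum>a=1..height n m t. B (a, a)) *\<^sub>C v" for t
  proof (rule col_act_triangular[OF v_anti v_supp gl])
    fix a b assume b: "b \<in> {1..height n m t}" and nz: "B (a, b) \<noteq> 0"
    have bn: "b \<le> n" using b height_le[of n m t] by simp
    have "place n a \<le> place n b" using B nz by (simp add: upper_sp_def)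
    hence "place n a \<le> b" using bn by (simp add: place_def)
    thus "a \<in> {1..height n m t}" using gl[OF nz] b bn by (auto simp: place_def split: if_splits)
  qed
  hence "act B v = (\<Sum>t<part n m 1. (\<Sum>a=1..height n m t. B (a, a)) *\<^sub>C v)"
    unfolding lie_act_col_act[OF col_anti_tensors[OF v_anti]] by simp
  thus ?thesis by (simp add: cfun.subspace_sum cfun.subspace_scale subspace_filt v_filt)
qed

text \<open>Moving B past x leaves the bracket, applied to one factor fewer. Its lower part restores
  the lost degree and its upper part is covered by induction, so upper triangular operators never
  raise the filtration degree.\<close>

lemma upper_foldr:
  "set xs \<subseteq> lower_sp n \<Longrightarrow> B \<in> upper_sp n \<Longrightarrow> act B (foldr act xs v) \<in> filt (length xs)"
proof (induction xs arbitrary: B)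
  case Nil
  thus ?case using upper_v by simp
next
  case (Cons x xs)
  let ?T = "foldr act xs v" and ?br = "bracket (2 * n + 1) B x"
  have x: "x \<in> lower_sp n" and xs: "set xs \<subseteq> lower_sp n" using Cons.prems by auto
  have br: "?br \<in> odd_sp n"
    using Cons.prems x by (intro bracket_odd_sp) (auto intro: lower_sp_odd_sp upper_sp_odd_sp)
  have T: "?T \<in> filt (length xs)" by (rule foldr_filt[OF xs]) simp
  have "?br = lower_part n ?br + (?br - lower_part n ?br)" by simp
  hence "act ?br ?T = act (lower_part n ?br) ?T + act (?br - lower_part n ?br) ?T"
    by (metis lie_act_add_matrix)
  moreover have "act (lower_part n ?br) ?T \<in> filt (Suc (length xs))"
    by (intro filt_step lower_part_in br T)
  moreover have "act (?br - lower_part n ?br) ?T \<in> filt (Suc (length xs))"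
    using Cons.IH[OF xs upper_part_in[OF br]] filt_mono[OF le_SucI[OF order_refl]] by blast
  moreover have "act x (act B ?T) \<in> filt (Suc (length xs))"
    by (intro filt_step x Cons.IH xs Cons.prems)
  moreover have "act B (act x ?T) = act ?br ?T + act x (act B ?T)"
    using lie_act_bracket[of "2 * n + 1" B x ?T] by simp
  ultimately show ?case by (simp add: cfun.subspace_add subspace_filt)
qed

lemma upper_filt:
  assumes "B \<in> upper_sp n" "T \<in> filt s" shows "act B T \<in> filt s"
proof (rule lie_act_span_in[OF _ subspace_filt])
  show "T \<in> cfun.span {foldr act xs v |xs. set xs \<subseteq> lower_sp n \<and> length xs \<le> s}"
    using assms(2) unfolding pbw_filtration_def ext_n_minus_eq .
  fix T assume "T \<in> {foldr act xs v |xs. set xs \<subseteq> lower_sp n \<and> length xs \<le> s}"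
  then obtain xs where "T = foldr act xs v" "set xs \<subseteq> lower_sp n" "length xs \<le> s" by blast
  thus "act B T \<in> filt s" using upper_foldr[of xs B] assms(1) filt_mono[of "length xs" s] by blast
qed

lemma odd_filt:
  assumes "X \<in> odd_sp n" "T \<in> filt s" shows "act X T \<in> filt (Suc s)"
proof -
  have "act X T = act (lower_part n X) T + act (X - lower_part n X) T"
    by (metis lie_act_add_matrix add_diff_cancel_left' diff_add_cancel add.commute)
  moreover have "act (X - lower_part n X) T \<in> filt (Suc s)"
    using upper_filt[OF upper_part_in[OF assms(1)] assms(2)] filt_mono[of s "Suc s"] by auto
  ultimately show ?thesis
    using filt_step[OF lower_part_in[OF assms(1)] assms(2)] by (simp add: cfun.subspace_add subspace_filt)
qed

text \<open>Telescoping: with L the lower part, the difference for the next power is X applied to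
  the old difference, plus X - L applied to a power of L on v. The first term gains one degree and
  the second none. This turns an exact vanishing of a power of X into a relation between lower
  triangular monomials modulo the lower piece.\<close>

lemma power_lower_part:
  assumes X: "X \<in> odd_sp n"
  shows "(act X ^^ Suc r) v - (act (lower_part n X) ^^ Suc r) v \<in> filt r"
proof (induction r)
  case 0
  have "act X v = act (lower_part n X) v + act (X - lower_part n X) v"
    by (metis lie_act_add_matrix add_diff_cancel_left' diff_add_cancel add.commute)
  thus ?case using upper_v[OF upper_part_in[OF X]] by simp
next
  case (Suc r)
  let ?L = "lower_part n X"
  have Lr: "(act ?L ^^ r) v \<in> filt r" for r
    by (induction r) (simp_all add: v_filt filt_step lower_part_in X)
  have "(act X ^^ Suc (Suc r)) v - (act ?L ^^ Suc (Suc r)) v =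
      act X ((act X ^^ Suc r) v) - act ?L ((act ?L ^^ Suc r) v)"
    by (simp only: funpow.simps(2)[of "Suc r"] comp_apply)
  also have "\<dots> = act X ((act X ^^ Suc r) v - (act ?L ^^ Suc r) v) + act (X - ?L) ((act ?L ^^ Suc r) v)"
  proof -
    have "act X T = act ?L T + act (X - ?L) T" for T
      by (metis lie_act_add_matrix add_diff_cancel_left' diff_add_cancel add.commute)
    thus ?thesis unfolding lie_act_diff by simp
  qed
  also have "\<dots> \<in> filt (Suc r)"
    by (intro cfun.subspace_add subspace_filt odd_filt X Suc.IH upper_filt upper_part_in Lr)
  finally show ?case .
qed

lemma foldr_move:
  assumes "X \<in> lower_sp n" "set ys \<subseteq> lower_sp n" "set zs \<subseteq> lower_sp n"
  shows "foldr act (ys @ X # zs) v - foldr act (X # ys @ zs) v \<in> filt (length ys + length zs)"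
  using assms(2)
proof (induction ys)
  case Nil
  show ?case unfolding append_Nil diff_self by (rule cfun.subspace_0[OF subspace_filt])
next
  case (Cons y ys)
  let ?T = "foldr act (ys @ zs) v"
  have y: "y \<in> lower_sp n" using Cons.prems by simp
  have T: "?T \<in> filt (length ys + length zs)"
    using Cons.prems assms(3) by (intro foldr_filt) auto
  have "foldr act ((y # ys) @ X # zs) v - foldr act (X # (y # ys) @ zs) v =
      act y (foldr act (ys @ X # zs) v) - act X (act y ?T)"
    by simp
  also have "\<dots> = act y (foldr act (ys @ X # zs) v - foldr act (X # ys @ zs) v) + act (bracket (2 * n + 1) y X) ?T"
    unfolding lie_act_diff lie_act_bracket by simp
  also have "\<dots> \<in> filt (Suc (length ys + length zs))"
    using Cons.prems by (intro cfun.subspace_add subspace_filt filt_step y bracket_lower_sp T assms Cons.IH) simp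
  finally show ?case by (simp del: minus_apply)
qed

text \<open>Each exchange of neighbouring factors costs a bracket, which is a single element of the
  same algebra, so reordering changes the product only by terms with fewer factors.\<close>

lemma foldr_perm:
  assumes "mset xs = mset ys" "set xs \<subseteq> lower_sp n"
  shows "foldr act xs v - foldr act ys v \<in> lower_filt (length xs)"
  using assms
proof (induction xs arbitrary: ys)
  case Nil
  hence "ys = []" by simp
  thus ?case using cfun.subspace_0[OF subspace_lower_filt] by (simp only: diff_self)
next
  case (Cons x xs)
  have "x \<in> set ys" using Cons.prems(1) by (metis list.set_intros(1) set_mset_mset)
  then obtain as bs where ys: "ys = as @ x # bs" by (metis split_list)
  have eq: "mset xs = mset (as @ bs)" using Cons.prems(1) ys by simp
  have len: "length xs = length as + length bs" using eq by (metis length_append size_mset)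
  have sub: "set as \<subseteq> lower_sp n" "set bs \<subseteq> lower_sp n" "x \<in> lower_sp n" "set xs \<subseteq> lower_sp n"
  proof -
    have "set xs = set as \<union> set bs" using eq by (metis set_append set_mset_mset)
    thus "set as \<subseteq> lower_sp n" "set bs \<subseteq> lower_sp n" "x \<in> lower_sp n" "set xs \<subseteq> lower_sp n"
      using Cons.prems(2) by auto
  qed
  have 1: "act x (foldr act xs v - foldr act (as @ bs) v) \<in> filt (length xs)"
  proof (cases "length xs")
    case 0
    hence "xs = []" "as @ bs = []" using len by auto
    thus ?thesis using cfun.subspace_0[OF subspace_filt] by simp
  next
    case (Suc r)
    have "foldr act xs v - foldr act (as @ bs) v \<in> filt r"
      using Cons.IH[OF eq sub(4)] unfolding Suc lower_filt_def by simp
    thus ?thesis unfolding Suc by (intro filt_step sub)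
  qed
  have 2: "foldr act (as @ x # bs) v - foldr act (x # as @ bs) v \<in> filt (length xs)"
    unfolding len by (intro foldr_move sub)
  have "foldr act (x # xs) v - foldr act ys v =
      act x (foldr act xs v - foldr act (as @ bs) v) - (foldr act (as @ x # bs) v - foldr act (x # as @ bs) v)"
    unfolding ys lie_act_diff by simp
  also have "\<dots> \<in> filt (length xs)" by (intro cfun.subspace_diff subspace_filt 1 2)
  finally show ?case by (simp add: lower_filt_def)
qed

section \<open>Monomials in the root vectors\<close>

definition mon_list :: "elt list \<Rightarrow> tensor"
  where "mon_list xs = foldr act (map (neg_vec n) xs) v"

text \<open>The order of the factors is an arbitrary choice; it affects the tensor only modulo the
  preceding filtration piece, and all relations are taken modulo that piece.\<close>

definition mon :: "elt multiset \<Rightarrow> tensor"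
  where "mon M = mon_list (SOME xs. mset xs = M)"

lemma mon_list_cong:
  assumes "set xs \<subseteq> poset n"
  shows "mon_list xs - mon (mset xs) \<in> lower_filt (length xs)"
proof -
  define ys where "ys = (SOME ys. mset ys = mset xs)"
  have "mset ys = mset xs" unfolding ys_def by (rule someI[of _ xs]) simp
  thus ?thesis using foldr_perm[of "map (neg_vec n) xs" "map (neg_vec n) ys"] assms neg_vec_lower[of _ n]
    unfolding mon_def ys_def[symmetric] mon_list_def by auto
qed

lemma mon_list_filt: "set xs \<subseteq> poset n \<Longrightarrow> mon_list xs \<in> filt (length xs)"
  unfolding mon_list_def using neg_vec_lower[of _ n] by (intro foldr_filt) auto

lemma mon_ex:
  obtains xs where "mset xs = M" "mon M = mon_list xs"
  unfolding mon_def using someI_ex[OF ex_mset[of M]] by blast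

lemma mon_filt:
  assumes "set_mset M \<subseteq> poset n" shows "mon M \<in> filt (size M)"
proof -
  obtain xs where "mset xs = M" "mon M = mon_list xs" by (rule mon_ex)
  thus ?thesis using mon_list_filt[of xs] assms by auto
qed

lemma mon_empty: "mon {#} = v"
proof -
  obtain xs where "mset xs = {#}" "mon {#} = mon_list xs" by (rule mon_ex)
  thus ?thesis by (simp add: mon_list_def)
qed

lemma mon_add:
  assumes "\<beta> \<in> poset n" "set_mset M \<subseteq> poset n"
  shows "act (neg_vec n \<beta>) (mon M) - mon (add_mset \<beta> M) \<in> filt (size M)"
proof -
  obtain xs where xs: "mset xs = M" "mon M = mon_list xs" by (rule mon_ex)
  have "act (neg_vec n \<beta>) (mon M) = mon_list (\<beta> # xs)" using xs by (simp add: mon_list_def)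
  thus ?thesis using mon_list_cong[of "\<beta> # xs"] assms xs by (auto simp: lower_filt_def)
qed

lemma filt_span_mon: "filt d \<subseteq> cfun.span {mon M |M. set_mset M \<subseteq> poset n \<and> size M \<le> d}"
proof (induction d)
  case 0
  have "{foldr act xs v |xs. set xs \<subseteq> ext_n_minus n \<and> length xs \<le> 0} \<subseteq> {mon {#}}"
    by (auto simp: mon_empty)
  also have "\<dots> \<subseteq> {mon M |M. set_mset M \<subseteq> poset n \<and> size M \<le> 0}" by auto
  finally show ?case unfolding pbw_filtration_def by (rule cfun.span_mono)
next
  case (Suc d)
  let ?A = "\<lambda>d. cfun.span {mon M |M. set_mset M \<subseteq> poset n \<and> size M \<le> d}"
  have mono: "?A d \<subseteq> ?A (Suc d)" by (intro cfun.span_mono) auto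
  have step: "act X T \<in> ?A (Suc d)" if X: "X \<in> lower_sp n" and T: "T \<in> ?A d" for X T
  proof (rule lie_act_span_in[OF T cfun.subspace_span])
    fix T assume "T \<in> {mon M |M. set_mset M \<subseteq> poset n \<and> size M \<le> d}"
    then obtain M where M: "T = mon M" "set_mset M \<subseteq> poset n" "size M \<le> d" by blast
    have "act (neg_vec n \<alpha>) T \<in> ?A (Suc d)" if a: "\<alpha> \<in> poset n" for \<alpha>
    proof -
      have "act (neg_vec n \<alpha>) (mon M) - mon (add_mset \<alpha> M) \<in> ?A (Suc d)"
        using mon_add[OF a M(2)] filt_mono[OF M(3)] Suc.IH mono by blast
      moreover have "mon (add_mset \<alpha> M) \<in> ?A (Suc d)"
        using M a by (intro cfun.span_base CollectI exI[of _ "add_mset \<alpha> M"]) auto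
      ultimately have "(act (neg_vec n \<alpha>) (mon M) - mon (add_mset \<alpha> M)) + mon (add_mset \<alpha> M) \<in> ?A (Suc d)"
        by (rule cfun.span_add)
      thus ?thesis unfolding M(1) by simp
    qed
    hence "act (\<Sum>\<alpha>\<in>poset n. X (col_idx n (elt_col n \<alpha>), elt_row \<alpha>) *\<^sub>C neg_vec n \<alpha>) T \<in> ?A (Suc d)"
      unfolding lie_act_sum_matrix lie_act_scale_matrix by (intro cfun.span_sum cfun.span_scale)
    thus "act X T \<in> ?A (Suc d)" using lower_sp_expand[OF X] by simp
  qed
  have "foldr act xs v \<in> ?A (Suc d)" if xs: "set xs \<subseteq> lower_sp n" "length xs \<le> Suc d" for xs
  proof (cases xs)
    case Nil
    have "foldr act xs v \<in> filt d" using Nil v_filt by simp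
    thus ?thesis using Suc.IH mono by blast
  next
    case (Cons y ys)
    have "set ys \<subseteq> lower_sp n" "length ys \<le> d" using xs Cons by simp_all
    hence "foldr act ys v \<in> ?A d" using Suc.IH foldr_filt[of ys d] by blast
    thus ?thesis using step xs Cons by simp
  qed
  thus ?case unfolding pbw_filtration_def ext_n_minus_eq by (intro cfun.span_minimal cfun.subspace_span) blast
qed

end

section \<open>Nested matchings minimise the sum of products\<close>

definition letters :: "(nat \<times> nat) multiset \<Rightarrow> nat multiset"
  where "letters S = image_mset fst S + image_mset snd S"

text \<open>Pairs are read as intervals, any two of which are comparable under inclusion. Elements
  of a Dyck path have this property, since along a path rows rise and columns fall.\<close>

definition nested :: "(nat \<times> nat) multiset \<Rightarrow> bool"
  where "nested S \<longleftrightarrow> (\<forall>x\<in>#S. \<forall>y\<in>#S.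
    fst x \<le> fst y \<and> snd y \<le> snd x \<or> fst y \<le> fst x \<and> snd x \<le> snd y)"

text \<open>Uncrossing. If T does not pair the extreme letters a and b, it contains (a, d) and (e,
  b). Replacing them by (a, b) and a pair of d and e keeps the letters and lowers the sum by (b -
  d)(e - a) > 0. Removing (a, b) on both sides then reduces the size.\<close>

lemma nested_minimal:
  assumes "\<And>x. x \<in># S \<Longrightarrow> fst x \<le> snd x" "\<And>x. x \<in># T \<Longrightarrow> fst x \<le> snd x"
    and "nested S" "letters S = letters T"
  shows "(\<Sum>x\<in>#S. fst x * snd x) \<le> (\<Sum>x\<in>#T. fst x * snd x) \<and>
    ((\<Sum>x\<in>#S. fst x * snd x) = (\<Sum>x\<in>#T. fst x * snd x) \<longrightarrow> S = T)"
  using assms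
proof (induction "size S" arbitrary: S T)
  case 0
  hence "S = {#}" "T = {#}" by (auto simp: letters_def)
  thus ?case by simp
next
  case (Suc k)
  let ?W = "\<lambda>S::(nat \<times> nat) multiset. \<Sum>x\<in>#S. fst x * snd x"
  \<comment> \<open>The longest pair of a nested matching consists of the smallest and the largest letter.\<close>
  obtain x where x: "x \<in># S" and longest: "\<And>y. y \<in># S \<Longrightarrow> snd y - fst y \<le> snd x - fst x"
  proof -
    have "finite ((\<lambda>y. snd y - fst y) ` set_mset S)" "(\<lambda>y. snd y - fst y) ` set_mset S \<noteq> {}"
      using Suc.hyps(2) by auto
    from Max_in[OF this] obtain x where "x \<in># S" "snd x - fst x = Max ((\<lambda>y. snd y - fst y) ` set_mset S)" by auto
    thus ?thesis using that[of x] by auto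
  qed
  obtain a b where ab: "x = (a, b)" by (cases x)
  have outer: "a \<le> fst y \<and> snd y \<le> b" if y: "y \<in># S" for y
  proof -
    have "fst x \<le> fst y \<and> snd y \<le> snd x \<or> fst y \<le> fst x \<and> snd x \<le> snd y"
      using Suc.prems(3) x y unfolding nested_def by blast
    thus ?thesis using longest[OF y] Suc.prems(1)[OF y] Suc.prems(1)[OF x] ab by auto
  qed
  have range: "a \<le> l \<and> l \<le> b" if "l \<in># letters T" for l
  proof -
    have "l \<in># letters S" using that Suc.prems(4) by simp
    then obtain y where "y \<in># S" "l = fst y \<or> l = snd y" by (auto simp: letters_def)
    thus ?thesis using outer[of y] Suc.prems(1)[of y] by auto
  qed
  define S' where "S' = S - {#(a, b)#}"
  have S: "S = add_mset (a, b) S'" using x ab by (simp add: S'_def)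
  have S': "size S' = k" "\<And>x. x \<in># S' \<Longrightarrow> fst x \<le> snd x" "nested S'"
    using Suc.hyps(2) Suc.prems(1,3) unfolding S nested_def by auto
  have lT: "y \<in># T \<Longrightarrow> a \<le> fst y \<and> snd y \<le> b" for y
    using range[of "fst y"] range[of "snd y"] by (auto simp: letters_def)
  have "a \<in># letters S" "b \<in># letters S" unfolding S letters_def by auto
  hence "a \<in># letters T" "b \<in># letters T" using Suc.prems(4) by simp_all
  hence "(\<exists>y\<in>#T. fst y = a \<or> snd y = a) \<and> (\<exists>z\<in>#T. fst z = b \<or> snd z = b)"
    unfolding letters_def by (auto simp: image_iff)
  then obtain y z where y: "y \<in># T" "fst y = a" and z: "z \<in># T" "snd z = b"
    using lT Suc.prems(2) by (metis le_antisym)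
  show ?case
  proof (cases "(a, b) \<in># T")
    case True
    then obtain T' where T: "T = add_mset (a, b) T'" by (metis insert_DiffM)
    have "letters S' = letters T'" using Suc.prems(4) unfolding S T letters_def by simp
    hence "?W S' \<le> ?W T' \<and> (?W S' = ?W T' \<longrightarrow> S' = T')"
      using Suc.prems(2) S' unfolding T by (intro Suc.hyps(1)) simp_all
    thus ?thesis unfolding S T by simp
  next
    case False
    obtain d e where de: "y = (a, d)" "z = (e, b)" using y z by (cases y, cases z) auto
    have ne: "d \<noteq> b" "e \<noteq> a" using False y z de by auto
    have "d < b" "a < e" using lT[OF y(1)] lT[OF z(1)] ne de by auto
    hence "a * d + e * b > a * b + d * e"
    proof -
      obtain p q where "b = d + p" "p > 0" "e = a + q" "q > 0"
        using \<open>d < b\<close> \<open>a < e\<close> by (metis less_imp_add_positive)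
      thus ?thesis by (simp add: algebra_simps)
    qed
    note less = this
    have "z \<in># T - {#y#}" using z de ne y by (simp add: in_diff_count)
    then obtain T0 where T: "T = add_mset y (add_mset z T0)"
      using y by (metis insert_DiffM)
    \<comment> \<open>This is T after uncrossing, with (a, b) already removed; \<open>min\<close>
      and \<open>max\<close> only restore the convention that a pair is ordered.\<close>
    define T' where "T' = add_mset (min d e, max d e) T0"
    have "letters S' = letters T'"
      using Suc.prems(4) unfolding S T letters_def T'_def de by (auto simp: min_def max_def add_mset_commute)
    moreover have "fst x \<le> snd x" if "x \<in># T'" for x
      using that Suc.prems(2)[of x] unfolding T T'_def by auto
    ultimately have "?W S' \<le> ?W T'"
      using Suc.hyps(1)[of S' T'] S' by blast
    moreover have "?W T' = d * e + ?W T0" unfolding T'_def by (simp add: min_def max_def mult.commute)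
    moreover have "?W T = a * d + (e * b + ?W T0)" unfolding T de by simp
    moreover have "?W S = a * b + ?W S'" unfolding S by simp
    ultimately have "?W S < ?W T" using less by linarith
    thus ?thesis by simp
  qed
qed

lemma char_independent:
  fixes A :: "nat multiset \<Rightarrow> 'a \<Rightarrow> complex"
  assumes "finite E" and U: "cfun.subspace U"
    and "\<And>\<eta>. (\<And>l. \<eta> l \<noteq> 0) \<Longrightarrow> (\<Sum>e\<in>E. (\<Prod>l\<in>#e. \<eta> l) *\<^sub>C A e) \<in> U"
    and "e \<in> E"
  shows "A e \<in> U"
  using assms(1,3,4)
proof (induction E arbitrary: A e)
  case (insert e0 E)
  have main: "A e \<in> U" if e: "e \<in> E" for e
  proof -
    have "e \<noteq> e0" using e insert.hyps by blast
    then obtain l where l: "count e l \<noteq> count e0 l" by (metis multiset_eqI)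
    define g :: "nat \<Rightarrow> complex" where "g = (\<lambda>x. if x = l then 2 else 1)"
    have g: "(\<Prod>l\<in>#e. g l) = 2 ^ count e l" for e
      by (induction e) (auto simp: g_def)
    let ?c = "\<lambda>e. 2 ^ count e l - 2 ^ count e0 l :: complex"
    have "?c e *\<^sub>C A e \<in> U"
    proof (rule insert.IH[of "\<lambda>e. ?c e *\<^sub>C A e", OF _ e])
      fix \<eta> :: "nat \<Rightarrow> complex" assume \<eta>: "\<And>l. \<eta> l \<noteq> 0"
      have "(\<Sum>e\<in>insert e0 E. (\<Prod>l\<in>#e. g l * \<eta> l) *\<^sub>C A e) - 2 ^ count e0 l *\<^sub>C (\<Sum>e\<in>insert e0 E. (\<Prod>l\<in>#e. \<eta> l) *\<^sub>C A e) \<in> U"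
        using \<eta> by (intro cfun.subspace_diff cfun.subspace_scale U insert.prems) (auto simp: g_def)
      also have "(\<Sum>e\<in>insert e0 E. (\<Prod>l\<in>#e. g l * \<eta> l) *\<^sub>C A e) - 2 ^ count e0 l *\<^sub>C (\<Sum>e\<in>insert e0 E. (\<Prod>l\<in>#e. \<eta> l) *\<^sub>C A e) =
          (\<Sum>e\<in>insert e0 E. (\<Prod>l\<in>#e. \<eta> l) *\<^sub>C (?c e *\<^sub>C A e))"
        unfolding cfun.scale_sum_right sum_subtractf[symmetric]
        by (intro sum.cong refl) (auto simp: fun_eq_iff fun_apply prod_mset.distrib g algebra_simps)
      also have "\<dots> = (\<Sum>e\<in>E. (\<Prod>l\<in>#e. \<eta> l) *\<^sub>C (?c e *\<^sub>C A e))"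
        using insert.hyps by simp
      finally show "(\<Sum>e\<in>E. (\<Prod>l\<in>#e. \<eta> l) *\<^sub>C (?c e *\<^sub>C A e)) \<in> U" .
    qed
    moreover have "?c e \<noteq> 0"
    proof
      assume "?c e = 0"
      hence "of_nat (2 ^ count e l) = (of_nat (2 ^ count e0 l) :: complex)"
        by (simp only: of_nat_power of_nat_numeral right_minus_eq)
      hence "(2::nat) ^ count e l = 2 ^ count e0 l" by (rule of_nat_eq_iff[THEN iffD1])
      thus False using l by simp
    qed
    ultimately show ?thesis using cfun.subspace_scale[OF U, of "?c e *\<^sub>C A e" "inverse (?c e)"]
      by (simp add: cfun.scale_scale del: right_minus_eq)
  qed
  \<comment> \<open>Once all other coefficients are in \<open>U\<close>, evaluating at \<eta> = 1
    yields the one that was eliminated.\<close>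
  have "(\<Sum>e\<in>insert e0 E. (\<Prod>l\<in>#e. 1) *\<^sub>C A e) - (\<Sum>e\<in>E. A e) \<in> U"
    by (intro cfun.subspace_diff U insert.prems(1) cfun.subspace_sum main) auto
  hence "A e0 \<in> U" using insert.hyps by simp
  thus ?case using main insert.prems(2) by blast
qed simp

section \<open>The spanning set\<close>

definition elt_pairs :: "nat \<Rightarrow> elt multiset \<Rightarrow> (nat \<times> nat) multiset"
  where "elt_pairs n M = image_mset (\<lambda>\<alpha>. (elt_row \<alpha>, elt_col n \<alpha>)) M"

text \<open>
  Plays the role of the monomial order: the straightening relations rewrite a monomial outside the
  polytope into monomials of the same degree and larger energy.
\<close>

definition elt_energy :: "nat \<Rightarrow> elt multiset \<Rightarrow> nat"
  where "elt_energy n M = (\<Sum>\<alpha>\<in>#M. elt_row \<alpha> * elt_col n \<alpha>)"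

lemma elt_energy_pairs: "elt_energy n M = (\<Sum>x\<in>#elt_pairs n M. fst x * snd x)"
  by (simp add: elt_energy_def elt_pairs_def image_mset.compositionality comp_def)

lemma elt_pairs_inj:
  assumes "set_mset M \<subseteq> poset n" "set_mset M' \<subseteq> poset n" "elt_pairs n M = elt_pairs n M'"
  shows "M = M'"
proof -
  have "image_mset (\<lambda>(i, c). mk_elt n i c) (elt_pairs n M) = M" if "set_mset M \<subseteq> poset n" for M
  proof -
    have "image_mset (\<lambda>(i, c). mk_elt n i c) (elt_pairs n M) = image_mset (\<lambda>\<alpha>. mk_elt n (elt_row \<alpha>) (elt_col n \<alpha>)) M"
      by (simp add: elt_pairs_def image_mset.compositionality comp_def)
    also have "\<dots> = image_mset (\<lambda>\<alpha>. \<alpha>) M" by (rule image_mset_cong) (use that in auto)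
    finally show ?thesis by simp
  qed
  thus ?thesis using assms by metis
qed

text \<open>Makes straightening terminate: at fixed degree the energy cannot grow forever. The crude
  constant bounds both letters by 2n + 1.\<close>

lemma elt_energy_bound:
  assumes "set_mset M \<subseteq> poset n"
  shows "elt_energy n M \<le> size M * (2 * n + 1) ^ 2"
proof -
  have "elt_energy n M \<le> (\<Sum>\<alpha>\<in>#M. (2 * n + 1) ^ 2)"
    unfolding elt_energy_def
  proof (rule sum_mset_mono)
    fix \<alpha> assume "\<alpha> \<in># M"
    hence "elt_row \<alpha> \<le> 2 * n + 1" "elt_col n \<alpha> \<le> 2 * n + 1" using elt_bounds[of \<alpha> n] assms by auto
    thus "elt_row \<alpha> * elt_col n \<alpha> \<le> (2 * n + 1) ^ 2" by (simp add: power2_eq_square mult_le_mono)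
  qed
  thus ?thesis by simp
qed

lemma elt_energy_minimal:
  assumes S: "set_mset S \<subseteq> poset n" and T: "set_mset T \<subseteq> poset n" and nest: "nested (elt_pairs n S)"
    and l: "letters (elt_pairs n S) = letters (elt_pairs n T)" and ne: "T \<noteq> S"
  shows "elt_energy n S < elt_energy n T"
proof -
  have b: "fst x \<le> snd x" if "x \<in># elt_pairs n M" "set_mset M \<subseteq> poset n" for x M
    using that elt_bounds(3)[of _ n] by (auto simp: elt_pairs_def)
  have "elt_energy n S \<le> elt_energy n T \<and> (elt_energy n S = elt_energy n T \<longrightarrow> elt_pairs n S = elt_pairs n T)"
    unfolding elt_energy_pairs using b S T by (intro nested_minimal nest l) auto
  thus ?thesis using elt_pairs_inj[OF S T] ne by auto
qed

lemma lower_part_expand: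
  assumes X: "X \<in> odd_sp n" and Q: "Q \<subseteq> poset n"
    and eq: "\<And>\<alpha>. \<alpha> \<in> poset n \<Longrightarrow> X (col_idx n (elt_col n \<alpha>), elt_row \<alpha>) = (if \<alpha> \<in> Q then f \<alpha> else 0)"
  shows "lower_part n X = (\<Sum>\<alpha>\<in>Q. f \<alpha> *\<^sub>C neg_vec n \<alpha>)"
proof -
  have "lower_part n X = (\<Sum>\<alpha>\<in>poset n. lower_part n X (col_idx n (elt_col n \<alpha>), elt_row \<alpha>) *\<^sub>C neg_vec n \<alpha>)"
    by (rule lower_sp_expand[OF lower_part_in[OF X]])
  also have "\<dots> = (\<Sum>\<alpha>\<in>poset n. if \<alpha> \<in> Q then f \<alpha> *\<^sub>C neg_vec n \<alpha> else 0)"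
  proof (rule sum.cong[OF refl])
    fix \<alpha> assume a: "\<alpha> \<in> poset n"
    have "place n (elt_row \<alpha>) < place n (col_idx n (elt_col n \<alpha>))"
      using elt_bounds[OF a] place_col_idx[OF elt_col_in[OF a]] by (simp add: place_def)
    hence "lower_part n X (col_idx n (elt_col n \<alpha>), elt_row \<alpha>) = (if \<alpha> \<in> Q then f \<alpha> else 0)"
      using eq[OF a] by (simp add: lower_part_def)
    thus "lower_part n X (col_idx n (elt_col n \<alpha>), elt_row \<alpha>) *\<^sub>C neg_vec n \<alpha> =
        (if \<alpha> \<in> Q then f \<alpha> *\<^sub>C neg_vec n \<alpha> else 0)" by simp
  qed
  also have "\<dots> = (\<Sum>\<alpha>\<in>Q. f \<alpha> *\<^sub>C neg_vec n \<alpha>)"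
    using Q by (simp add: sum.If_cases Int_absorb1)
  finally show ?thesis .
qed

section \<open>Relations obtained from square-zero operators\<close>

context hw_vector
begin

text \<open>A column killed at v stays killed after the other columns have been acted on, because
  actions on different columns commute. On powers applied to v the operator is therefore a sum of
  commuting square-zero operators indexed by \<open>S\<close>.\<close>

lemma rank_one_vanish:
  assumes y: "\<And>a. y a \<noteq> 0 \<Longrightarrow> a \<in> {1..2 * n + 1}" and tr: "(\<Sum>a=1..2 * n + 1. \<xi> a * y a) = 0"
    and S: "S \<subseteq> {..<part n m 1}" "card S < D"
    and inact: "\<And>t. t < part n m 1 \<Longrightarrow> t \<notin> S \<Longrightarrow> col_act n m (\<lambda>(a, b). y a * \<xi> b) t v = 0"
  shows "(act (\<lambda>(a, b). y a * \<xi> b) ^^ D) v = 0"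
proof -
  let ?X = "\<lambda>(a, b). y a * \<xi> b"
  let ?A = "col_act n m ?X" and ?B = "\<lambda>T. \<Sum>t\<in>S. col_act n m (\<lambda>(a, b). y a * \<xi> b) t T"
  have fin: "finite S" using S(1) finite_subset by blast
  have gl: "a \<in> {1..2 * n + 1}" if "?X (a, b) \<noteq> 0" for a b using y[of a] that by auto
  have closed: "?A t T \<in> col_anti n m" if "T \<in> col_anti n m" for t T
    by (rule col_act_anti[OF gl that])
  have Bv: "(?B ^^ d) v \<in> col_anti n m" for d
    by (induction d) (simp_all add: v_anti cfun.subspace_sum subspace_col_anti closed)
  have A0: "?A t 0 = 0" for t using col_act_scale[of n m ?X t 0 0] by simp
  have Asum: "?A t (\<Sum>s\<in>S'. f s) = (\<Sum>s\<in>S'. ?A t (f s))" for t f and S' :: "nat set"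
  proof (induction S' rule: infinite_finite_induct)
    case (insert x F)
    show ?case unfolding sum.insert[OF insert.hyps] col_act_add insert.IH ..
  qed (simp_all only: sum.infinite sum.empty A0 not_False_eq_True)
  have comm: "?A t ((?B ^^ d) T) = (?B ^^ d) (?A t T)" if t: "t \<notin> S" for t d T
  proof (induction d)
    case (Suc d)
    have "?A t ((?B ^^ Suc d) T) = (\<Sum>s\<in>S. ?A t (?A s ((?B ^^ d) T)))"
      unfolding funpow.simps comp_apply Asum ..
    also have "\<dots> = (\<Sum>s\<in>S. ?A s (?A t ((?B ^^ d) T)))"
      by (intro sum.cong refl col_act_commute) (use t in auto)
    finally show ?case unfolding Suc.IH funpow.simps comp_apply .
  qed simp
  have B0: "(?B ^^ d) 0 = 0" for d
    by (induction d) (simp_all only: funpow.simps comp_apply id_apply A0 sum.neutral_const)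
  have "(act ?X ^^ d) v = (?B ^^ d) v" for d
  proof (induction d)
    case (Suc d)
    let ?T = "(?B ^^ d) v"
    have "(act ?X ^^ Suc d) v = (\<Sum>t<part n m 1. ?A t ?T)"
      using lie_act_col_act[OF col_anti_tensors[OF Bv]] Suc.IH by simp
    also have "\<dots> = (\<Sum>t\<in>S. ?A t ?T)"
    proof (rule sum.mono_neutral_right)
      show "\<forall>t\<in>{..<part n m 1} - S. ?A t ?T = 0"
        using comm inact B0 by simp
    qed (use S in auto)
    finally show ?case by simp
  qed simp
  moreover have "(?B ^^ D) v = 0"
    by (rule nilpotent_sum[OF fin col_act_add col_act_scale col_act_commute closed subspace_col_anti
        col_act_square[OF _ tr] v_anti S(2)])
  ultimately show ?thesis by simp
qed

lemma vanish_lower_filt: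
  assumes X: "X \<in> odd_sp n" and Q: "Q \<subseteq> poset n" and D: "D > 0"
    and eq: "\<And>\<alpha>. \<alpha> \<in> poset n \<Longrightarrow> X (col_idx n (elt_col n \<alpha>), elt_row \<alpha>) = (if \<alpha> \<in> Q then f \<alpha> else 0)"
    and van: "(act X ^^ D) v = 0"
  shows "(act (\<Sum>\<alpha>\<in>Q. f \<alpha> *\<^sub>C neg_vec n \<alpha>) ^^ D) v \<in> lower_filt D"
proof -
  obtain r where r: "D = Suc r" using D by (cases D) auto
  have "- ((act X ^^ D) v - (act (lower_part n X) ^^ D) v) \<in> filt r"
    unfolding r by (intro cfun.subspace_neg subspace_filt power_lower_part X)
  hence "(act (lower_part n X) ^^ D) v \<in> filt r" unfolding van by (simp del: funpow.simps)
  moreover have "lower_part n X = (\<Sum>\<alpha>\<in>Q. f \<alpha> *\<^sub>C neg_vec n \<alpha>)"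
    by (rule lower_part_expand[OF X Q]) (rule eq)
  ultimately show ?thesis by (simp add: lower_filt_def r del: funpow.simps)
qed

text \<open>The root vector of \<open>2\<epsilon>\<^sub>i\<close> is the square of a vector; its orbit consists of squares, whose lower
  triangular coordinates are products of two coordinates.\<close>

lemma bar_vanish:
  assumes i: "1 \<le> i" "i \<le> n" and D: "part n m i < D" and \<eta>: "\<And>l. \<eta> l \<noteq> (0::complex)"
  shows "(act (\<Sum>\<alpha>\<in>{\<alpha>\<in>poset n. i \<le> elt_row \<alpha>}. (\<eta> (elt_row \<alpha>) * \<eta> (elt_col n \<alpha>)) *\<^sub>C neg_vec n \<alpha>) ^^ D) v
    \<in> lower_filt D"
proof -
  let ?N = "2 * n + 1"
  \<comment> \<open>The inverse of \<open>col_idx\<close>: the letter carried by a basis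
    index.\<close>
  define c where "c = (\<lambda>a. 2 * n + 2 - place n a)"
  define y where "y = (\<lambda>a. if a \<in> {1..?N} \<and> i \<le> c a \<and> c a \<le> ?N - i then \<eta> (c a) else 0)"
  \<comment> \<open>\<open>\<xi>\<close> is the functional u \<mapsto> \<omega>(u, y), so the matrix
    is u \<mapsto> \<omega>(u, y) y and its trace \<omega>(y, y) is zero. As y carries no letter
    below i, \<open>\<xi>\<close> vanishes on e_1, ..., e_(i-1) and all columns shorter than i are
    killed.\<close>
  define \<xi> where "\<xi> = (\<lambda>b. if b \<in> {1..?N} then idx_sign n b * y (dual_idx n b) else 0)"
  let ?X = "\<lambda>(a, b). y a * \<xi> b"
  have y: "y a \<noteq> 0 \<Longrightarrow> a \<in> {1..?N}" for a by (auto simp: y_def split: if_splits)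
  have X: "?X \<in> odd_sp n" unfolding odd_sp_iff
  proof (intro conjI ballI)
    show "?X \<in> gl ?N" by (auto simp: gl_def y_def \<xi>_def split: if_splits)
    fix a b assume "a \<in> {1..?N}" "b \<in> {1..?N}"
    thus "idx_sign n a * ?X (dual_idx n a, b) = idx_sign n b * ?X (dual_idx n b, a)"
      by (simp add: \<xi>_def del: atLeastAtMost_iff)
  qed
  have tr: "(\<Sum>a=1..?N. \<xi> a * y a) = 0"
  proof -
    have "(\<Sum>a=1..?N. \<xi> a * y a) = (\<Sum>a=1..?N. \<xi> (dual_idx n a) * y (dual_idx n a))"
      by (rule sum_dual_idx[symmetric])
    also have "\<dots> = (\<Sum>a=1..?N. - (\<xi> a * y a))"
    proof (rule sum.cong[OF refl])
      fix a assume a: "a \<in> {1..?N}"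
      show "\<xi> (dual_idx n a) * y (dual_idx n a) = - (\<xi> a * y a)"
        using dual_idx_in[OF a] a by (simp add: \<xi>_def del: atLeastAtMost_iff)
    qed
    finally show ?thesis by (simp add: sum_negf)
  qed
  have cn: "c (n + r) = r" if "1 \<le> r" "r \<le> n" for r using that by (simp add: c_def place_def)
  have \<xi>low: "\<xi> r = (if i \<le> r then \<eta> r else 0)" if r: "1 \<le> r" "r \<le> n" for r
    using r i cn[OF r] by (auto simp: \<xi>_def y_def idx_sign_def dual_idx_def)
  have entry: "?X (col_idx n (elt_col n \<alpha>), elt_row \<alpha>) =
      (if \<alpha> \<in> {\<alpha>\<in>poset n. i \<le> elt_row \<alpha>} then \<eta> (elt_row \<alpha>) * \<eta> (elt_col n \<alpha>) else 0)"
    if a: "\<alpha> \<in> poset n" for \<alpha>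
  proof -
    note b = elt_bounds[OF a]
    have ci: "c (col_idx n (elt_col n \<alpha>)) = elt_col n \<alpha>"
      unfolding c_def place_col_idx[OF elt_col_in[OF a]] using b by simp
    have "y (col_idx n (elt_col n \<alpha>)) = \<eta> (elt_col n \<alpha>)" if "i \<le> elt_row \<alpha>"
      using col_idx_in[OF elt_col_in[OF a]] b that by (simp add: y_def ci)
    thus ?thesis using \<xi>low[OF b(1,2)] a by simp
  qed
  have "(act ?X ^^ D) v = 0"
  proof (rule rank_one_vanish[OF y tr])
    show "{..<part n m i} \<subseteq> {..<part n m 1}" using part_antimono[OF i(1)] by auto
    show "card {..<part n m i} < D" using D by simp
    fix t assume "t \<notin> {..<part n m i}"
    hence h: "height n m t < i" using height_iff[OF i, of m t] by simp
    have z: "\<xi> b = 0" if "b \<in> {1..height n m t}" for b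
      using \<xi>low[of b] that h i by simp
    have "col_act n m ?X t v = (\<Sum>a=1..height n m t. ?X (a, a)) *\<^sub>C v"
      by (rule col_act_triangular[OF v_anti v_supp]) (use y z in auto)
    also have "\<dots> = 0" using z by simp
    finally show "col_act n m ?X t v = 0" .
  qed
  thus ?thesis using D by (intro vanish_lower_filt[OF X _ _ entry]) auto
qed

text \<open>Allows a block matrix diag(A, -A^T), which in general is not of rank one, to be replaced
  by its block A as long as only letters up to n occur, as in v and its images under A.\<close>

lemma lie_act_agree:
  assumes X: "\<And>a b. b \<in> {1..n} \<Longrightarrow> X (a, b) = M (a, b)"
    and T: "\<And>w. T w \<noteq> 0 \<Longrightarrow> set w \<subseteq> {1..n}"
  shows "act X T = act M T"
proof
  fix w
  have "X (w ! p, j) * T (w[p := j]) = M (w ! p, j) * T (w[p := j])" if "p < length w" for p j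
  proof (cases "T (w[p := j]) = 0")
    case False
    have "j \<in> set (w[p := j])" using that by (rule set_update_memI)
    hence "j \<in> {1..n}" using T[OF False] by blast
    thus ?thesis using X by simp
  qed simp
  thus "act X T w = act M T w" unfolding lie_act_def by (intro sum.cong refl) simp
qed

lemma lie_act_low_letters:
  assumes M: "\<And>a b. M (a, b) \<noteq> 0 \<Longrightarrow> a \<in> {1..n}"
    and T: "\<And>w. T w \<noteq> 0 \<Longrightarrow> set w \<subseteq> {1..n}" and w: "act M T w \<noteq> 0"
  shows "set w \<subseteq> {1..n}"
proof -
  obtain p j where p: "p < length w" "M (w ! p, j) * T (w[p := j]) \<noteq> 0"
    using w unfolding lie_act_def by (auto elim!: sum.not_neutral_contains_not_neutral)
  hence "w ! p \<in> {1..n}" "set (w[p := j]) \<subseteq> {1..n}" using M T by auto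
  moreover have "w = w[p := j, p := w ! p]" by simp
  hence "set w \<subseteq> insert (w ! p) (set (w[p := j]))" by (metis set_update_subset_insert)
  ultimately show ?thesis by blast
qed

text \<open>The block has image y with support in i..j+1 and functional \<open>\<xi>\<close> with
  support in i..j. Columns shorter than i are killed because \<open>\<xi>\<close> vanishes on their
  letters, columns taller than j because their span is preserved and the trace is zero. The m_i +
  ... + m_j columns of height between i and j remain.\<close>

lemma plain_vanish:
  assumes ij: "1 \<le> i" "i \<le> j" "j < n" and D: "part n m i < D + part n m (j + 1)"
    and \<eta>: "\<And>l. \<eta> l \<noteq> (0::complex)"
  shows "(act (\<Sum>\<alpha>\<in>{\<alpha>\<in>poset n. i \<le> elt_row \<alpha> \<and> 2 * n + 1 - j \<le> elt_col n \<alpha>}.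
    (\<eta> (elt_row \<alpha>) * \<eta> (elt_col n \<alpha>)) *\<^sub>C neg_vec n \<alpha>) ^^ D) v \<in> lower_filt D"
proof -
  let ?N = "2 * n + 1"
  define \<xi> where "\<xi> = (\<lambda>b. if b \<in> {i..j} then \<eta> b else 0)"
  \<comment> \<open>The free coordinate at \<open>i\<close> makes the rank one matrix traceless, hence of square zero.\<close>
  define y where "y = (\<lambda>a. if a \<in> {i+1..j+1} then \<eta> (2 * n + 2 - a)
    else if a = i then - (\<Sum>b=i+1..j. \<xi> b * \<eta> (2 * n + 2 - b)) / \<eta> i else 0)"
  let ?M = "\<lambda>(a, b). y a * \<xi> b"
  \<comment> \<open>The embedding A \<mapsto> diag(A, -A^T) of gl(n), with zeros in the row and
    column of the radical vector.\<close>
  define X where "X = (\<lambda>(a, b). if a \<le> n \<and> b \<le> n then ?M (a, b)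
    else if a \<in> {n+1..2*n} \<and> b \<in> {n+1..2*n} then - ?M (b - n, a - n) else 0)"
  have y: "y a \<noteq> 0 \<Longrightarrow> a \<in> {i..j+1}" for a using ij by (auto simp: y_def split: if_splits)
  have \<xi>: "\<xi> a \<noteq> 0 \<Longrightarrow> a \<in> {i..j}" for a by (auto simp: \<xi>_def split: if_splits)
  have tr: "(\<Sum>a\<in>A. \<xi> a * y a) = 0" if A: "finite A" "{i..j} \<subseteq> A" for A
  proof -
    have "(\<Sum>a\<in>A. \<xi> a * y a) = (\<Sum>a=i..j. \<xi> a * y a)"
      using A by (intro sum.mono_neutral_right) (auto simp: \<xi>_def)
    also have "\<dots> = \<xi> i * y i + (\<Sum>a=i+1..j. \<xi> a * y a)"
      using ij by (simp add: sum.atLeast_Suc_atMost Suc_eq_plus1)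
    also have "(\<Sum>a=i+1..j. \<xi> a * y a) = (\<Sum>b=i+1..j. \<xi> b * \<eta> (2 * n + 2 - b))"
      by (rule sum.cong) (auto simp: y_def)
    also have "\<xi> i * y i = - (\<Sum>b=i+1..j. \<xi> b * \<eta> (2 * n + 2 - b))"
      using \<eta>[of i] ij by (simp add: \<xi>_def y_def)
    finally show ?thesis by simp
  qed
  have X: "X \<in> odd_sp n" unfolding odd_sp_iff
  proof (intro conjI ballI)
    show "X \<in> gl ?N" unfolding gl_def
    proof (intro CollectI allI impI)
      fix a b assume nz: "X (a, b) \<noteq> 0"
      show "a \<in> {1..?N} \<and> b \<in> {1..?N}"
      proof (cases "a \<le> n \<and> b \<le> n")
        case True
        hence "y a \<noteq> 0" "\<xi> b \<noteq> 0" using nz by (auto simp: X_def)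
        thus ?thesis using y[of a] \<xi>[of b] ij by auto
      next
        case False
        hence "a \<in> {n+1..2*n} \<and> b \<in> {n+1..2*n}" using nz unfolding X_def by (auto split: if_splits)
        thus ?thesis by auto
      qed
    qed
    fix a b assume "a \<in> {1..?N}" "b \<in> {1..?N}"
    thus "idx_sign n a * X (dual_idx n a, b) = idx_sign n b * X (dual_idx n b, a)"
      by (elim idx_cases) (simp_all add: X_def idx_sign_def dual_idx_def)
  qed
  have entry: "X (col_idx n (elt_col n \<alpha>), elt_row \<alpha>) =
      (if \<alpha> \<in> {\<alpha>\<in>poset n. i \<le> elt_row \<alpha> \<and> ?N - j \<le> elt_col n \<alpha>}
        then \<eta> (elt_row \<alpha>) * \<eta> (elt_col n \<alpha>) else 0)"
    if a: "\<alpha> \<in> poset n" for \<alpha>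
  proof -
    note b = elt_bounds[OF a]
    let ?r = "elt_row \<alpha>" and ?c = "elt_col n \<alpha>"
    show ?thesis
    proof (cases "n + 2 \<le> ?c")
      case True
      have ci: "col_idx n ?c = 2 * n + 2 - ?c" using True by (simp add: col_idx_def)
      have X1: "X (col_idx n ?c, ?r) = y (2 * n + 2 - ?c) * \<xi> ?r"
        unfolding ci using True b by (simp add: X_def)
      show ?thesis
      proof (cases "i \<le> ?r \<and> ?N - j \<le> ?c")
        case in': True
        have "2 * n + 2 - ?c \<in> {i+1..j+1}" "?r \<in> {i..j}" using in' b True ij by auto
        moreover have "2 * n + 2 - (2 * n + 2 - ?c) = ?c" using b by simp
        ultimately show ?thesis unfolding X1 using in' a by (simp add: y_def \<xi>_def)
      next
        case False
        have "y (2 * n + 2 - ?c) = 0 \<or> \<xi> ?r = 0"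
        proof (cases "i \<le> ?r")
          case True
          hence "2 * n + 2 - ?c > j + 1" using False by auto
          thus ?thesis using y[of "2 * n + 2 - ?c"] by auto
        next
          case False
          thus ?thesis using \<xi>[of ?r] by auto
        qed
        thus ?thesis unfolding X1 using False by auto
      qed
    next
      case False
      hence "n < col_idx n ?c" using b by (auto simp: col_idx_def)
      hence "X (col_idx n ?c, ?r) = 0" using b by (simp add: X_def)
      moreover have "\<not> ?N - j \<le> ?c" using False ij by simp
      ultimately show ?thesis by simp
    qed
  qed
  have XM: "X (a, b) = ?M (a, b)" if "b \<in> {1..n}" for a b
    by (cases "y a = 0") (use that y[of a] ij in \<open>auto simp: X_def\<close>)
  have M: "a \<in> {1..n}" if "?M (a, b) \<noteq> 0" for a b using that y[of a] ij by auto
  have "(act X ^^ d) v = (act ?M ^^ d) v \<and> (\<forall>w. (act ?M ^^ d) v w \<noteq> 0 \<longrightarrow> set w \<subseteq> {1..n})" for d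
  proof (induction d)
    case 0
    have "set w \<subseteq> {1..n}" if w: "v w \<noteq> 0" for w
    proof
      fix a assume "a \<in> set w"
      then obtain p where p: "p < part_size n m" "a = w ! p" using v_length[OF w] by (auto simp: in_set_conv_nth)
      thus "a \<in> {1..n}" using v_letters[OF w p(1)] height_le[of n m "box_col n m p"] by auto
    qed
    thus ?case by simp
  next
    case (Suc d)
    let ?T = "(act ?M ^^ d) v"
    have "act X ?T = act ?M ?T" by (rule lie_act_agree) (use XM Suc.IH in auto)
    moreover have "set w \<subseteq> {1..n}" if w: "act ?M ?T w \<noteq> 0" for w
      by (rule lie_act_low_letters[OF _ _ w]) (use M Suc.IH in auto)
    ultimately show ?case using Suc.IH by simp
  qed
  moreover have "(act ?M ^^ D) v = 0"
  proof (rule rank_one_vanish)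
    show "y a \<noteq> 0 \<Longrightarrow> a \<in> {1..?N}" for a using y[of a] ij by auto
    show "(\<Sum>a=1..?N. \<xi> a * y a) = 0" using ij by (intro tr) auto
    \<comment> \<open>These are the columns of height at least i and at most j.\<close>
    show "{part n m (j + 1)..<part n m i} \<subseteq> {..<part n m 1}" using part_antimono[OF ij(1), of n m] by auto
    show "card {part n m (j + 1)..<part n m i} < D" using D part_antimono[of i "j + 1" n m] ij by auto
    fix t assume t: "t \<notin> {part n m (j + 1)..<part n m i}"
    have *: "col_act n m ?M t v = (\<Sum>a=1..height n m t. ?M (a, a)) *\<^sub>C v"
      if tri: "\<And>a b. b \<in> {1..height n m t} \<Longrightarrow> ?M (a, b) \<noteq> 0 \<Longrightarrow> a \<in> {1..height n m t}"
    proof (rule col_act_triangular[OF v_anti v_supp _ tri])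
      fix a b assume "?M (a, b) \<noteq> 0"
      from M[OF this] show "a \<in> {1..?N}" by auto
    qed
    show "col_act n m ?M t v = 0"
    proof (cases "t < part n m i")
      case False
      hence h: "height n m t < i" using height_iff[of i n m t] ij by simp
      have z: "\<xi> b = 0" if "b \<in> {1..height n m t}" for b using \<xi>[of b] that h by auto
      show ?thesis using * z by simp
    next
      case True
      hence "t < part n m (j + 1)" using t by simp
      hence h: "j + 1 \<le> height n m t" using height_iff[of "j + 1" n m t] ij by simp
      have "col_act n m ?M t v = (\<Sum>a=1..height n m t. \<xi> a * y a) *\<^sub>C v"
        using * y h ij by (fastforce simp: mult.commute)
      also have "\<dots> = 0" using tr[of "{1..height n m t}"] h ij by simp
      finally show ?thesis .
    qed
  qed
  ultimately have "(act X ^^ D) v = 0" by simp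
  moreover have "D > 0" using D part_antimono[of i "j + 1" n m] ij by simp
  ultimately show ?thesis by (intro vanish_lower_filt[OF X _ _ entry]) auto
qed

lemma power_expand:
  assumes "finite Q"
  shows "(act (\<Sum>\<alpha>\<in>Q. f \<alpha> *\<^sub>C neg_vec n \<alpha>) ^^ D) v =
    (\<Sum>xs | set xs \<subseteq> Q \<and> length xs = D. (\<Prod>\<alpha>\<leftarrow>xs. f \<alpha>) *\<^sub>C mon_list xs)"
proof (induction D)
  case 0
  have "{xs. set xs \<subseteq> Q \<and> length xs = 0} = {[]}" by auto
  thus ?case by (simp add: mon_list_def)
next
  case (Suc D)
  let ?L = "\<lambda>D. {xs. set xs \<subseteq> Q \<and> length xs = D}"
  have "(act (\<Sum>\<alpha>\<in>Q. f \<alpha> *\<^sub>C neg_vec n \<alpha>) ^^ Suc D) v =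
      (\<Sum>xs\<in>?L D. \<Sum>\<alpha>\<in>Q. (\<Prod>\<alpha>\<leftarrow>\<alpha> # xs. f \<alpha>) *\<^sub>C mon_list (\<alpha> # xs))"
    unfolding funpow.simps comp_apply Suc.IH lie_act_sum lie_act_scale lie_act_sum_matrix lie_act_scale_matrix
      cfun.scale_sum_right by (simp add: mon_list_def mult.commute)
  also have "\<dots> = (\<Sum>(xs, \<alpha>)\<in>?L D \<times> Q. (\<Prod>\<alpha>\<leftarrow>\<alpha> # xs. f \<alpha>) *\<^sub>C mon_list (\<alpha> # xs))"
    by (rule sum.cartesian_product)
  also have "\<dots> = (\<Sum>xs\<in>(\<lambda>(xs, \<alpha>). \<alpha> # xs) ` (?L D \<times> Q). (\<Prod>\<alpha>\<leftarrow>xs. f \<alpha>) *\<^sub>C mon_list xs)"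
    by (subst sum.reindex) (auto simp: inj_on_def case_prod_unfold)
  also have "(\<lambda>(xs, \<alpha>). \<alpha> # xs) ` (?L D \<times> Q) = ?L (Suc D)"
    by (rule lists_length_Suc_eq[symmetric])
  finally show ?case .
qed

section \<open>Straightening monomials supported on chains\<close>

definition above :: "nat \<Rightarrow> nat \<Rightarrow> tensor set"
  where "above D w = cfun.span ({mon T |T. set_mset T \<subseteq> poset n \<and> size T = D \<and> w < elt_energy n T} \<union> lower_filt D)"

lemma lower_filt_above: "lower_filt D \<subseteq> above D w"
  unfolding above_def using cfun.span_superset by blast

text \<open>The expanded power is sorted by the multiset of letters of each word;
  \<open>char_independent\<close> makes every class vanish modulo the lower piece. In the class of S
  all other multisets have larger energy, while the orderings of S itself contribute a positive
  integer multiple of \<open>mon S\<close>, which can be divided out.\<close>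

lemma straighten_nested:
  assumes Q: "Q \<subseteq> poset n"
    and van: "\<And>\<eta>. (\<And>l. \<eta> l \<noteq> (0::complex)) \<Longrightarrow>
      (act (\<Sum>\<alpha>\<in>Q. (\<eta> (elt_row \<alpha>) * \<eta> (elt_col n \<alpha>)) *\<^sub>C neg_vec n \<alpha>) ^^ D) v \<in> lower_filt D"
    and S: "set_mset S \<subseteq> Q" "size S = D" "nested (elt_pairs n S)"
  shows "mon S \<in> above D (elt_energy n S)"
proof -
  have finQ: "finite Q" using Q finite_poset finite_subset by blast
  define L where "L = {xs. set xs \<subseteq> Q \<and> length xs = D}"
  have finL: "finite L" unfolding L_def by (rule finite_lists_length_eq[OF finQ])
  define key where "key = (\<lambda>xs. letters (elt_pairs n (mset xs)))"
  define A where "A = (\<lambda>e. \<Sum>xs\<in>{xs\<in>L. key xs = e}. mon_list xs)"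
  have keyprod: "(\<Prod>\<alpha>\<leftarrow>xs. \<eta> (elt_row \<alpha>) * \<eta> (elt_col n \<alpha>)) = (\<Prod>l\<in>#key xs. \<eta> l)" for xs and \<eta> :: "nat \<Rightarrow> complex"
    by (induction xs) (auto simp: key_def letters_def elt_pairs_def)
  have "A e \<in> lower_filt D" if e: "e \<in> key ` L" for e
  proof (rule char_independent[OF _ subspace_lower_filt _ e])
    show "finite (key ` L)" using finL by simp
    fix \<eta> :: "nat \<Rightarrow> complex" assume \<eta>: "\<And>l. \<eta> l \<noteq> 0"
    have "(\<Sum>e\<in>key ` L. (\<Prod>l\<in>#e. \<eta> l) *\<^sub>C A e) =
        (\<Sum>e\<in>key ` L. \<Sum>xs\<in>{xs\<in>L. key xs = e}. (\<Prod>l\<in>#key xs. \<eta> l) *\<^sub>C mon_list xs)"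
      unfolding A_def cfun.scale_sum_right by (intro sum.cong refl) auto
    also have "\<dots> = (\<Sum>xs\<in>L. (\<Prod>l\<in>#key xs. \<eta> l) *\<^sub>C mon_list xs)"
      by (rule sum.group) (use finL in auto)
    also have "\<dots> = (act (\<Sum>\<alpha>\<in>Q. (\<eta> (elt_row \<alpha>) * \<eta> (elt_col n \<alpha>)) *\<^sub>C neg_vec n \<alpha>) ^^ D) v"
      unfolding power_expand[OF finQ] L_def keyprod ..
    finally show "(\<Sum>e\<in>key ` L. (\<Prod>l\<in>#e. \<eta> l) *\<^sub>C A e) \<in> lower_filt D" using van[OF \<eta>] by simp
  qed
  moreover obtain xs0 where xs0: "mset xs0 = S" using ex_mset by blast
  have xs0L: "xs0 \<in> L" using xs0 S by (auto simp: L_def)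
  define e where "e = letters (elt_pairs n S)"
  have "e = key xs0" by (simp add: e_def key_def xs0)
  ultimately have Ae: "A e \<in> lower_filt D" using xs0L by blast
  let ?I = "{xs\<in>L. mset xs = S}" and ?J = "{xs\<in>L. key xs = e \<and> mset xs \<noteq> S}"
  have sub: "cfun.subspace (above D (elt_energy n S))" by (simp add: above_def)
  have J: "mon_list xs \<in> above D (elt_energy n S)" if xs: "xs \<in> ?J" for xs
  proof -
    have p: "set xs \<subseteq> poset n" "length xs = D" using xs Q by (auto simp: L_def)
    have SP: "set_mset S \<subseteq> poset n" using S Q by blast
    have "elt_energy n S < elt_energy n (mset xs)"
      using xs p SP by (intro elt_energy_minimal S(3)) (auto simp: key_def e_def)
    hence "mon (mset xs) \<in> above D (elt_energy n S)"
      unfolding above_def using p by (intro cfun.span_base UnI1 CollectI exI[of _ "mset xs"]) auto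
    moreover have "mon_list xs - mon (mset xs) \<in> above D (elt_energy n S)"
      using mon_list_cong[OF p(1)] p(2) lower_filt_above by blast
    ultimately have "mon_list xs - mon (mset xs) + mon (mset xs) \<in> above D (elt_energy n S)"
      by (intro cfun.subspace_add sub)
    thus ?thesis by simp
  qed
  have I: "mon_list xs - mon S \<in> above D (elt_energy n S)" if xs: "xs \<in> ?I" for xs
  proof -
    have "set xs \<subseteq> poset n" "length xs = D" "mset xs = S" using xs Q by (auto simp: L_def)
    thus ?thesis using mon_list_cong[of xs] lower_filt_above by blast
  qed
  have "{xs\<in>L. key xs = e} = ?I \<union> ?J" by (auto simp: key_def e_def)
  hence "A e = (\<Sum>xs\<in>?I \<union> ?J. mon_list xs)" by (simp add: A_def)
  also have "\<dots> = (\<Sum>xs\<in>?I. mon_list xs) + (\<Sum>xs\<in>?J. mon_list xs)"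
    using finL by (intro sum.union_disjoint) auto
  also have "(\<Sum>xs\<in>?I. mon_list xs) = (\<Sum>xs\<in>?I. mon_list xs - mon S) + (\<Sum>xs\<in>?I. mon S)"
    by (simp add: sum_subtractf)
  also have "(\<Sum>xs\<in>?I. mon S) = of_nat (card ?I) *\<^sub>C mon S"
    using finL cfun.sum_constant_scale[of "mon S" ?I] by simp
  finally have "of_nat (card ?I) *\<^sub>C mon S = A e - (\<Sum>xs\<in>?I. mon_list xs - mon S) - (\<Sum>xs\<in>?J. mon_list xs)"
    by (simp del: fscale_apply)
  also have "\<dots> \<in> above D (elt_energy n S)"
    using Ae lower_filt_above by (intro cfun.subspace_diff sub cfun.subspace_sum I J) auto
  finally have "inverse (of_nat (card ?I)) *\<^sub>C (of_nat (card ?I) *\<^sub>C mon S) \<in> above D (elt_energy n S)"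
    by (rule cfun.subspace_scale[OF sub])
  moreover have "xs0 \<in> ?I" using xs0 xs0L by simp
  hence "card ?I \<noteq> 0" using finL by auto
  hence "inverse (of_nat (card ?I)) *\<^sub>C (of_nat (card ?I) *\<^sub>C mon S) = mon S" by (simp add: fun_eq_iff)
  ultimately show ?thesis by (simp only:)
qed

lemma above_step:
  assumes \<beta>: "\<beta> \<in> poset n" and T: "T \<in> above D w"
  shows "act (neg_vec n \<beta>) T \<in> above (Suc D) (w + elt_row \<beta> * elt_col n \<beta>)"
proof (rule lie_act_span_in[OF T[unfolded above_def]])
  let ?G = "above (Suc D) (w + elt_row \<beta> * elt_col n \<beta>)"
  show sub: "cfun.subspace ?G" by (simp add: above_def)
  fix T assume "T \<in> {mon T |T. set_mset T \<subseteq> poset n \<and> size T = D \<and> w < elt_energy n T} \<union> lower_filt D"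
  thus "act (neg_vec n \<beta>) T \<in> ?G"
  proof
    assume "T \<in> {mon T |T. set_mset T \<subseteq> poset n \<and> size T = D \<and> w < elt_energy n T}"
    then obtain M where M: "T = mon M" "set_mset M \<subseteq> poset n" "size M = D" "w < elt_energy n M" by blast
    have "act (neg_vec n \<beta>) (mon M) - mon (add_mset \<beta> M) \<in> lower_filt (Suc D)"
      using mon_add[OF \<beta> M(2)] M(3) by (simp add: lower_filt_def)
    moreover have "mon (add_mset \<beta> M) \<in> ?G"
      unfolding above_def using M \<beta>
      by (intro cfun.span_base UnI1 CollectI exI[of _ "add_mset \<beta> M"]) (auto simp: elt_energy_def)
    ultimately have "act (neg_vec n \<beta>) (mon M) - mon (add_mset \<beta> M) + mon (add_mset \<beta> M) \<in> ?G"
      using lower_filt_above by (intro cfun.subspace_add sub) auto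
    thus ?thesis by (simp add: M(1))
  next
    assume T: "T \<in> lower_filt D"
    have "act (neg_vec n \<beta>) T \<in> lower_filt (Suc D)"
    proof (cases D)
      case 0
      thus ?thesis using T cfun.subspace_0[OF subspace_filt] by (simp add: lower_filt_def)
    next
      case (Suc r)
      thus ?thesis using T filt_step[OF neg_vec_lower[OF \<beta>], of T r] by (simp add: lower_filt_def)
    qed
    thus ?thesis using lower_filt_above by blast
  qed
qed

text \<open>Energy is additive, so multiplying by further factors preserves the strict increase. It
  is therefore enough to straighten the part of a monomial that lies on a violated path.\<close>

lemma straighten_add:
  assumes "mon S \<in> above (size S) (elt_energy n S)" "set_mset S \<subseteq> poset n" "set_mset R \<subseteq> poset n"
  shows "mon (S + R) \<in> above (size (S + R)) (elt_energy n (S + R))"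
  using assms(3)
proof (induction R)
  case (add \<beta> R)
  have \<beta>: "\<beta> \<in> poset n" and R: "set_mset (S + R) \<subseteq> poset n" using add.prems assms(2) by auto
  let ?G = "above (Suc (size (S + R))) (elt_energy n (S + R) + elt_row \<beta> * elt_col n \<beta>)"
  have "act (neg_vec n \<beta>) (mon (S + R)) \<in> ?G"
    using add by (intro above_step \<beta>) auto
  moreover have "act (neg_vec n \<beta>) (mon (S + R)) - mon (add_mset \<beta> (S + R)) \<in> ?G"
    using mon_add[OF \<beta> R] lower_filt_above[of "Suc (size (S + R))"] by (auto simp: lower_filt_def)
  ultimately have "act (neg_vec n \<beta>) (mon (S + R)) - (act (neg_vec n \<beta>) (mon (S + R)) - mon (add_mset \<beta> (S + R))) \<in> ?G"
    by (rule cfun.subspace_diff[rotated]) (simp add: above_def)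
  hence "mon (add_mset \<beta> (S + R)) \<in> ?G" by simp
  moreover have "elt_energy n (add_mset \<beta> (S + R)) = elt_energy n (S + R) + elt_row \<beta> * elt_col n \<beta>"
    by (simp add: elt_energy_def)
  ultimately show ?case by simp
qed (simp add: assms(1))

end

section \<open>From violated Dyck path inequalities to the spanning set\<close>

lemma arrow_rel:
  assumes "arrow n \<alpha> \<beta>"
  shows "elt_row \<alpha> \<le> elt_row \<beta> \<and> elt_col n \<beta> \<le> elt_col n \<alpha> \<and>
    elt_col n \<beta> + elt_row \<alpha> < elt_col n \<alpha> + elt_row \<beta>"
  using assms by cases auto

lemma arrow_path_facts:
  assumes "arrow_path n p a b"
  shows "distinct p" "\<alpha> \<in> set p \<Longrightarrow> elt_row a \<le> elt_row \<alpha> \<and> elt_col n b \<le> elt_col n \<alpha>"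
    "\<alpha> \<in> set p \<Longrightarrow> \<beta> \<in> set p \<Longrightarrow> elt_row \<alpha> \<le> elt_row \<beta> \<and> elt_col n \<beta> \<le> elt_col n \<alpha> \<or>
      elt_row \<beta> \<le> elt_row \<alpha> \<and> elt_col n \<alpha> \<le> elt_col n \<beta>"
proof -
  let ?R = "\<lambda>\<alpha> \<beta>. elt_row \<alpha> \<le> elt_row \<beta> \<and> elt_col n \<beta> \<le> elt_col n \<alpha> \<and>
    elt_col n \<beta> + elt_row \<alpha> < elt_col n \<alpha> + elt_row \<beta>"
  have p: "p \<noteq> []" "hd p = a" "last p = b" "successively (arrow n) p" using assms by (auto simp: arrow_path_def)
  have "successively ?R p" using p(4) by (rule successively_mono) (rule arrow_rel)
  moreover have "transp ?R" by (rule transpI) linarith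
  ultimately have sw: "sorted_wrt ?R p" by (simp add: successively_conv_sorted_wrt)
  hence nth: "?R (p ! i) (p ! j)" if "i < j" "j < length p" for i j using that by (simp add: sorted_wrt_iff_nth_less)
  show "distinct p" unfolding distinct_conv_nth
  proof (intro allI impI)
    fix i j assume "i < length p" "j < length p" "i \<noteq> j"
    thus "p ! i \<noteq> p ! j" using nth[of i j] nth[of j i] by (cases "i < j") auto
  qed
  have le: "elt_row (p ! i) \<le> elt_row (p ! j) \<and> elt_col n (p ! j) \<le> elt_col n (p ! i)" if "i \<le> j" "j < length p" for i j
    using nth[of i j] that by (cases "i = j") auto
  show "elt_row a \<le> elt_row \<alpha> \<and> elt_col n b \<le> elt_col n \<alpha>" if \<alpha>: "\<alpha> \<in> set p"
  proof -
    obtain k where k: "k < length p" "\<alpha> = p ! k" using \<alpha> by (auto simp: in_set_conv_nth)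
    thus ?thesis using le[of 0 k] le[of k "length p - 1"] p by (auto simp: hd_conv_nth last_conv_nth)
  qed
  show "elt_row \<alpha> \<le> elt_row \<beta> \<and> elt_col n \<beta> \<le> elt_col n \<alpha> \<or>
      elt_row \<beta> \<le> elt_row \<alpha> \<and> elt_col n \<alpha> \<le> elt_col n \<beta>" if ab: "\<alpha> \<in> set p" "\<beta> \<in> set p"
  proof -
    obtain k l where kl: "k < length p" "\<alpha> = p ! k" "l < length p" "\<beta> = p ! l" using ab by (auto simp: in_set_conv_nth)
    show ?thesis unfolding kl using le[of k l] le[of l k] kl by (meson nat_le_linear)
  qed
qed

lemma FFLV_int_iff:
  "s \<in> FFLV_int n m \<longleftrightarrow> (\<forall>\<alpha>. \<alpha> \<notin> poset n \<longrightarrow> s \<alpha> = 0) \<and>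
    (\<forall>i j p. i \<le> j \<and> arrow_path n p (Plain i i) (Plain j j) \<longrightarrow> (\<Sum>\<alpha>\<leftarrow>p. s \<alpha>) \<le> (\<Sum>k=i..j. m k)) \<and>
    (\<forall>i j p. i \<le> j \<and> arrow_path n p (Plain i i) (Bar j j) \<longrightarrow> (\<Sum>\<alpha>\<leftarrow>p. s \<alpha>) \<le> (\<Sum>k=i..n. m k))"
proof -
  have 1: "(\<Sum>\<alpha>\<leftarrow>p. real (s \<alpha>)) = real (\<Sum>\<alpha>\<leftarrow>p. s \<alpha>)" for p by (induction p) auto
  have 2: "(\<Sum>k=i..j. real (m k)) = real (\<Sum>k=i..j. m k)" for i j by simp
  show ?thesis unfolding FFLV_int_def FFLV_def mem_Collect_eq 1 2 of_nat_le_iff by simp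
qed

lemma part_split: "i \<le> j \<Longrightarrow> j \<le> n \<Longrightarrow> part n m i = (\<Sum>k=i..j. m k) + part n m (j + 1)"
  unfolding part_def using sum.ub_add_nat[of i j m "n - j"] by simp

lemma sum_list_count:
  assumes "distinct p"
  shows "(\<Sum>\<alpha>\<leftarrow>p. count T \<alpha>) = size (filter_mset (\<lambda>\<alpha>. \<alpha> \<in> set p) T)"
proof -
  have "size (filter_mset (\<lambda>\<alpha>. \<alpha> \<in> set p) T) = (\<Sum>\<alpha>\<in>set p. count (filter_mset (\<lambda>\<alpha>. \<alpha> \<in> set p) T) \<alpha>)"
    unfolding size_multiset_overloaded_eq by (rule sum.mono_neutral_left) (auto simp: not_in_iff)
  also have "\<dots> = (\<Sum>\<alpha>\<in>set p. count T \<alpha>)" by (rule sum.cong) auto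
  finally show ?thesis using assms by (simp add: sum_list_distinct_conv_sum_set)
qed

context hw_vector
begin

text \<open>The operator runs over the whole region \<open>Q\<close>, which depends only on the ends
  of the path, but the factor being straightened consists of the letters on the path: those form a
  chain, and their number is the left side of the violated inequality.\<close>

lemma straighten_path:
  assumes T: "set_mset T \<subseteq> poset n" and p: "arrow_path n p a b" and Q: "set p \<subseteq> Q" "Q \<subseteq> poset n"
    and van: "\<And>D \<eta>. (\<Sum>\<alpha>\<leftarrow>p. count T \<alpha>) = D \<Longrightarrow> (\<And>l. \<eta> l \<noteq> (0::complex)) \<Longrightarrow>
      (act (\<Sum>\<alpha>\<in>Q. (\<eta> (elt_row \<alpha>) * \<eta> (elt_col n \<alpha>)) *\<^sub>C neg_vec n \<alpha>) ^^ D) v \<in> lower_filt D"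
  shows "mon T \<in> above (size T) (elt_energy n T)"
proof -
  define S where "S = filter_mset (\<lambda>\<alpha>. \<alpha> \<in> set p) T"
  define R where "R = filter_mset (\<lambda>\<alpha>. \<alpha> \<notin> set p) T"
  have TS: "T = S + R" unfolding S_def R_def by (rule multiset_partition)
  have sz: "(\<Sum>\<alpha>\<leftarrow>p. count T \<alpha>) = size S"
    unfolding S_def by (rule sum_list_count[OF arrow_path_facts(1)[OF p]])
  have Ssub: "set_mset S \<subseteq> set p" by (auto simp: S_def)
  have "nested (elt_pairs n S)" unfolding nested_def elt_pairs_def
    using Ssub arrow_path_facts(3)[OF p] by auto
  hence "mon S \<in> above (size S) (elt_energy n S)"
    using Ssub Q van[OF sz] by (intro straighten_nested[of Q]) auto
  moreover have "set_mset S \<subseteq> poset n" "set_mset R \<subseteq> poset n" using T unfolding S_def R_def by auto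
  ultimately show ?thesis unfolding TS by (rule straighten_add)
qed

lemma straighten:
  assumes T: "set_mset T \<subseteq> poset n" and not: "count T \<notin> FFLV_int n m"
  shows "mon T \<in> above (size T) (elt_energy n T)"
proof -
  \<comment> \<open>The endpoint is left arbitrary, so that this also covers paths ending at
    \<open>Plain n n\<close>, whose bound m_i + ... + m_n is the same as for barred ends.\<close>
  have bar: ?thesis if p: "arrow_path n p (Plain i i) b" "(\<Sum>k=i..n. m k) < (\<Sum>\<alpha>\<leftarrow>p. count T \<alpha>)" for i b p
  proof -
    have "Plain i i \<in> poset n" using p(1) hd_in_set[of p] by (auto simp: arrow_path_def)
    hence i: "1 \<le> i" "i \<le> n" by (auto simp: poset_def)
    show ?thesis
    proof (rule straighten_path[OF T p(1)])
      show "set p \<subseteq> {\<alpha>\<in>poset n. i \<le> elt_row \<alpha>}"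
        using arrow_path_facts(2)[OF p(1)] p(1) by (auto simp: arrow_path_def)
    qed (use p(2) i in \<open>auto intro!: bar_vanish simp: part_def\<close>)
  qed
  have plain: ?thesis if p: "arrow_path n p (Plain i i) (Plain j j)" "(\<Sum>k=i..j. m k) < (\<Sum>\<alpha>\<leftarrow>p. count T \<alpha>)" "i \<le> j" "j < n" for i j p
  proof -
    have "Plain i i \<in> poset n" using p(1) hd_in_set[of p] by (auto simp: arrow_path_def)
    hence i: "1 \<le> i" by (auto simp: poset_def)
    show ?thesis
    proof (rule straighten_path[OF T p(1)])
      show "set p \<subseteq> {\<alpha>\<in>poset n. i \<le> elt_row \<alpha> \<and> 2 * n + 1 - j \<le> elt_col n \<alpha>}"
        using arrow_path_facts(2)[OF p(1)] p(1) by (auto simp: arrow_path_def)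
    qed (use p i part_split[of i j n m] in \<open>auto intro!: plain_vanish\<close>)
  qed
  have "\<forall>\<alpha>. \<alpha> \<notin> poset n \<longrightarrow> count T \<alpha> = 0" using T by (auto simp: not_in_iff[symmetric])
  then consider i j p where "i \<le> j" "arrow_path n p (Plain i i) (Plain j j)" "(\<Sum>k=i..j. m k) < (\<Sum>\<alpha>\<leftarrow>p. count T \<alpha>)"
    | i j p where "arrow_path n p (Plain i i) (Bar j j)" "(\<Sum>k=i..n. m k) < (\<Sum>\<alpha>\<leftarrow>p. count T \<alpha>)"
    using not unfolding FFLV_int_iff by (auto simp: not_le)
  thus ?thesis
  proof cases
    case (1 i j p)
    have "Plain j j \<in> poset n" using 1(2) last_in_set[of p] by (auto simp: arrow_path_def)
    hence "j \<le> n" by (auto simp: poset_def)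
    thus ?thesis using plain[OF 1(2,3,1)] bar[OF 1(2)] 1(3) by (cases "j = n") auto
  qed (use bar in blast)
qed

definition fflv_span :: "nat \<Rightarrow> tensor set"
  where "fflv_span d = cfun.span {mon M |M. set_mset M \<subseteq> poset n \<and> size M \<le> d \<and> count M \<in> FFLV_int n m}"

text \<open>A double induction: on the degree, which absorbs the lower pieces, and at fixed degree
  downwards on the energy, which is bounded.\<close>

lemma filt_fflv_span: "filt d \<subseteq> fflv_span d"
proof (induction d rule: less_induct)
  case (less d)
  have mono: "fflv_span d' \<subseteq> fflv_span d" if "d' \<le> d" for d'
    unfolding fflv_span_def using that by (intro cfun.span_mono) auto
  have low: "lower_filt d \<subseteq> fflv_span d"
  proof (cases d)
    case (Suc r)
    thus ?thesis using less[of r] mono[of r] by (auto simp: lower_filt_def)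
  qed (simp add: lower_filt_def fflv_span_def cfun.span_zero)
  have top: "mon M \<in> fflv_span d" if "set_mset M \<subseteq> poset n" "size M = d" for M
    using that
  proof (induction "d * (2 * n + 1) ^ 2 - elt_energy n M" arbitrary: M rule: less_induct)
    case (less M)
    show ?case
    proof (cases "count M \<in> FFLV_int n m")
      case True
      thus ?thesis unfolding fflv_span_def using less.prems by (intro cfun.span_base) auto
    next
      case False
      have "{mon T |T. set_mset T \<subseteq> poset n \<and> size T = d \<and> elt_energy n M < elt_energy n T} \<subseteq> fflv_span d"
      proof safe
        fix T assume T: "set_mset T \<subseteq> poset n" "d = size T" "elt_energy n M < elt_energy n T"
        show "mon T \<in> fflv_span (size T)"
          using elt_energy_bound[OF T(1)] T less.hyps[of T] by fastforce
      qed
      hence "above d (elt_energy n M) \<subseteq> fflv_span d"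
        unfolding above_def using low by (intro cfun.span_minimal) (auto simp: fflv_span_def)
      thus ?thesis using straighten[OF less.prems(1) False] less.prems(2) by auto
    qed
  qed
  have "mon M \<in> fflv_span d" if M: "set_mset M \<subseteq> poset n" "size M \<le> d" for M
  proof (cases "size M = d")
    case False
    hence "mon M \<in> fflv_span (size M)" using mon_filt[OF M(1)] less[of "size M"] M(2) by auto
    thus ?thesis using mono[OF M(2)] by blast
  qed (use top M in simp)
  hence "{mon M |M. set_mset M \<subseteq> poset n \<and> size M \<le> d} \<subseteq> fflv_span d" by blast
  moreover have "cfun.subspace (fflv_span d)" by (simp add: fflv_span_def)
  ultimately have "cfun.span {mon M |M. set_mset M \<subseteq> poset n \<and> size M \<le> d} \<subseteq> fflv_span d"
    by (rule cfun.span_minimal)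
  with filt_span_mon[of d] show ?case by (rule subset_trans)
qed

end

section \<open>Paths and the transfer map\<close>

lemma arrow_step_col:
  assumes "\<alpha> \<in> poset n" "\<beta> \<in> poset n" "elt_row \<beta> = elt_row \<alpha>" "elt_col n \<alpha> = elt_col n \<beta> + 1"
  shows "arrow n \<alpha> \<beta>"
  using assms(1)
proof (cases rule: poset_cases)
  case (Bar i j)
  have "\<beta> = mk_elt n i (j - 1)" using assms Bar by (metis add_diff_cancel_right' elt_row.simps(2) elt_col.simps(2) mk_elt_eq)
  hence b: "\<beta> = Bar i (j - 1)" using Bar by (simp add: mk_elt_def)
  hence "i \<le> j - 1" using assms(2) by (auto simp: poset_def)
  thus ?thesis using row_bar[of i "j - 1" n] Bar b by simp
next
  case (Plain i j)
  have c: "elt_col n \<beta> = 2 * n + 1 - (j + 1)" "elt_row \<beta> = i" using assms Plain by auto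
  hence "\<beta> = mk_elt n i (2 * n + 1 - (j + 1))" using assms(2) by (metis mk_elt_eq)
  hence b: "\<beta> = Plain i (j + 1)" using Plain by (auto simp: mk_elt_def)
  show ?thesis unfolding Plain(1) b using Plain by (intro row_plain) auto
next
  case (last i)
  have c: "elt_col n \<beta> = n" "elt_row \<beta> = i" using assms last by auto
  hence "\<beta> = mk_elt n i n" using assms(2) by (metis mk_elt_eq)
  hence b: "\<beta> = Bar i n" by (simp add: mk_elt_def)
  show ?thesis unfolding last(1) b using last by (intro row_middle)
qed

lemma arrow_step_row:
  assumes "\<alpha> \<in> poset n" "\<beta> \<in> poset n" "elt_row \<beta> = elt_row \<alpha> + 1" "elt_col n \<alpha> = elt_col n \<beta>"
  shows "arrow n \<alpha> \<beta>"
proof (cases \<alpha>)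
  case (Plain i j)
  have j: "1 \<le> i" "i \<le> j" "j \<le> n" using assms(1) Plain by (auto simp: poset_def)
  have "\<beta> = mk_elt n (i + 1) (2 * n + 1 - j)" using assms Plain by (metis elt_row.simps(1) elt_col.simps(1) mk_elt_eq)
  hence b: "\<beta> = Plain (i + 1) j" using j by (auto simp: mk_elt_def)
  hence "i + 1 \<le> j" using assms(2) by (auto simp: poset_def)
  thus ?thesis unfolding Plain b using j by (intro col_plain)
next
  case (Bar i j)
  have j: "1 \<le> i" "i \<le> j" "j \<le> n" using assms(1) Bar by (auto simp: poset_def)
  have "\<beta> = mk_elt n (i + 1) j" using assms Bar by (metis elt_row.simps(2) elt_col.simps(2) mk_elt_eq)
  hence b: "\<beta> = Bar (i + 1) j" using j by (auto simp: mk_elt_def)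
  hence "i + 1 \<le> j" using assms(2) by (auto simp: poset_def)
  thus ?thesis unfolding Bar b using j by (intro col_bar)
qed

lemma arrow_path_single: "\<alpha> \<in> poset n \<Longrightarrow> arrow_path n [\<alpha>] \<alpha> \<alpha>"
  by (simp add: arrow_path_def)

lemma arrow_path_Cons:
  "arrow n \<alpha> \<beta> \<Longrightarrow> \<alpha> \<in> poset n \<Longrightarrow> arrow_path n p \<beta> b \<Longrightarrow> arrow_path n (\<alpha> # p) \<alpha> b"
  by (auto simp: arrow_path_def successively_Cons)

text \<open>The order generated by the arrows is the componentwise one. The column is lowered before
  the row is raised; in the other order the walk could violate
  \<open>row + column \<le> 2 * n + 1\<close> and leave the poset.\<close>

lemma arrow_path_exists:
  assumes "\<alpha> \<in> poset n" "\<beta> \<in> poset n" "elt_row \<alpha> \<le> elt_row \<beta>" "elt_col n \<beta> \<le> elt_col n \<alpha>"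
  shows "\<exists>p. arrow_path n p \<alpha> \<beta>"
  using assms
proof (induction "(elt_col n \<alpha> - elt_col n \<beta>) + (elt_row \<beta> - elt_row \<alpha>)" arbitrary: \<alpha> rule: less_induct)
  case (less \<alpha>)
  note b = elt_bounds[OF less.prems(1)] elt_bounds[OF less.prems(2)]
  show ?case
  proof (cases "elt_col n \<beta> < elt_col n \<alpha>")
    case True
    let ?\<gamma> = "mk_elt n (elt_row \<alpha>) (elt_col n \<alpha> - 1)"
    have g: "?\<gamma> \<in> poset n" using b True less.prems by (intro mk_elt_in) auto
    have c: "elt_row ?\<gamma> = elt_row \<alpha>" "elt_col n ?\<gamma> = elt_col n \<alpha> - 1" using b by auto
    have "arrow n \<alpha> ?\<gamma>" using less.prems g c True by (intro arrow_step_col) auto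
    moreover have "\<exists>p. arrow_path n p ?\<gamma> \<beta>" using less.prems g c True by (intro less.hyps) auto
    ultimately show ?thesis using arrow_path_Cons less.prems by blast
  next
    case False
    hence ce: "elt_col n \<alpha> = elt_col n \<beta>" using less.prems by simp
    show ?thesis
    proof (cases "elt_row \<alpha> < elt_row \<beta>")
      case True
      let ?\<gamma> = "mk_elt n (elt_row \<alpha> + 1) (elt_col n \<alpha>)"
      have g: "?\<gamma> \<in> poset n" using b True ce by (intro mk_elt_in) auto
      have c: "elt_row ?\<gamma> = elt_row \<alpha> + 1" "elt_col n ?\<gamma> = elt_col n \<alpha>" using b by auto
      have "arrow n \<alpha> ?\<gamma>" using less.prems g c by (intro arrow_step_row) auto
      moreover have "\<exists>p. arrow_path n p ?\<gamma> \<beta>" using less.prems g c True by (intro less.hyps) auto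
      ultimately show ?thesis using arrow_path_Cons less.prems by blast
    next
      case False
      hence "\<alpha> = \<beta>" using ce less.prems by (intro elt_eqI) auto
      thus ?thesis using arrow_path_single less.prems by blast
    qed
  qed
qed

lemma arrow_path_append:
  assumes p: "arrow_path n p a b" and q: "arrow_path n q b c"
  shows "arrow_path n (p @ tl q) a c"
proof -
  obtain q' where q': "q = b # q'" using q by (cases q) (auto simp: arrow_path_def)
  show ?thesis using p q unfolding q' arrow_path_def
    by (cases q') (auto simp: successively_append_iff successively_Cons)
qed

text \<open>The marking at the end of a path. Adding it to the sum of a path starting in row i turns
  both kinds of inequality into the single bound \<open>part n m i\<close>, since m_i + ... + m_j is
  \<open>part n m i - part n m (j + 1)\<close>.\<close>

fun end_bound :: "nat \<Rightarrow> (nat \<Rightarrow> nat) \<Rightarrow> elt \<Rightarrow> nat" where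
  "end_bound n m (Plain i j) = part n m (j + 1)"
| "end_bound n m (Bar i j) = 0"

fun is_end :: "elt \<Rightarrow> bool" where
  "is_end (Plain i j) = (i = j)" | "is_end (Bar i j) = (i = j)"

definition path_values :: "nat \<Rightarrow> (nat \<Rightarrow> nat) \<Rightarrow> (elt \<Rightarrow> nat) \<Rightarrow> elt \<Rightarrow> nat set"
  where "path_values n m s \<alpha> = {(\<Sum>\<beta>\<leftarrow>p. s \<beta>) + end_bound n m b |p b. arrow_path n p \<alpha> b \<and> is_end b}"

lemma path_valuesI:
  "arrow_path n p \<alpha> b \<Longrightarrow> is_end b \<Longrightarrow> (\<Sum>\<beta>\<leftarrow>p. s \<beta>) + end_bound n m b \<in> path_values n m s \<alpha>"
  unfolding path_values_def by blast

lemma arrow_path_sum: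
  fixes s :: "elt \<Rightarrow> nat"
  assumes "arrow_path n p a b"
  shows "s a \<le> (\<Sum>\<beta>\<leftarrow>p. s \<beta>)" "s b \<le> (\<Sum>\<beta>\<leftarrow>p. s \<beta>)"
proof -
  have "a \<in> set p" "b \<in> set p" using assms by (auto simp: arrow_path_def)
  thus "s a \<le> (\<Sum>\<beta>\<leftarrow>p. s \<beta>)" "s b \<le> (\<Sum>\<beta>\<leftarrow>p. s \<beta>)" by (simp_all add: member_le_sum_list)
qed

text \<open>The inverse of Stanley's transfer map from the (marked) order polytope to the chain polytope.\<close>

definition transfer :: "nat \<Rightarrow> (nat \<Rightarrow> nat) \<Rightarrow> (elt \<Rightarrow> nat) \<Rightarrow> elt \<Rightarrow> nat"
  where "transfer n m s \<alpha> = Max (path_values n m s \<alpha>)"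

context
  fixes n :: nat and m :: "nat \<Rightarrow> nat" and s :: "elt \<Rightarrow> nat"
  assumes s: "s \<in> FFLV_int n m"
begin

text \<open>The polytope only bounds paths that start on the diagonal, so the path is first extended
  backwards along the row to \<open>Plain i i\<close>; nonnegativity of s makes this
  harmless.\<close>

lemma path_values_bound:
  assumes "\<alpha> \<in> poset n" "x \<in> path_values n m s \<alpha>"
  shows "x \<le> part n m (elt_row \<alpha>)"
proof -
  obtain p b where p: "x = (\<Sum>\<beta>\<leftarrow>p. s \<beta>) + end_bound n m b" "arrow_path n p \<alpha> b" "is_end b"
    using assms(2) by (auto simp: path_values_def)
  let ?i = "elt_row \<alpha>"
  have i: "1 \<le> ?i" "?i \<le> n" using elt_bounds[OF assms(1)] by auto
  hence "Plain ?i ?i \<in> poset n" by (auto simp: poset_def)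
  moreover have "elt_col n \<alpha> \<le> elt_col n (Plain ?i ?i)" using elt_bounds[OF assms(1)] by simp
  ultimately obtain q where q: "arrow_path n q (Plain ?i ?i) \<alpha>"
    using arrow_path_exists[of "Plain ?i ?i" n \<alpha>] assms(1) by auto
  have qp: "arrow_path n (q @ tl p) (Plain ?i ?i) b" by (rule arrow_path_append[OF q p(2)])
  have "(\<Sum>\<beta>\<leftarrow>p. s \<beta>) = s \<alpha> + (\<Sum>\<beta>\<leftarrow>tl p. s \<beta>)"
    using p(2) by (cases p) (auto simp: arrow_path_def)
  also have "s \<alpha> \<le> (\<Sum>\<beta>\<leftarrow>q. s \<beta>)"
    by (rule arrow_path_sum(2)[OF q])
  finally have le: "(\<Sum>\<beta>\<leftarrow>p. s \<beta>) \<le> (\<Sum>\<beta>\<leftarrow>q @ tl p. s \<beta>)" by simp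
  have b: "b \<in> poset n" using p(2) by (auto simp: arrow_path_def)
  have ib: "?i \<le> elt_row b" using arrow_path_facts(2)[OF p(2), of b] p(2) by (auto simp: arrow_path_def)
  show ?thesis
  proof (cases b)
    case (Plain i j)
    hence j: "b = Plain j j" "?i \<le> j" "j \<le> n" using p(3) ib b by (auto simp: poset_def)
    have "(\<Sum>\<beta>\<leftarrow>q @ tl p. s \<beta>) \<le> (\<Sum>k=?i..j. m k)"
      using s qp j(2) unfolding FFLV_int_iff j(1) by blast
    moreover have "end_bound n m b = part n m (j + 1)" unfolding j(1) by simp
    ultimately show ?thesis using le p(1) part_split[OF j(2,3), of m] by linarith
  next
    case (Bar i j)
    hence j: "b = Bar j j" "?i \<le> j" using p(3) ib unfolding Bar by simp_all
    have "(\<Sum>\<beta>\<leftarrow>q @ tl p. s \<beta>) \<le> (\<Sum>k=?i..n. m k)"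
      using s qp j(2) unfolding FFLV_int_iff j(1) by blast
    moreover have "end_bound n m b = 0" unfolding j(1) by simp
    ultimately show ?thesis using le p(1) unfolding part_def by linarith
  qed
qed

lemma path_values_finite:
  assumes "\<alpha> \<in> poset n" shows "finite (path_values n m s \<alpha>)"
  by (rule finite_subset[OF _ finite_atMost[of "part n m (elt_row \<alpha>)"]]) (use path_values_bound[OF assms] in auto)

lemma path_values_le: "\<alpha> \<in> poset n \<Longrightarrow> x \<in> path_values n m s \<alpha> \<Longrightarrow> x \<le> transfer n m s \<alpha>"
  unfolding transfer_def using path_values_finite by (intro Max_ge)

lemma transfer_in:
  assumes a: "\<alpha> \<in> poset n"
  shows "transfer n m s \<alpha> \<in> path_values n m s \<alpha>"
proof -
  \<comment> \<open>Every element reaches the end of its own row, so the maximum is taken over a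
    nonempty set.\<close>
  let ?b = "Bar (elt_row \<alpha>) (elt_row \<alpha>)"
  have "?b \<in> poset n" using elt_bounds[OF a] by (auto simp: poset_def)
  then obtain p where "arrow_path n p \<alpha> ?b" using arrow_path_exists[OF a, of ?b] elt_bounds[OF a] by auto
  hence "(\<Sum>\<beta>\<leftarrow>p. s \<beta>) + end_bound n m ?b \<in> path_values n m s \<alpha>" by (rule path_valuesI) simp
  thus ?thesis unfolding transfer_def using path_values_finite[OF a] by (intro Max_in) auto
qed

lemma transfer_le: "\<alpha> \<in> poset n \<Longrightarrow> transfer n m s \<alpha> \<le> part n m (elt_row \<alpha>)"
  using path_values_bound transfer_in by blast

lemma transfer_ge: "\<alpha> \<in> poset n \<Longrightarrow> s \<alpha> \<le> transfer n m s \<alpha>"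
proof -
  assume "\<alpha> \<in> poset n"
  from transfer_in[OF this] obtain p b where p: "transfer n m s \<alpha> = (\<Sum>\<beta>\<leftarrow>p. s \<beta>) + end_bound n m b" "arrow_path n p \<alpha> b"
    by (auto simp: path_values_def)
  have "s \<alpha> \<le> (\<Sum>\<beta>\<leftarrow>p. s \<beta>)" by (rule arrow_path_sum(1)[OF p(2)])
  thus ?thesis using p(1) by simp
qed

text \<open>A best path from \<beta> can be prolonged upwards to start at \<alpha>. Consequently the
  intervals of length s below the transferred values are disjoint for comparable elements, and the
  elements whose intervals contain a given level form an antichain.\<close>

lemma transfer_mono:
  assumes a: "\<alpha> \<in> poset n" and b: "\<beta> \<in> poset n" and "\<alpha> \<noteq> \<beta>" "elt_row \<alpha> \<le> elt_row \<beta>" "elt_col n \<beta> \<le> elt_col n \<alpha>"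
  shows "s \<alpha> + transfer n m s \<beta> \<le> transfer n m s \<alpha>"
proof -
  obtain p where p: "arrow_path n p \<alpha> \<beta>" using arrow_path_exists assms by blast
  obtain q e where q: "transfer n m s \<beta> = (\<Sum>\<gamma>\<leftarrow>q. s \<gamma>) + end_bound n m e" "arrow_path n q \<beta> e" "is_end e"
    using transfer_in[OF b] by (auto simp: path_values_def)
  obtain p' where p': "p = \<alpha> # p'" using p by (cases p) (auto simp: arrow_path_def)
  have "p' \<noteq> []" "last p' = \<beta>" using p p' assms(3) by (auto simp: arrow_path_def split: if_splits)
  hence "\<beta> \<in> set p'" by auto
  hence 1: "s \<beta> \<le> (\<Sum>\<gamma>\<leftarrow>p'. s \<gamma>)" by (intro member_le_sum_list) auto
  have 2: "(\<Sum>\<gamma>\<leftarrow>q. s \<gamma>) = s \<beta> + (\<Sum>\<gamma>\<leftarrow>tl q. s \<gamma>)"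
    using q(2) by (cases q) (auto simp: arrow_path_def)
  have "(\<Sum>\<gamma>\<leftarrow>p @ tl q. s \<gamma>) + end_bound n m e \<le> transfer n m s \<alpha>"
    by (intro path_values_le a path_valuesI[OF arrow_path_append[OF p q(2)] q(3)])
  thus ?thesis using 1 2 q(1) p' by simp
qed

text \<open>Walking straight down to \<open>Plain j j\<close> collects the marking of the diagonal,
  so the interval of \<open>Plain i j\<close> starts at level \<open>part n m (j + 1)\<close> or
  later: it only meets columns of height at most j.\<close>

lemma transfer_Plain:
  assumes "Plain i j \<in> poset n"
  shows "s (Plain i j) + part n m (j + 1) \<le> transfer n m s (Plain i j)"
proof -
  have j: "1 \<le> i" "i \<le> j" "j \<le> n" using assms by (auto simp: poset_def)
  hence "Plain j j \<in> poset n" by (auto simp: poset_def)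
  then obtain p where p: "arrow_path n p (Plain i j) (Plain j j)"
    using arrow_path_exists[OF assms, of "Plain j j"] j by auto
  hence "(\<Sum>\<gamma>\<leftarrow>p. s \<gamma>) + end_bound n m (Plain j j) \<le> transfer n m s (Plain i j)"
    by (intro path_values_le assms path_valuesI) simp_all
  moreover have "s (Plain i j) \<le> (\<Sum>\<gamma>\<leftarrow>p. s \<gamma>)"
    by (rule arrow_path_sum(1)[OF p])
  ultimately show ?thesis by simp
qed

text \<open>
  The point \<open>s\<close> splits into antichains, one for each column \<open>t\<close> of the Young diagram: the poset elements
  whose interval of length \<open>s \<alpha>\<close> below the transferred value contains \<open>t\<close>.
\<close>

definition box_elts :: "nat \<Rightarrow> elt set"
  where "box_elts p = {\<alpha>\<in>poset n. elt_row \<alpha> = box_row n m p \<and>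
    transfer n m s \<alpha> - s \<alpha> \<le> box_col n m p \<and> box_col n m p < transfer n m s \<alpha>}"

definition special :: "nat set"
  where "special = {p. p < part_size n m \<and> box_elts p \<noteq> {}}"

definition box_elt :: "nat \<Rightarrow> elt"
  where "box_elt p = (SOME \<alpha>. \<alpha> \<in> box_elts p)"

lemma finite_special: "finite special"
  by (simp add: special_def)

lemma box_elt_in: "p \<in> special \<Longrightarrow> box_elt p \<in> box_elts p"
  unfolding box_elt_def special_def by (auto intro: someI)

lemma box_elt_poset: "p \<in> special \<Longrightarrow> box_elt p \<in> poset n"
  using box_elt_in by (auto simp: box_elts_def)

lemma box_elt_row: "p \<in> special \<Longrightarrow> elt_row (box_elt p) = box_row n m p"
  using box_elt_in by (auto simp: box_elts_def)

lemma disjoint_levels: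
  assumes "\<alpha> \<in> poset n" "\<beta> \<in> poset n" "\<alpha> \<noteq> \<beta>" "elt_row \<alpha> \<le> elt_row \<beta>" "elt_col n \<beta> \<le> elt_col n \<alpha>"
    and "transfer n m s \<alpha> - s \<alpha> \<le> t" "t < transfer n m s \<beta>"
  shows False
  using transfer_mono[OF assms(1-5)] assms(6,7) by linarith

lemma box_elt_unique: "p \<in> special \<Longrightarrow> \<alpha> \<in> box_elts p \<Longrightarrow> \<alpha> = box_elt p"
proof (rule ccontr)
  assume p: "p \<in> special" and a: "\<alpha> \<in> box_elts p" and ne: "\<alpha> \<noteq> box_elt p"
  note b = box_elt_in[OF p]
  show False
  proof (cases "elt_col n (box_elt p) \<le> elt_col n \<alpha>")
    case True
    show False by (rule disjoint_levels[of \<alpha> "box_elt p"]) (use a b ne True in \<open>auto simp: box_elts_def\<close>)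
  next
    case False
    show False by (rule disjoint_levels[of "box_elt p" \<alpha>]) (use a b ne False in \<open>auto simp: box_elts_def\<close>)
  qed
qed

text \<open>The antichain property in coordinates: within one column of the diagram a larger row
  goes with a larger column letter. This is the monotonicity that the rearrangement inequality
  needs.\<close>

lemma box_elt_col_mono:
  assumes "p \<in> special" "q \<in> special" "box_col n m p = box_col n m q" "box_row n m p < box_row n m q"
  shows "elt_col n (box_elt p) < elt_col n (box_elt q)"
proof (rule ccontr)
  assume "\<not> ?thesis"
  thus False using box_elt_in[OF assms(1)] box_elt_in[OF assms(2)] assms(3,4)
    by (intro disjoint_levels[of "box_elt p" "box_elt q" "box_col n m p"]) (auto simp: box_elts_def)
qed

text \<open>The interval of \<alpha> has length s \<alpha> and lies below the length of its row, so
  each of its levels is a box of that row, and that box selects \<alpha>.\<close>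

lemma card_box_elt:
  assumes a: "\<alpha> \<in> poset n"
  shows "card {p\<in>special. box_elt p = \<alpha>} = s \<alpha>"
proof -
  let ?P = "{p\<in>special. box_elt p = \<alpha>}"
  let ?I = "{transfer n m s \<alpha> - s \<alpha>..<transfer n m s \<alpha>}"
  have "bij_betw (box_col n m) ?P ?I"
    unfolding bij_betw_def
  proof
    show "inj_on (box_col n m) ?P"
    proof (rule inj_onI)
      fix p q assume pq: "p \<in> ?P" "q \<in> ?P" "box_col n m p = box_col n m q"
      have "box_row n m p = box_row n m q" using pq box_elt_row[of p] box_elt_row[of q] by simp
      thus "p = q" using pq by (intro box_inj[of p n m q]) (auto simp: special_def)
    qed
    show "box_col n m ` ?P = ?I"
    proof safe
      fix p assume "p \<in> special" "\<alpha> = box_elt p"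
      thus "box_col n m p \<in> {transfer n m s (box_elt p) - s (box_elt p)..<transfer n m s (box_elt p)}"
        using box_elt_in[of p] by (auto simp: box_elts_def)
    next
      fix t assume t: "t \<in> ?I"
      have "t < part n m (elt_row \<alpha>)" using t transfer_le[OF a] by simp
      then obtain p where p: "p < part_size n m" "box_row n m p = elt_row \<alpha>" "box_col n m p = t"
        using elt_bounds[OF a] by (metis box_exists)
      hence "\<alpha> \<in> box_elts p" using t a by (auto simp: box_elts_def)
      moreover have "p \<in> special" using p calculation by (auto simp: special_def)
      ultimately show "t \<in> box_col n m ` ?P" using box_elt_unique[of p \<alpha>] p by force
    qed
  qed
  hence "card ?P = card ?I" by (rule bij_betw_same_card)
  thus ?thesis using transfer_ge[OF a] by simp
qed

lemma box_elt_mset: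
  assumes S: "set_mset S \<subseteq> poset n" "count S = s"
  shows "image_mset box_elt (mset_set special) = S"
proof (rule multiset_eqI)
  fix \<alpha>
  have "count (image_mset box_elt (mset_set special)) \<alpha> = card {p\<in>special. box_elt p = \<alpha>}"
    using finite_special by (simp add: count_image_mset Collect_conj_eq Int_commute vimage_def)
  also have "\<dots> = count S \<alpha>"
  proof (cases "\<alpha> \<in> poset n")
    case True
    thus ?thesis using card_box_elt S by simp
  next
    case False
    hence "{p\<in>special. box_elt p = \<alpha>} = {}" using box_elt_poset by auto
    moreover have "count S \<alpha> = 0" using S False by (metis count_eq_zero_iff subsetD)
    ultimately show ?thesis by (simp only: card.empty)
  qed
  finally show "count (image_mset box_elt (mset_set special)) \<alpha> = count S \<alpha>" .
qed

text \<open>The replacement letter cannot occur in the column of v. For barred elements and the last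
  unbarred ones it exceeds n; for \<open>Plain i j\<close> with j < n it is j + 1, and the column
  has height at most j.\<close>

lemma special_letter:
  assumes p: "p \<in> special"
  shows "height n m (box_col n m p) < col_idx n (elt_col n (box_elt p))"
  using box_elt_poset[OF p]
proof (cases rule: poset_cases)
  case (Bar i j)
  thus ?thesis using height_le[of n m "box_col n m p"] by (simp add: col_idx_def)
next
  case (last i)
  thus ?thesis using height_le[of n m "box_col n m p"] by (simp add: col_idx_def)
next
  case (Plain i j)
  have "part n m (j + 1) \<le> transfer n m s (box_elt p) - s (box_elt p)"
    using transfer_Plain[of i j] box_elt_poset[OF p] Plain by simp
  hence "\<not> box_col n m p < part n m (j + 1)" using box_elt_in[OF p] by (auto simp: box_elts_def)
  hence "\<not> j + 1 \<le> height n m (box_col n m p)" using height_iff[of "j + 1" n m "box_col n m p"] Plain by simp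
  moreover have "col_idx n (elt_col n (box_elt p)) = j + 1" using Plain by (auto simp: col_idx_def)
  ultimately show ?thesis by simp
qed

end

section \<open>A rearrangement inequality\<close>

text \<open>Induction by removing the index with the largest r. It is strict because c is strictly
  increasing along r and r is injective.\<close>

lemma rearrangement:
  fixes r l c :: "'a \<Rightarrow> nat"
  assumes "finite A" "inj_on r A" "inj_on l A" "l ` A = r ` A"
    and mono: "\<And>p q. p \<in> A \<Longrightarrow> q \<in> A \<Longrightarrow> r p < r q \<Longrightarrow> c p < c q"
  shows "(\<Sum>p\<in>A. l p * c p) \<le> (\<Sum>p\<in>A. r p * c p) \<and>
    ((\<exists>p\<in>A. l p \<noteq> r p) \<longrightarrow> (\<Sum>p\<in>A. l p * c p) < (\<Sum>p\<in>A. r p * c p))"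
  using assms
proof (induction "card A" arbitrary: A l)
  case 0
  thus ?case by simp
next
  case (Suc k)
  have "r ` A \<noteq> {}" "finite (r ` A)" using Suc.hyps(2) Suc.prems(1) by auto
  hence "Max (r ` A) \<in> r ` A" by (intro Max_in)
  then obtain x where x: "x \<in> A" "r x = Max (r ` A)" by (metis imageE)
  hence max: "r p \<le> r x" if "p \<in> A" for p using that Suc.prems(1) by simp
  have less: "r p < r x" if "p \<in> A" "p \<noteq> x" for p
    using max[OF that(1)] inj_onD[OF Suc.prems(2), of p x] that x(1) by fastforce
  have split: "(\<Sum>p\<in>A. f p) = f x + (\<Sum>p\<in>A - {x}. f p)" for f :: "'a \<Rightarrow> nat"
    using Suc.prems(1) x(1) by (rule sum.remove)
  have IH: "(\<Sum>p\<in>A - {x}. l p * c p) \<le> (\<Sum>p\<in>A - {x}. r p * c p) \<and>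
      ((\<exists>p\<in>A - {x}. l p \<noteq> r p) \<longrightarrow> (\<Sum>p\<in>A - {x}. l p * c p) < (\<Sum>p\<in>A - {x}. r p * c p))"
    if "inj_on l A" "l ` A = r ` A" "l x = r x" for l
  proof (rule Suc.hyps(1))
    show "k = card (A - {x})" using Suc.hyps(2) Suc.prems(1) x(1) by simp
    show "inj_on r (A - {x})" "inj_on l (A - {x})" using Suc.prems(2) that(1) by (auto intro: inj_on_subset)
    show "l ` (A - {x}) = r ` (A - {x})"
      using inj_on_image_set_diff[OF that(1), of A "{x}"] inj_on_image_set_diff[OF Suc.prems(2), of A "{x}"] that x(1) by simp
  qed (use Suc.prems in auto)
  show ?case
  proof (cases "l x = r x")
    case True
    show ?thesis using IH[OF Suc.prems(3,4) True] True unfolding split[of "\<lambda>p. l p * c p"] split[of "\<lambda>p. r p * c p"] by auto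
  next
    case False
    \<comment> \<open>\<open>h\<close> holds the value that belongs at x. Exchanging the values at h
      and x raises the sum by (r x - l x)(c x - c h) > 0.\<close>
    obtain h where h: "h \<in> A" "l h = r x" using x(1) Suc.prems(4) by (metis imageE imageI)
    have hx: "h \<noteq> x" using h False by auto
    define l' where "l' = l(h := l x, x := r x)"
    have l': "inj_on l' A" "l' ` A = r ` A"
    proof -
      have eq: "l' p = l (transpose h x p)" for p using h hx by (auto simp: l'_def transpose_def)
      have b: "bij_betw (transpose h x) A A" using h(1) x(1)
        by (intro bij_betw_byWitness[where f' = "transpose h x"]) (auto simp: transpose_def)
      have "inj_on (l \<circ> transpose h x) A" using b Suc.prems(3) by (intro comp_inj_on) (auto simp: bij_betw_def)
      thus "inj_on l' A" by (simp add: comp_def eq[abs_def])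
      have "l' ` A = l ` (transpose h x ` A)" by (simp add: eq[abs_def] image_image)
      thus "l' ` A = r ` A" using b Suc.prems(4) by (simp add: bij_betw_def)
    qed
    have "(\<Sum>p\<in>A - {x}. l' p * c p) \<le> (\<Sum>p\<in>A - {x}. r p * c p)" using IH[OF l'] by (simp add: l'_def)
    moreover have hA: "h \<in> A - {x}" using h hx by simp
    have split2: "(\<Sum>p\<in>A. f p) = f x + (f h + (\<Sum>p\<in>A - {x} - {h}. f p))" for f :: "'a \<Rightarrow> nat"
      unfolding split[of f] using Suc.prems(1) hA by (simp add: sum.remove)
    have "(\<Sum>p\<in>A - {x} - {h}. l' p * c p) = (\<Sum>p\<in>A - {x} - {h}. l p * c p)"
      by (rule sum.cong) (auto simp: l'_def)
    ultimately have "r x * c x + (l x * c h + (\<Sum>p\<in>A - {x} - {h}. l p * c p)) \<le> (\<Sum>p\<in>A. r p * c p)"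
      using split2[of "\<lambda>p. l' p * c p"] split[of "\<lambda>p. l' p * c p"] split[of "\<lambda>p. r p * c p"] hx by (simp add: l'_def)
    moreover have "l x * c x + r x * c h < r x * c x + l x * c h"
    proof -
      have "l x \<in> r ` A" using x(1) Suc.prems(4) by blast
      hence "l x < r x" using False max by force
      moreover have "c h < c x" using less[OF h(1) hx] Suc.prems(5) h(1) x(1) by blast
      ultimately obtain a b where "r x = l x + a" "c x = c h + b" "a > 0" "b > 0"
        by (metis less_imp_add_positive)
      thus ?thesis by (simp add: algebra_simps)
    qed
    moreover have "(\<Sum>p\<in>A. l p * c p) = l x * c x + (r x * c h + (\<Sum>p\<in>A - {x} - {h}. l p * c p))"
      unfolding split2 h(2) ..
    ultimately have "(\<Sum>p\<in>A. l p * c p) < (\<Sum>p\<in>A. r p * c p)" by linarith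
    thus ?thesis by simp
  qed
qed

section \<open>Coordinates detecting the monomials\<close>

text \<open>Two cases arise because a barred root vector has both its entries in columns up to n,
  with the two letters exchanged. The product of the letters is the same in both cases, so energies
  can be computed without knowing which one occurs.\<close>

lemma neg_vec_low_column:
  assumes \<beta>: "\<beta> \<in> poset n" and c: "c \<in> {1..2 * n + 1}" and r: "r \<in> {1..n}"
    and nz: "neg_vec n \<beta> (col_idx n c, r) \<noteq> 0"
  shows "elt_row \<beta> = r \<and> elt_col n \<beta> = c \<or> elt_row \<beta> = c \<and> elt_col n \<beta> = r"
  using \<beta>
proof (cases rule: poset_cases)
  case (Bar i j)
  have "col_idx n c = n + j \<and> r = i \<or> col_idx n c = n + i \<and> r = j"
    using nz unfolding Bar(1) neg_vec_Bar[OF Bar(2-4)] by (auto split: if_splits)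
  moreover have "c = k" if "col_idx n c = n + k" "1 \<le> k" "k \<le> n" for k
    using that c by (auto simp: col_idx_def split: if_splits)
  ultimately show ?thesis using Bar by auto
next
  case (Plain i j)
  have "col_idx n c = j + 1 \<and> r = i"
    using nz r unfolding Plain(1) neg_vec_Plain[OF Plain(2-4)] by (auto split: if_splits)
  moreover have "c = 2 * n + 2 - (j + 1)" if "col_idx n c = j + 1"
    using that c Plain by (auto simp: col_idx_def split: if_splits)
  ultimately show ?thesis using Plain by auto
next
  case (last i)
  have "col_idx n c = 2 * n + 1 \<and> r = i"
    using nz unfolding last(1) neg_vec_Plain_last by (auto simp: unit_vec_def split: if_splits)
  moreover have "c = n + 1" if "col_idx n c = 2 * n + 1"
    using that c by (auto simp: col_idx_def split: if_splits)
  ultimately show ?thesis using last by auto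
qed

lemma neg_vec_main_entry: "neg_vec n \<alpha> (col_idx n (elt_col n \<alpha>), elt_row \<alpha>) = 1"
  by (simp add: neg_vec_def)

definition word_upd :: "nat list \<Rightarrow> nat set \<Rightarrow> (nat \<Rightarrow> nat) \<Rightarrow> nat list"
  where "word_upd u B l = map (\<lambda>p. if p \<in> B then l p else u ! p) [0..<length u]"

context hw_vector
begin

definition bad :: "nat list \<Rightarrow> nat set"
  where "bad u = {p. p < part_size n m \<and> u ! p \<notin> {1..height n m (box_col n m p)}}"

lemma finite_bad [simp]: "finite (bad u)"
  by (simp add: bad_def)

lemma mon_list_tensors: "set xs \<subseteq> poset n \<Longrightarrow> mon_list xs \<in> tensors (2 * n + 1) (part_size n m)"
proof (induction xs)
  case Nil
  thus ?case using col_anti_tensors[OF v_anti] by (simp add: mon_list_def)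
next
  case (Cons x xs)
  hence "x \<in> poset n" by simp
  hence "a \<in> {1..2 * n + 1}" if "neg_vec n x (a, b) \<noteq> 0" for a b
    using odd_sp_gl[OF lower_sp_odd_sp[OF neg_vec_lower]] that by blast
  hence "act (neg_vec n x) (mon_list xs) \<in> tensors (2 * n + 1) (part_size n m)"
    using Cons by (intro lie_act_tensors) auto
  thus ?case by (simp add: mon_list_def)
qed

lemma mon_list_length: "set xs \<subseteq> poset n \<Longrightarrow> mon_list xs u \<noteq> 0 \<Longrightarrow> length u = part_size n m"
  using mon_list_tensors[of xs] by (auto simp: tensors_def tensor_words_def)

lemma mon_list_Cons:
  "mon_list (\<beta> # xs) u = (\<Sum>p<length u. \<Sum>j=1..2 * n + 1. neg_vec n \<beta> (u ! p, j) * mon_list xs (u[p := j]))"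
  by (simp add: mon_list_def lie_act_def)

text \<open>Every operator replaces one letter, so a nonzero coordinate needs at least as many operators
  as there are bad letters; if there are just enough, each one turns a bad letter into a good one.\<close>

lemma step_bad:
  assumes len: "length u = part_size n m" and p: "p < length u"
    and le: "card (bad (u[p := j])) \<le> k"
  shows "card (bad u) \<le> Suc k"
    and "card (bad u) = Suc k \<Longrightarrow> p \<in> bad u \<and> bad (u[p := j]) = bad u - {p} \<and>
      card (bad (u[p := j])) = k \<and> j \<in> {1..height n m (box_col n m p)}"
proof -
  have same: "q \<in> bad (u[p := j]) \<longleftrightarrow> q \<in> bad u" if "q \<noteq> p" for q
    using that by (simp add: bad_def)
  have sub: "bad u - {p} \<subseteq> bad (u[p := j])" using same by blast
  have c1: "card (bad u - {p}) \<le> card (bad (u[p := j]))" using sub by (intro card_mono) auto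
  have c2: "card (bad u) \<le> Suc (card (bad u - {p}))" by (auto simp: card_Diff_singleton_if)
  show "card (bad u) \<le> Suc k" using c1 c2 le by linarith
  assume eq: "card (bad u) = Suc k"
  hence c: "card (bad u - {p}) = k" "card (bad (u[p := j])) = k" using c1 c2 le by linarith+
  have pin: "p \<in> bad u" using c(1) eq by (cases "p \<in> bad u") simp_all
  have e: "bad (u[p := j]) = bad u - {p}" using card_subset_eq[OF _ sub] c by simp
  have "p \<notin> bad (u[p := j])" unfolding e by simp
  hence "j \<in> {1..height n m (box_col n m p)}" using p len by (simp add: bad_def del: atLeastAtMost_iff)
  with pin e c show "p \<in> bad u \<and> bad (u[p := j]) = bad u - {p} \<and>
      card (bad (u[p := j])) = k \<and> j \<in> {1..height n m (box_col n m p)}" by simp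
qed

text \<open>A witness that operators and bad positions match one to one: \<open>f p\<close> is the
  operator used at p and \<open>l p\<close> the letter it replaced. Undoing all replacements must
  give a word at which v is nonzero.\<close>

definition assignment :: "elt list \<Rightarrow> nat list \<Rightarrow> (nat \<Rightarrow> nat) \<Rightarrow> (nat \<Rightarrow> elt) \<Rightarrow> bool"
  where "assignment xs u l f \<longleftrightarrow> v (word_upd u (bad u) l) \<noteq> 0 \<and>
    mset xs = image_mset f (mset_set (bad u)) \<and>
    (\<forall>p\<in>bad u. neg_vec n (f p) (u ! p, l p) \<noteq> 0 \<and> l p \<in> {1..height n m (box_col n m p)})"

lemma assignment_Cons:
  assumes len: "length u = part_size n m" and p: "p < length u"
    and s: "p \<in> bad u" "bad (u[p := j]) = bad u - {p}" "j \<in> {1..height n m (box_col n m p)}"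
    and nz: "neg_vec n \<beta> (u ! p, j) \<noteq> 0" and a: "assignment xs (u[p := j]) l f"
  shows "assignment (\<beta> # xs) u (l(p := j)) (f(p := \<beta>))"
proof -
  have "word_upd u (bad u) (l(p := j)) = word_upd (u[p := j]) (bad u - {p}) l"
    unfolding word_upd_def length_list_update
  proof (rule map_cong[OF refl])
    fix q assume "q \<in> set [0..<length u]"
    show "(if q \<in> bad u then (l(p := j)) q else u ! q) = (if q \<in> bad u - {p} then l q else u[p := j] ! q)"
      by (cases "q = p") (use s(1) p in simp_all)
  qed
  moreover have "mset (\<beta> # xs) = image_mset (f(p := \<beta>)) (mset_set (bad u))"
  proof -
    have "mset_set (bad u) = add_mset p (mset_set (bad u - {p}))"
      using s(1) by (metis finite_bad mset_set.remove)
    moreover have "image_mset (f(p := \<beta>)) (mset_set (bad u - {p})) = image_mset f (mset_set (bad u - {p}))"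
      by (rule image_mset_cong) auto
    ultimately show ?thesis using a s(2) by (simp add: assignment_def)
  qed
  ultimately show ?thesis using a s nz p unfolding assignment_def by auto
qed

lemma mon_list_assignment:
  assumes "set xs \<subseteq> poset n" "mon_list xs u \<noteq> 0"
  shows "card (bad u) \<le> length xs \<and> (card (bad u) = length xs \<longrightarrow> (\<exists>l f. assignment xs u l f))"
  using assms
proof (induction xs arbitrary: u)
  case Nil
  hence v: "v u \<noteq> 0" by (simp add: mon_list_def)
  have b: "bad u = {}" using v_letters[OF v] by (auto simp: bad_def)
  have "word_upd u {} l = u" for l by (simp add: word_upd_def map_nth)
  thus ?case using b v by (simp add: assignment_def)
next
  case (Cons \<beta> xs)
  have len: "length u = part_size n m" using mon_list_length Cons.prems by blast
  obtain p j where p: "p < length u" and nz: "neg_vec n \<beta> (u ! p, j) * mon_list xs (u[p := j]) \<noteq> 0"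
    using Cons.prems(2) unfolding mon_list_Cons by (auto elim!: sum.not_neutral_contains_not_neutral)
  have nz': "neg_vec n \<beta> (u ! p, j) \<noteq> 0" "mon_list xs (u[p := j]) \<noteq> 0" using nz by auto
  have IH: "card (bad (u[p := j])) \<le> length xs"
    "card (bad (u[p := j])) = length xs \<Longrightarrow> \<exists>l f. assignment xs (u[p := j]) l f"
    using Cons.IH[OF _ nz'(2)] Cons.prems(1) by auto
  have "\<exists>l f. assignment (\<beta> # xs) u l f" if eq: "card (bad u) = Suc (length xs)"
  proof -
    note s = step_bad(2)[OF len p IH(1) eq]
    then obtain l f where "assignment xs (u[p := j]) l f" using IH(2) by blast
    thus ?thesis using assignment_Cons[OF len p _ _ _ nz'(1)] s by blast
  qed
  thus ?case using step_bad(1)[OF len p IH(1)] by simp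
qed

end

section \<open>The test word of a lattice point\<close>

locale fflv_point = hw_vector +
  fixes S :: "elt multiset"
  assumes S_poset: "set_mset S \<subseteq> poset n" and S_fflv: "count S \<in> FFLV_int n m"
begin

abbreviation "spec \<equiv> special n m (count S)"
abbreviation "sel \<equiv> box_elt n m (count S)"

text \<open>The coordinate used for S is the one with C = \<open>spec\<close>; general subsets occur
  in the induction that undoes the replacements one at a time.\<close>

definition spec_word :: "nat set \<Rightarrow> nat list"
  where "spec_word C = map (\<lambda>p. if p \<in> C then col_idx n (elt_col n (sel p)) else box_row n m p) [0..<part_size n m]"

lemma length_spec_word [simp]: "length (spec_word C) = part_size n m"
  by (simp add: spec_word_def)

lemma spec_lt: "p \<in> spec \<Longrightarrow> p < part_size n m"
  using S_fflv by (simp add: special_def)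

lemma nth_spec_word:
  "p < part_size n m \<Longrightarrow> spec_word C ! p = (if p \<in> C then col_idx n (elt_col n (sel p)) else box_row n m p)"
  by (simp add: spec_word_def)

lemma bad_spec_word:
  assumes "C \<subseteq> spec" shows "bad (spec_word C) = C"
proof -
  have "spec_word C ! p \<notin> {1..height n m (box_col n m p)} \<longleftrightarrow> p \<in> C" if "p < part_size n m" for p
    using that assms special_letter[OF S_fflv, of p] box_bounds[OF that] by (auto simp: nth_spec_word)
  thus ?thesis using assms spec_lt by (auto simp: bad_def)
qed

text \<open>The energy of xs is the sum of \<open>l p\<close> times the selected column letter,
  where l permutes the rows within each column of the diagram. By rearrangement it is at most the
  energy of the selection, with equality only if l is the row function; the hypothesis on energies
  forces equality.\<close>

lemma rigid:
  assumes C: "C \<subseteq> spec" and a: "assignment xs (spec_word C) l f" and xs: "set xs \<subseteq> poset n"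
    and en: "(\<Sum>p\<in>C. elt_row (sel p) * elt_col n (sel p)) \<le> elt_energy n (mset xs)"
  shows "\<forall>p\<in>C. l p = box_row n m p \<and> f p = sel p"
proof -
  have finC: "finite C" using C finite_special[OF S_fflv] finite_subset by blast
  have v: "v (word_upd (spec_word C) C l) \<noteq> 0" and ms: "mset xs = image_mset f (mset_set C)"
    and nz: "\<And>p. p \<in> C \<Longrightarrow> neg_vec n (f p) (spec_word C ! p, l p) \<noteq> 0"
    and l: "\<And>p. p \<in> C \<Longrightarrow> l p \<in> {1..height n m (box_col n m p)}"
    using a unfolding assignment_def bad_spec_word[OF C] by auto
  have ln: "l p \<in> {1..n}" if "p \<in> C" for p
    using l[OF that] height_le[of n m "box_col n m p"] by auto
  have fp: "f p \<in> poset n" if "p \<in> C" for p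
  proof -
    have "f p \<in># mset xs" unfolding ms using that finC by simp
    thus ?thesis using xs by auto
  qed
  let ?c = "\<lambda>p. elt_col n (sel p)"
  have cin: "?c p \<in> {1..2 * n + 1}" if "p \<in> C" for p
    using elt_col_in[OF box_elt_poset[OF S_fflv]] that C by blast
  have two: "elt_row (f p) = l p \<and> elt_col n (f p) = ?c p \<or> elt_row (f p) = ?c p \<and> elt_col n (f p) = l p"
    if p: "p \<in> C" for p
  proof (rule neg_vec_low_column[OF fp[OF p] cin[OF p] ln[OF p]])
    show "neg_vec n (f p) (col_idx n (?c p), l p) \<noteq> 0"
      using nz[OF p] nth_spec_word[of p C] spec_lt C p by auto
  qed
  have "elt_energy n (mset xs) = (\<Sum>p\<in>C. elt_row (f p) * elt_col n (f p))"
    unfolding elt_energy_def ms by (simp add: image_mset.compositionality comp_def sum_unfold_sum_mset)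
  also have "\<dots> = (\<Sum>p\<in>C. l p * ?c p)"
  proof (rule sum.cong[OF refl])
    fix p assume "p \<in> C"
    from two[OF this] show "elt_row (f p) * elt_col n (f p) = l p * ?c p" by (auto simp: mult.commute)
  qed
  finally have en2: "(\<Sum>p\<in>C. box_row n m p * ?c p) \<le> (\<Sum>p\<in>C. l p * ?c p)"
    using en box_elt_row[OF S_fflv] C by (simp add: subset_iff)
  have rearr: "(\<Sum>p\<in>C \<inter> col_set n m t. l p * ?c p) \<le> (\<Sum>p\<in>C \<inter> col_set n m t. box_row n m p * ?c p) \<and>
    ((\<exists>p\<in>C \<inter> col_set n m t. l p \<noteq> box_row n m p) \<longrightarrow>
      (\<Sum>p\<in>C \<inter> col_set n m t. l p * ?c p) < (\<Sum>p\<in>C \<inter> col_set n m t. box_row n m p * ?c p))" for t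
  proof (rule rearrangement)
    let ?T = "col_set n m t" and ?w = "\<lambda>p. word_upd (spec_word C) C l ! p"
    have w: "?w p = (if p \<in> C then l p else box_row n m p)" if "p \<in> ?T" for p
      using that nth_spec_word[of p C] by (auto simp: word_upd_def col_set_def)
    have bw: "bij_betw ?w ?T {1..height n m t}" by (rule v_supp[OF v])
    have br: "bij_betw (box_row n m) ?T {1..height n m t}" by (rule bij_col_set)
    show "inj_on (box_row n m) (C \<inter> ?T)" using br by (auto simp: bij_betw_def intro: inj_on_subset)
    have "inj_on ?w (C \<inter> ?T)" using bw by (auto simp: bij_betw_def intro: inj_on_subset)
    thus "inj_on l (C \<inter> ?T)" using w by (auto simp: inj_on_def)
    \<comment> \<open>Both the undone word and the row word use each letter of the column once, and
      they agree off C; hence they take the same values on C.\<close>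
    have "l ` (C \<inter> ?T) = ?w ` (C \<inter> ?T)" using w by (intro image_cong) auto
    also have "\<dots> = {1..height n m t} - ?w ` (?T - C)"
    proof -
      have "C \<inter> ?T = ?T - (?T - C)" by blast
      thus ?thesis using inj_on_image_set_diff[of ?w ?T ?T "?T - C"] bw by (simp add: bij_betw_def)
    qed
    also have "?w ` (?T - C) = box_row n m ` (?T - C)" using w by (intro image_cong) auto
    also have "{1..height n m t} - \<dots> = box_row n m ` (C \<inter> ?T)"
    proof -
      have "C \<inter> ?T = ?T - (?T - C)" by blast
      thus ?thesis using inj_on_image_set_diff[of "box_row n m" ?T ?T "?T - C"] br by (simp add: bij_betw_def)
    qed
    finally show "l ` (C \<inter> ?T) = box_row n m ` (C \<inter> ?T)" .
    show "?c p < ?c q" if "p \<in> C \<inter> ?T" "q \<in> C \<inter> ?T" "box_row n m p < box_row n m q" for p q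
      using that C by (intro box_elt_col_mono[OF S_fflv]) (auto simp: col_set_def)
  qed (use finC in simp)
  have split: "(\<Sum>p\<in>C. g p) = (\<Sum>t<part n m 1. \<Sum>p\<in>C \<inter> col_set n m t. g p)" for g :: "nat \<Rightarrow> nat"
  proof -
    have "box_col n m ` C \<subseteq> {..<part n m 1}"
    proof safe
      fix p assume "p \<in> C"
      hence "p < part_size n m" using C spec_lt by blast
      thus "box_col n m p < part n m 1" using box_bounds[of p n m] part_antimono[of 1 "box_row n m p" n m] by linarith
    qed
    hence "(\<Sum>t<part n m 1. \<Sum>p\<in>{p\<in>C. box_col n m p = t}. g p) = (\<Sum>p\<in>C. g p)"
      using finC by (intro sum.group) auto
    moreover have "{p\<in>C. box_col n m p = t} = C \<inter> col_set n m t" for t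
      using C spec_lt by (auto simp: col_set_def)
    ultimately show ?thesis by simp
  qed
  have lr: "l p = box_row n m p" if p: "p \<in> C" for p
  proof (rule ccontr)
    assume ne: "l p \<noteq> box_row n m p"
    let ?t = "box_col n m p"
    have pl: "p < part_size n m" using p C spec_lt by blast
    have "?t < part n m 1" using box_bounds[OF pl] part_antimono[of 1 "box_row n m p" n m] by linarith
    moreover have "p \<in> C \<inter> col_set n m ?t" using p pl by (simp add: col_set_def)
    ultimately have "(\<Sum>p\<in>C. l p * ?c p) < (\<Sum>p\<in>C. box_row n m p * ?c p)"
      unfolding split using rearr ne by (intro sum_strict_mono_ex1) auto
    thus False using en2 by simp
  qed
  have "f p = sel p" if p: "p \<in> C" for p
  proof (rule elt_eqI[OF fp[OF p]])
    have pS: "p \<in> spec" using p C by blast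
    show "sel p \<in> poset n" by (rule box_elt_poset[OF S_fflv pS])
    have "elt_row (sel p) = l p" using box_elt_row[OF S_fflv pS] lr[OF p] by simp
    moreover have "elt_row (sel p) \<le> elt_col n (sel p)" "elt_row (f p) \<le> elt_col n (f p)"
      using elt_bounds(3) box_elt_poset[OF S_fflv pS] fp[OF p] by auto
    \<comment> \<open>Both elements have the same two letters, and the inequality between row and
      column decides which letter is the row.\<close>
    ultimately show "elt_row (f p) = elt_row (sel p)" "elt_col n (f p) = elt_col n (sel p)"
      using two[OF p] by auto
  qed
  with lr show ?thesis by blast
qed

text \<open>By rigidity the outermost operator can only undo a position that selects it, by
  restoring the row number. All contributions are positive multiples of the same number, so they
  cannot cancel.\<close>

lemma coordinate_value:
  assumes "C \<subseteq> spec" "mset xs = image_mset sel (mset_set C)"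
  shows "\<exists>N>0. mon_list xs (spec_word C) = of_nat N * v row_word"
  using assms
proof (induction xs arbitrary: C)
  case Nil
  have finC: "finite C" using Nil.prems(1) finite_special[OF S_fflv] finite_subset by blast
  have "mset_set C = {#}" using Nil.prems(2) by simp
  hence "C = {}" using finC by (simp add: mset_set_empty_iff)
  hence "spec_word C = row_word" by (simp add: spec_word_def row_word_def)
  thus ?case by (intro exI[of _ 1]) (simp add: mon_list_def)
next
  case (Cons \<beta> xs)
  have finC: "finite C" using Cons.prems(1) finite_special[OF S_fflv] finite_subset by blast
  let ?u = "spec_word C"
  have sel: "sel p \<in> poset n" if "p \<in> C" for p using box_elt_poset[OF S_fflv] Cons.prems(1) that by blast
  have set: "set (\<beta> # xs) = sel ` C"
    using arg_cong[OF Cons.prems(2), of set_mset] finC by simp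
  hence poset: "set (\<beta> # xs) \<subseteq> poset n" unfolding set using sel by blast
  hence poset': "set xs \<subseteq> poset n" by simp
  have len: "length (\<beta> # xs) = card C" using arg_cong[OF Cons.prems(2), of size] finC by simp
  have en: "(\<Sum>p\<in>C. elt_row (sel p) * elt_col n (sel p)) = elt_energy n (mset (\<beta> # xs))"
    unfolding Cons.prems(2) elt_energy_def by (simp add: image_mset.compositionality comp_def sum_unfold_sum_mset)
  define G where "G = (\<lambda>p. p \<in> C \<and> sel p = \<beta>)"
  have good: "\<exists>N>0. neg_vec n \<beta> (?u ! p, box_row n m p) * mon_list xs (?u[p := box_row n m p]) = of_nat N * v row_word"
    if p: "G p" for p
  proof -
    have pC: "p \<in> C" "sel p = \<beta>" using p by (auto simp: G_def)
    have pl: "p < part_size n m" using pC Cons.prems(1) spec_lt by blast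
    have "?u[p := box_row n m p] = spec_word (C - {p})"
      using pl by (auto simp: list_eq_iff_nth_eq nth_list_update nth_spec_word)
    moreover have "mset_set C = add_mset p (mset_set (C - {p}))" using pC finC by (metis mset_set.remove)
    hence "mset xs = image_mset sel (mset_set (C - {p}))" using Cons.prems(2) pC by simp
    hence "\<exists>N>0. mon_list xs (spec_word (C - {p})) = of_nat N * v row_word"
      using Cons.prems(1) by (intro Cons.IH) auto
    moreover have "neg_vec n \<beta> (?u ! p, box_row n m p) = 1"
      using neg_vec_main_entry[of n \<beta>] box_elt_row[OF S_fflv, of p] pC Cons.prems(1) pl by (auto simp: nth_spec_word)
    ultimately show ?thesis by simp
  qed
  then obtain N where N: "\<And>p. G p \<Longrightarrow> N p > 0 \<and>
      neg_vec n \<beta> (?u ! p, box_row n m p) * mon_list xs (?u[p := box_row n m p]) = of_nat (N p) * v row_word"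
    by metis
  have other: "G p \<and> j = box_row n m p"
    if p: "p < part_size n m" and nz: "neg_vec n \<beta> (?u ! p, j) * mon_list xs (?u[p := j]) \<noteq> 0" for p j
  proof -
    have nz': "neg_vec n \<beta> (?u ! p, j) \<noteq> 0" "mon_list xs (?u[p := j]) \<noteq> 0" using nz by auto
    have b: "card (bad ?u) = Suc (length xs)" using len bad_spec_word[OF Cons.prems(1)] by simp
    have pl: "p < length ?u" using p by simp
    note IH = mon_list_assignment[OF poset' nz'(2)]
    have step: "p \<in> bad ?u" "bad (?u[p := j]) = bad ?u - {p}" "card (bad (?u[p := j])) = length xs"
      "j \<in> {1..height n m (box_col n m p)}"
      using step_bad(2)[OF length_spec_word pl _ b, of j] IH by blast+
    obtain l f where "assignment xs (?u[p := j]) l f" using IH step(3) by blast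
    hence asg: "assignment (\<beta> # xs) ?u (l(p := j)) (f(p := \<beta>))"
      using step nz'(1) by (intro assignment_Cons length_spec_word pl)
    have "\<forall>q\<in>C. (l(p := j)) q = box_row n m q \<and> (f(p := \<beta>)) q = sel q"
      by (rule rigid[OF Cons.prems(1) asg poset]) (simp only: en order_refl)
    moreover have "p \<in> C" using step(1) bad_spec_word[OF Cons.prems(1)] by simp
    ultimately show ?thesis by (auto simp: G_def)
  qed
  have rowN: "box_row n m p \<in> {1..2 * n + 1}" if "p < part_size n m" for p using box_bounds[OF that] by auto
  have "mon_list (\<beta> # xs) ?u = (\<Sum>p<part_size n m. \<Sum>j=1..2*n+1. if j = box_row n m p then (if G p then of_nat (N p) * v row_word else 0) else 0)"
    unfolding mon_list_Cons length_spec_word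
  proof (intro sum.cong refl)
    fix p j assume "p \<in> {..<part_size n m}"
    thus "neg_vec n \<beta> (?u ! p, j) * mon_list xs (?u[p := j]) =
        (if j = box_row n m p then (if G p then of_nat (N p) * v row_word else 0) else 0)"
      using other[of p j] N[of p] by (cases "G p \<and> j = box_row n m p") auto
  qed
  also have "\<dots> = (\<Sum>p<part_size n m. if G p then of_nat (N p) * v row_word else 0)"
    by (rule sum.cong) (use rowN in \<open>auto simp: sum.delta\<close>)
  also have "\<dots> = (\<Sum>p<part_size n m. of_nat (if G p then N p else 0) * v row_word)"
    by (rule sum.cong) auto
  also have "\<dots> = of_nat (\<Sum>p<part_size n m. if G p then N p else 0) * v row_word"
    by (simp only: of_nat_sum sum_distrib_right)
  finally have "mon_list (\<beta> # xs) ?u = of_nat (\<Sum>p<part_size n m. if G p then N p else 0) * v row_word" .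
  moreover have "(\<Sum>p<part_size n m. if G p then N p else 0) > 0"
  proof -
    have "\<beta> \<in> sel ` C" unfolding set[symmetric] by simp
    then obtain p where "p \<in> C" "sel p = \<beta>" by blast
    hence p: "G p" "p < part_size n m" using Cons.prems(1) spec_lt by (auto simp: G_def)
    have "(if G p then N p else 0) \<le> (\<Sum>p<part_size n m. if G p then N p else 0)"
      by (rule member_le_sum) (use p in auto)
    thus ?thesis using N[OF p(1)] p(1) by simp
  qed
  ultimately show ?case by blast
qed

lemma card_spec: "card spec = size S"
  using arg_cong[OF box_elt_mset[OF S_fflv S_poset refl], of size] by simp

lemma energy_spec: "(\<Sum>p\<in>spec. elt_row (sel p) * elt_col n (sel p)) = elt_energy n S"
proof -
  have "elt_energy n S = elt_energy n (image_mset sel (mset_set spec))"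
    unfolding box_elt_mset[OF S_fflv S_poset refl] ..
  thus ?thesis by (simp add: elt_energy_def image_mset.compositionality comp_def sum_unfold_sum_mset)
qed

lemma coordinate_self: "mon S (spec_word spec) \<noteq> 0"
proof -
  obtain xs where xs: "mset xs = S" "mon S = mon_list xs" by (rule mon_ex)
  have "\<exists>N>0. mon_list xs (spec_word spec) = of_nat N * v row_word"
    using xs(1) box_elt_mset[OF S_fflv S_poset refl] by (intro coordinate_value) auto
  thus ?thesis using xs(2) v_row_word by auto
qed

lemma coordinate_small:
  assumes "set_mset T \<subseteq> poset n" "size T < size S"
  shows "mon T (spec_word spec) = 0"
proof (rule ccontr)
  obtain xs where xs: "mset xs = T" "mon T = mon_list xs" by (rule mon_ex)
  assume "mon T (spec_word spec) \<noteq> 0"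
  hence "card (bad (spec_word spec)) \<le> length xs"
    using mon_list_assignment[of xs] xs assms(1) by auto
  thus False using bad_spec_word[of spec] card_spec assms(2) xs(1) by auto
qed

lemma coordinate_other:
  assumes T: "set_mset T \<subseteq> poset n" "size T = size S" "elt_energy n S \<le> elt_energy n T" "T \<noteq> S"
  shows "mon T (spec_word spec) = 0"
proof (rule ccontr)
  obtain xs where xs: "mset xs = T" "mon T = mon_list xs" by (rule mon_ex)
  have sub: "set xs \<subseteq> poset n" using xs(1) T(1) by auto
  have b: "bad (spec_word spec) = spec" by (rule bad_spec_word) simp
  assume "mon T (spec_word spec) \<noteq> 0"
  hence "mon_list xs (spec_word spec) \<noteq> 0" using xs by simp
  moreover have "card (bad (spec_word spec)) = length xs"
    unfolding b card_spec using T(2) xs(1) by auto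
  ultimately obtain l f where a: "assignment xs (spec_word spec) l f"
    using mon_list_assignment[OF sub] by blast
  have f: "\<forall>p\<in>spec. l p = box_row n m p \<and> f p = sel p"
    using T(3) xs(1) energy_spec by (intro rigid[OF order_refl a sub]) simp
  have "T = image_mset f (mset_set spec)" using a xs(1) b by (simp add: assignment_def)
  also have "\<dots> = image_mset sel (mset_set spec)"
    by (rule image_mset_cong) (use f finite_special[OF S_fflv] in auto)
  also have "\<dots> = S" by (rule box_elt_mset[OF S_fflv S_poset refl])
  finally show False using T(4) by simp
qed

end

section \<open>The trace-free module\<close>

lemma symp_form_unit:
  assumes "a \<in> {1..2 * n + 1}"
  shows "symp_form n (unit_vec a) (unit_vec b) = (if dual_idx n a = b then idx_sign n a else 0)"
proof -
  have "symp_form n (unit_vec a) (unit_vec b) =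
      (\<Sum>x=1..2 * n + 1. if x = a then (if dual_idx n a = b then idx_sign n a else 0) else 0)"
    unfolding symp_form_alt by (rule sum.cong) (auto simp: unit_vec_def)
  thus ?thesis using assms by simp
qed

text \<open>Separates the action on an inserted letter from that on the old positions; induction on
  w avoids computing how indices shift beyond p.\<close>

lemma sum_insert_at:
  fixes G :: "nat list \<Rightarrow> complex"
  assumes "p \<le> length w"
  shows "(\<Sum>r<Suc (length w). \<Sum>j\<in>J. X (insert_at p a w ! r, j) * G ((insert_at p a w)[r := j])) =
    (\<Sum>j\<in>J. X (a, j) * G (insert_at p j w)) +
    (\<Sum>r<length w. \<Sum>j\<in>J. X (w ! r, j) * G (insert_at p a (w[r := j])))"
  using assms
proof (induction w arbitrary: p G)
  case Nil
  thus ?case by (simp add: insert_at_def)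
next
  case (Cons x w)
  show ?case
  proof (cases p)
    case 0
    thus ?thesis by (simp add: insert_at_def sum.lessThan_Suc_shift del: sum.lessThan_Suc)
  next
    case (Suc p')
    have ia: "insert_at (Suc p') y (z # ys) = z # insert_at p' y ys" for y z :: nat and ys by (simp add: insert_at_def)
    show ?thesis using Cons.IH[of p' "\<lambda>u. G (x # u)"] Cons.prems unfolding Suc
      by (simp add: ia sum.lessThan_Suc_shift[of _ "Suc (length w)"] sum.lessThan_Suc_shift[of _ "length w"] del: sum.lessThan_Suc)
  qed
qed

lemma length_insert_at [simp]: "length (insert_at p x w) = Suc (length w)"
  by (simp add: insert_at_def)

lemma set_insert_at: "set (insert_at p x w) = insert x (set w)"
proof -
  have "set w = set (take p w) \<union> set (drop p w)" by (metis append_take_drop_id set_append)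
  thus ?thesis by (auto simp: insert_at_def)
qed

text \<open>The action at the two contracted positions cancels by invariance of \<omega>; what
  remains is the action on the uncontracted positions.\<close>

lemma contraction_lie_act:
  assumes X: "X \<in> odd_sp n" and T: "T \<in> tensors (2 * n + 1) k" and pq: "p < q" "q < k"
  shows "contraction n p q (lie_act (2 * n + 1) X T) = lie_act (2 * n + 1) X (contraction n p q T)"
proof
  fix w
  let ?N = "2 * n + 1" and ?I = "{1..2 * n + 1}"
  let ?J = "\<lambda>a b. symp_form n (unit_vec a) (unit_vec b)"
  let ?w = "\<lambda>a b w. insert_at q b (insert_at p a w)"
  show "contraction n p q (lie_act ?N X T) w = lie_act ?N X (contraction n p q T) w"
  proof (cases "length w + 2 = k")
    case False
    have T0: "T u = 0" if "length u = length w + 2" for u using that False T by (auto simp: tensors_def tensor_words_def)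
    have "lie_act ?N X T u = 0" if "length u = length w + 2" for u
      using T0 that unfolding lie_act_def by (auto intro!: sum.neutral)
    hence "contraction n p q (lie_act ?N X T) w = 0" by (auto simp: contraction_def intro!: sum.neutral)
    moreover have "lie_act ?N X (contraction n p q T) w = 0"
      unfolding lie_act_def contraction_def using T0 by (auto intro!: sum.neutral)
    ultimately show ?thesis by simp
  next
    case True
    have expand: "lie_act ?N X T (?w a b w) = (\<Sum>j\<in>?I. X (b, j) * T (?w a j w)) + (\<Sum>j\<in>?I. X (a, j) * T (?w j b w)) +
        (\<Sum>r<length w. \<Sum>j\<in>?I. X (w ! r, j) * T (?w a b (w[r := j])))" for a b
    proof -
      have "lie_act ?N X T (?w a b w) =
          (\<Sum>j\<in>?I. X (b, j) * T (?w a j w)) +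
          (\<Sum>r<Suc (length w). \<Sum>j\<in>?I. X (insert_at p a w ! r, j) * T (insert_at q b ((insert_at p a w)[r := j])))"
        using sum_insert_at[of q "insert_at p a w" X b T ?I] pq True by (simp add: lie_act_def del: sum.lessThan_Suc)
      thus ?thesis using sum_insert_at[of p w X a "\<lambda>u. T (insert_at q b u)" ?I] pq True
        by (simp del: sum.lessThan_Suc)
    qed
    have swap3: "(\<Sum>a\<in>?I. \<Sum>b\<in>?I. \<Sum>j\<in>?I. f a b j) = (\<Sum>a\<in>?I. \<Sum>b\<in>?I. \<Sum>j\<in>?I. f a j b)" for f :: "nat \<Rightarrow> nat \<Rightarrow> nat \<Rightarrow> complex"
      by (intro sum.cong refl sum.swap)
    have swap3': "(\<Sum>a\<in>?I. \<Sum>b\<in>?I. \<Sum>j\<in>?I. f a b j) = (\<Sum>a\<in>?I. \<Sum>b\<in>?I. \<Sum>j\<in>?I. f j b a)" for f :: "nat \<Rightarrow> nat \<Rightarrow> nat \<Rightarrow> complex"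
    proof -
      have "(\<Sum>a\<in>?I. \<Sum>b\<in>?I. \<Sum>j\<in>?I. f a b j) = (\<Sum>b\<in>?I. \<Sum>a\<in>?I. \<Sum>j\<in>?I. f a b j)" by (rule sum.swap)
      also have "\<dots> = (\<Sum>b\<in>?I. \<Sum>j\<in>?I. \<Sum>a\<in>?I. f a b j)" by (intro sum.cong refl sum.swap)
      also have "\<dots> = (\<Sum>j\<in>?I. \<Sum>b\<in>?I. \<Sum>a\<in>?I. f a b j)" by (rule sum.swap)
      finally show ?thesis .
    qed
    have inv: "(\<Sum>j\<in>?I. ?J a j * X (j, b)) + (\<Sum>j\<in>?I. ?J j b * X (j, a)) = 0" if ab: "a \<in> ?I" "b \<in> ?I" for a b
    proof -
      have "(\<Sum>j\<in>?I. ?J a j * X (j, b)) = (\<Sum>j\<in>?I. if j = dual_idx n a then idx_sign n a * X (dual_idx n a, b) else 0)"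
        by (rule sum.cong) (auto simp: symp_form_unit[OF ab(1)])
      also have "\<dots> = idx_sign n a * X (dual_idx n a, b)" using dual_idx_in[OF ab(1)] by simp
      finally have 1: "(\<Sum>j\<in>?I. ?J a j * X (j, b)) = idx_sign n a * X (dual_idx n a, b)" .
      have "(\<Sum>j\<in>?I. ?J j b * X (j, a)) = (\<Sum>j\<in>?I. if j = dual_idx n b then - idx_sign n b * X (dual_idx n b, a) else 0)"
      proof (rule sum.cong[OF refl])
        fix j assume j: "j \<in> ?I"
        have "dual_idx n j = b \<longleftrightarrow> j = dual_idx n b" using j ab(2) dual_idx_dual_idx by metis
        thus "?J j b * X (j, a) = (if j = dual_idx n b then - idx_sign n b * X (dual_idx n b, a) else 0)"
          unfolding symp_form_unit[OF j] using idx_sign_dual[OF ab(2)] by auto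
      qed
      also have "\<dots> = - idx_sign n b * X (dual_idx n b, a)" using dual_idx_in[OF ab(2)] by simp
      finally show ?thesis unfolding 1 using X ab by (simp add: odd_sp_iff del: atLeastAtMost_iff)
    qed
    have "contraction n p q (lie_act ?N X T) w =
        (\<Sum>a\<in>?I. \<Sum>b\<in>?I. \<Sum>j\<in>?I. ?J a b * X (b, j) * T (?w a j w)) +
        (\<Sum>a\<in>?I. \<Sum>b\<in>?I. \<Sum>j\<in>?I. ?J a b * X (a, j) * T (?w j b w)) +
        (\<Sum>a\<in>?I. \<Sum>b\<in>?I. \<Sum>r<length w. \<Sum>j\<in>?I. ?J a b * (X (w ! r, j) * T (?w a b (w[r := j]))))"
      unfolding contraction_def expand
      by (simp only: distrib_left sum.distrib sum_distrib_left mult.assoc)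
    also have "(\<Sum>a\<in>?I. \<Sum>b\<in>?I. \<Sum>j\<in>?I. ?J a b * X (b, j) * T (?w a j w)) =
        (\<Sum>a\<in>?I. \<Sum>b\<in>?I. \<Sum>j\<in>?I. ?J a j * X (j, b) * T (?w a b w))" by (rule swap3)
    also have "(\<Sum>a\<in>?I. \<Sum>b\<in>?I. \<Sum>j\<in>?I. ?J a b * X (a, j) * T (?w j b w)) =
        (\<Sum>a\<in>?I. \<Sum>b\<in>?I. \<Sum>j\<in>?I. ?J j b * X (j, a) * T (?w a b w))" by (rule swap3')
    also have "(\<Sum>a\<in>?I. \<Sum>b\<in>?I. \<Sum>j\<in>?I. ?J a j * X (j, b) * T (?w a b w)) + \<dots> =
        (\<Sum>a\<in>?I. \<Sum>b\<in>?I. ((\<Sum>j\<in>?I. ?J a j * X (j, b)) + (\<Sum>j\<in>?I. ?J j b * X (j, a))) * T (?w a b w))"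
      by (simp only: sum.distrib[symmetric] sum_distrib_right distrib_right)
    also have "\<dots> = 0" using inv by (intro sum.neutral ballI) simp
    also have "(\<Sum>a\<in>?I. \<Sum>b\<in>?I. \<Sum>r<length w. \<Sum>j\<in>?I. ?J a b * (X (w ! r, j) * T (?w a b (w[r := j])))) =
        (\<Sum>r<length w. \<Sum>j\<in>?I. \<Sum>a\<in>?I. \<Sum>b\<in>?I. ?J a b * (X (w ! r, j) * T (?w a b (w[r := j]))))"
    proof -
      have "(\<Sum>a\<in>?I. \<Sum>b\<in>?I. \<Sum>r<length w. \<Sum>j\<in>?I. g a b r j) = (\<Sum>r<length w. \<Sum>j\<in>?I. \<Sum>a\<in>?I. \<Sum>b\<in>?I. g a b r j)" for g :: "nat \<Rightarrow> nat \<Rightarrow> nat \<Rightarrow> nat \<Rightarrow> complex"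
      proof -
        have "(\<Sum>a\<in>?I. \<Sum>b\<in>?I. \<Sum>r<length w. \<Sum>j\<in>?I. g a b r j) = (\<Sum>a\<in>?I. \<Sum>r<length w. \<Sum>b\<in>?I. \<Sum>j\<in>?I. g a b r j)"
          by (intro sum.cong refl sum.swap)
        also have "\<dots> = (\<Sum>r<length w. \<Sum>a\<in>?I. \<Sum>b\<in>?I. \<Sum>j\<in>?I. g a b r j)" by (rule sum.swap)
        also have "\<dots> = (\<Sum>r<length w. \<Sum>a\<in>?I. \<Sum>j\<in>?I. \<Sum>b\<in>?I. g a b r j)"
          by (intro sum.cong refl sum.swap)
        also have "\<dots> = (\<Sum>r<length w. \<Sum>j\<in>?I. \<Sum>a\<in>?I. \<Sum>b\<in>?I. g a b r j)"
          by (intro sum.cong refl sum.swap)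
        finally show ?thesis .
      qed
      thus ?thesis .
    qed
    also have "\<dots> = lie_act ?N X (contraction n p q T) w"
      unfolding lie_act_def contraction_def by (simp only: sum_distrib_left mult.left_commute)
    finally show ?thesis by simp
  qed
qed

lemma contraction_add: "contraction n p q (S + T) = contraction n p q S + contraction n p q T"
  by (auto simp: contraction_def fun_eq_iff fun_apply algebra_simps sum.distrib)

lemma contraction_scale: "contraction n p q (c *\<^sub>C T) = c *\<^sub>C contraction n p q T"
  by (auto simp: contraction_def fun_eq_iff algebra_simps sum_distrib_left)

lemma young_symmetrizer_add: "young_symmetrizer n m (S + T) = young_symmetrizer n m S + young_symmetrizer n m T"
  by (auto simp: young_symmetrizer_def perm_act_def fun_eq_iff fun_apply sum_fun_apply algebra_simps sum.distrib)

lemma young_symmetrizer_scale: "young_symmetrizer n m (c *\<^sub>C T) = c *\<^sub>C young_symmetrizer n m T"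
  by (auto simp: young_symmetrizer_def perm_act_def fun_eq_iff sum_fun_apply algebra_simps sum_distrib_left)

lemma subspace_schur_module: "cfun.subspace (schur_module n m)"
  unfolding schur_module_def
proof (rule cfun.subspaceI)
  let ?A = "tensors (2 * n + 1) (part_size n m)"
  note sub = subspace_tensors[of "2 * n + 1" "part_size n m"]
  have "young_symmetrizer n m 0 = 0"
    by (auto simp: young_symmetrizer_def perm_act_def fun_eq_iff fun_apply sum_fun_apply)
  thus "0 \<in> young_symmetrizer n m ` ?A" using cfun.subspace_0[OF sub] by (metis imageI)
  fix c S assume "S \<in> young_symmetrizer n m ` ?A"
  then obtain S' where S': "S' \<in> ?A" "S = young_symmetrizer n m S'" by blast
  show "c *\<^sub>C S \<in> young_symmetrizer n m ` ?A"
    unfolding S' young_symmetrizer_scale[symmetric] by (intro imageI cfun.subspace_scale sub S')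
  fix T assume "T \<in> young_symmetrizer n m ` ?A"
  then obtain T' where T': "T' \<in> ?A" "T = young_symmetrizer n m T'" by blast
  show "S + T \<in> young_symmetrizer n m ` ?A"
    unfolding S' T' young_symmetrizer_add[symmetric] by (intro imageI cfun.subspace_add sub S' T')
qed

lemma subspace_trace_free: "cfun.subspace (trace_free_module n m)"
proof (rule cfun.subspaceI)
  have "contraction n p q 0 = 0" for p q
    by (auto simp: contraction_def fun_eq_iff fun_apply)
  thus "0 \<in> trace_free_module n m"
    using cfun.subspace_0[OF subspace_schur_module] by (simp add: trace_free_module_def)
qed (auto simp: trace_free_module_def contraction_add contraction_scale
    cfun.subspace_add[OF subspace_schur_module] cfun.subspace_scale[OF subspace_schur_module] simp del: fscale_apply)

lemma lie_act_perm_act: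
  assumes T: "T \<in> tensors N k" and \<sigma>: "\<sigma> permutes {..<k}"
  shows "lie_act N X (perm_act T \<sigma>) = perm_act (lie_act N X T) \<sigma>"
proof
  fix w
  let ?\<tau> = "inv \<sigma>"
  have \<tau>: "?\<tau> permutes {..<k}" by (rule permutes_inv[OF \<sigma>])
  show "lie_act N X (perm_act T \<sigma>) w = perm_act (lie_act N X T) \<sigma> w"
  proof (cases "length w = k")
    case False
    hence "T u = 0" if "length u = length w" for u using that T by (auto simp: tensors_def tensor_words_def)
    thus ?thesis by (auto simp: lie_act_def perm_act_def intro!: sum.neutral)
  next
    case True
    have upd: "permute_list ?\<tau> (w[?\<tau> i := j]) = (permute_list ?\<tau> w)[i := j]" if i: "i < k" for i j
    proof (rule nth_equalityI)
      fix r assume "r < length (permute_list ?\<tau> (w[?\<tau> i := j]))"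
      hence r: "r < k" using True by simp
      have "?\<tau> r < k" "?\<tau> i < k" using permutes_in_image[OF \<tau>, of r] permutes_in_image[OF \<tau>, of i] r i by auto
      moreover have "?\<tau> r = ?\<tau> i \<longleftrightarrow> r = i" using permutes_inj[OF \<tau>] by (auto simp: inj_eq)
      ultimately show "permute_list ?\<tau> (w[?\<tau> i := j]) ! r = (permute_list ?\<tau> w)[i := j] ! r"
        using r i True by (cases "r = i") (simp_all add: permute_list_def)
    qed (use True in simp)
    have "lie_act N X (perm_act T \<sigma>) w = (\<Sum>p<k. \<Sum>j=1..N. X (w ! p, j) * T (permute_list ?\<tau> (w[p := j])))"
      by (simp add: lie_act_def perm_act_def True)
    also have "\<dots> = (\<Sum>i<k. \<Sum>j=1..N. X (w ! ?\<tau> i, j) * T (permute_list ?\<tau> (w[?\<tau> i := j])))"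
      by (rule sum.reindex_bij_betw[OF permutes_imp_bij[OF \<tau>], symmetric])
    also have "\<dots> = (\<Sum>i<k. \<Sum>j=1..N. X (permute_list ?\<tau> w ! i, j) * T ((permute_list ?\<tau> w)[i := j]))"
    proof (intro sum.cong refl)
      fix i j assume i: "i \<in> {..<k}"
      hence "permute_list ?\<tau> w ! i = w ! ?\<tau> i" by (simp add: permute_list_def True)
      thus "X (w ! ?\<tau> i, j) * T (permute_list ?\<tau> (w[?\<tau> i := j])) =
          X (permute_list ?\<tau> w ! i, j) * T ((permute_list ?\<tau> w)[i := j])"
        using upd i by simp
    qed
    also have "\<dots> = perm_act (lie_act N X T) \<sigma> w" by (simp add: lie_act_def perm_act_def True)
    finally show ?thesis .
  qed
qed

lemma lie_act_schur:
  assumes X: "\<And>a b. X (a, b) \<noteq> 0 \<Longrightarrow> a \<in> {1..2 * n + 1}" and T: "T \<in> schur_module n m"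
  shows "lie_act (2 * n + 1) X T \<in> schur_module n m"
proof -
  obtain S where S: "S \<in> tensors (2 * n + 1) (part_size n m)" "T = young_symmetrizer n m S"
    using T by (auto simp: schur_module_def)
  have "\<sigma> \<circ> \<tau> permutes {..<part_size n m}" if "\<sigma> \<in> row_stab n m" "\<tau> \<in> col_stab n m" for \<sigma> \<tau>
    using that by (intro permutes_compose) (auto simp: row_stab_def col_stab_def)
  hence "lie_act (2 * n + 1) X T = young_symmetrizer n m (lie_act (2 * n + 1) X S)"
    unfolding S(2) young_symmetrizer_def lie_act_sum lie_act_scale
    by (intro sum.cong refl) (simp add: lie_act_perm_act[OF S(1)])
  moreover have "lie_act (2 * n + 1) X S \<in> tensors (2 * n + 1) (part_size n m)"
    by (rule lie_act_tensors[OF _ S(1)]) (rule X)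
  ultimately show ?thesis unfolding schur_module_def by (simp only: imageI)
qed

lemma lie_act_trace_free:
  assumes X: "X \<in> odd_sp n" and T: "T \<in> trace_free_module n m"
  shows "lie_act (2 * n + 1) X T \<in> trace_free_module n m"
proof -
  have gl: "a \<in> {1..2 * n + 1}" if "X (a, b) \<noteq> 0" for a b
    using glD[of X "2 * n + 1"] X that by (auto simp: odd_sp_def)
  have S: "T \<in> schur_module n m" and c: "\<And>p q. p < q \<Longrightarrow> q < part_size n m \<Longrightarrow> contraction n p q T = 0"
    using T by (auto simp: trace_free_module_def)
  have t: "T \<in> tensors (2 * n + 1) (part_size n m)" using S schur_module_anti col_anti_tensors by blast
  show ?thesis unfolding trace_free_module_def
    using lie_act_schur[OF gl S] contraction_lie_act[OF X t] c by auto
qed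

section \<open>Weights\<close>

definition mset_wt :: "nat \<Rightarrow> elt multiset \<Rightarrow> weight"
  where "mset_wt n M = (\<Sum>\<alpha>\<in>#M. elt_weight n \<alpha>)"

lemma pt_wt_count:
  assumes "set_mset M \<subseteq> poset n"
  shows "pt_wt n (count M) = mset_wt n M"
  using assms
proof (induction M)
  case empty
  show ?case by (auto simp: pt_wt_def mset_wt_def fun_eq_iff sum_fun_apply fun_apply)
next
  case (add \<beta> M)
  have \<beta>: "\<beta> \<in> poset n" using add.prems by simp
  have "pt_wt n (count (add_mset \<beta> M)) =
      (\<Sum>\<alpha>\<in>poset n. (if \<alpha> = \<beta> then elt_weight n \<beta> else 0) + of_nat (count M \<alpha>) *\<^sub>C elt_weight n \<alpha>)"
    unfolding pt_wt_def by (rule sum.cong) (auto simp: fun_eq_iff fun_apply algebra_simps)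
  also have "\<dots> = elt_weight n \<beta> + pt_wt n (count M)"
    unfolding sum.distrib pt_wt_def using \<beta> by simp
  also have "pt_wt n (count M) = mset_wt n M" using add by simp
  finally show ?case unfolding mset_wt_def image_mset_add_mset sum_mset.add_mset .
qed

lemma pt_deg_count:
  assumes "set_mset M \<subseteq> poset n"
  shows "pt_deg n (count M) = size M"
proof -
  have "size M = (\<Sum>\<alpha>\<in>poset n. count M \<alpha>)"
    unfolding size_multiset_overloaded_eq using assms
    by (intro sum.mono_neutral_left) (auto simp: not_in_iff)
  thus ?thesis by (simp add: pt_deg_def)
qed

lemma FFLV_mset:
  assumes "s \<in> FFLV_int n m"
  shows "\<exists>M. set_mset M \<subseteq> poset n \<and> count M = s"
proof (intro exI[of _ "Abs_multiset s"] conjI subsetI)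
  have z: "s \<alpha> = 0" if "\<alpha> \<notin> poset n" for \<alpha> using assms that by (simp add: FFLV_int_iff)
  have "finite {\<alpha>. 0 < s \<alpha>}"
    by (rule finite_subset[OF _ finite_poset[of n]]) (use z in \<open>metis mem_Collect_eq less_numeral_extra(3) subsetI\<close>)
  thus cnt: "count (Abs_multiset s) = s" by (rule count_Abs_multiset)
  fix \<alpha> assume "\<alpha> \<in># Abs_multiset s"
  hence "count (Abs_multiset s) \<alpha> \<noteq> 0" by simp
  hence "s \<alpha> \<noteq> 0" unfolding cnt .
  thus "\<alpha> \<in> poset n" using z by metis
qed

lemma finite_FFLV_int: "finite (FFLV_int n m)"
proof -
  have "FFLV_int n m \<subseteq> {s. \<forall>\<alpha>. (\<alpha> \<in> poset n \<longrightarrow> s \<alpha> \<in> {..part n m 1}) \<and> (\<alpha> \<notin> poset n \<longrightarrow> s \<alpha> = 0)}"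
  proof (intro subsetI CollectI allI conjI impI)
    fix s \<alpha> assume s: "s \<in> FFLV_int n m" and a: "\<alpha> \<in> poset n"
    have "s \<alpha> \<le> part n m (elt_row \<alpha>)" using transfer_ge[OF s a] transfer_le[OF s a] by simp
    also have "\<dots> \<le> part n m 1" using elt_bounds[OF a] by (intro part_antimono)
    finally show "s \<alpha> \<in> {..part n m 1}" by simp
  next
    fix s \<alpha> assume "s \<in> FFLV_int n m" "\<alpha> \<notin> poset n"
    thus "s \<alpha> = 0" by (auto simp: FFLV_int_iff)
  qed
  thus ?thesis using finite_set_of_finite_funs[of "poset n" "{..part n m 1}" 0] by (auto intro: finite_subset)
qed

lemma subspace_weights: "cfun.subspace (weights n)"
  by (simp add: weights_def)

lemma eps_weights: "i \<in> {1..n} \<Longrightarrow> eps i \<in> weights n"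
  unfolding weights_def by (intro cfun.span_base) blast

lemma elt_weight_weights:
  assumes "\<alpha> \<in> poset n" shows "elt_weight n \<alpha> \<in> weights n"
proof -
  note w = cfun.subspace_add[OF subspace_weights] cfun.subspace_diff[OF subspace_weights] eps_weights
  have d: "del_wt n \<in> weights n" unfolding weights_def by (intro cfun.span_base) blast
  from assms show ?thesis
  proof (cases rule: poset_cases)
    case (Bar i j)
    show ?thesis unfolding Bar(1) elt_weight_Bar[OF Bar(3,4)] by (intro w) (use Bar in auto)
  next
    case (Plain i j)
    show ?thesis unfolding Plain(1) elt_weight_Plain[OF Plain(2-4)] by (intro w) (use Plain in auto)
  next
    case (last i)
    show ?thesis unfolding last(1) elt_weight_Plain_last[OF last(3)] by (intro w d) (use last in auto)
  qed
qed

lemma highest_weight_weights: "highest_weight n m \<in> weights n"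
  unfolding highest_weight_def fund_weight_def
  by (intro cfun.subspace_sum cfun.subspace_scale subspace_weights eps_weights) auto

lemma mset_wt_weights: "set_mset M \<subseteq> poset n \<Longrightarrow> mset_wt n M \<in> weights n"
proof (induction M)
  case empty
  show ?case using cfun.subspace_0[OF subspace_weights] by (simp add: mset_wt_def)
next
  case (add \<beta> M)
  thus ?case using cfun.subspace_add[OF subspace_weights elt_weight_weights[of \<beta> n]] by (simp add: mset_wt_def)
qed

lemma weights_support: "\<mu> \<in> weights n \<Longrightarrow> i \<notin> {1..n + 1} \<Longrightarrow> \<mu> i = 0"
proof -
  let ?P = "{\<mu> :: weight. \<forall>i. i \<notin> {1..n + 1} \<longrightarrow> \<mu> i = 0}"
  have "cfun.subspace ?P" by (auto simp: cfun.subspace_def fun_apply)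
  moreover have "eps ` {1..n} \<union> {del_wt n} \<subseteq> ?P" by (auto simp: eps_def del_wt_def unit_vec_def)
  ultimately have "weights n \<subseteq> ?P" unfolding weights_def by (intro cfun.span_minimal)
  thus "\<mu> \<in> weights n \<Longrightarrow> i \<notin> {1..n + 1} \<Longrightarrow> \<mu> i = 0" by blast
qed

lemma weights_separated:
  assumes "\<mu> \<in> weights n" "\<nu> \<in> weights n" "\<mu> \<noteq> \<nu>"
  obtains H where "H \<in> ext_cartan n" "pairing n \<mu> H \<noteq> pairing n \<nu> H"
proof -
  obtain i where i: "\<mu> i \<noteq> \<nu> i" using assms(3) by (auto simp: fun_eq_iff)
  hence iN: "i \<in> {1..n + 1}" using weights_support[OF assms(1)] weights_support[OF assms(2)] by metis
  show ?thesis
  proof (cases "i = n + 1")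
    case True
    let ?H = "unit_vec (2 * n + 1, 2 * n + 1) :: matrix"
    have "?H \<in> ext_cartan n" unfolding ext_cartan_def by (intro cfun.span_base) blast
    moreover have "pairing n \<rho> ?H = \<rho> (n + 1)" for \<rho> by (auto simp: pairing_def unit_vec_def intro!: sum.neutral)
    ultimately show ?thesis using that i True by simp
  next
    case False
    hence i': "i \<in> {1..n}" using iN by auto
    let ?H = "unit_vec (i, i) - unit_vec (n + i, n + i) :: matrix"
    have "?H \<in> ext_cartan n" unfolding ext_cartan_def using i' by (intro cfun.span_base) blast
    moreover have "pairing n \<rho> ?H = \<rho> i" for \<rho>
    proof -
      have "(\<Sum>k=1..n. \<rho> k * ?H (k, k)) = (\<Sum>k=1..n. if k = i then \<rho> i else 0)"
        by (rule sum.cong) (use i' in \<open>auto simp: unit_vec_def fun_apply\<close>)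
      moreover have "?H (2 * n + 1, 2 * n + 1) = 0" using i' by (simp add: unit_vec_def fun_apply)
      ultimately show ?thesis using i' by (simp add: pairing_def)
    qed
    ultimately show ?thesis using that i by simp
  qed
qed

lemma highest_weight_part: "highest_weight n m = (\<Sum>a=1..n. of_nat (part n m a) *\<^sub>C eps a)"
proof
  fix x
  have "highest_weight n m x = (\<Sum>i=1..n. \<Sum>a=1..i. of_nat (m i) * eps a x)"
    by (simp add: highest_weight_def fund_weight_def sum_fun_apply sum_distrib_left)
  also have "\<dots> = (\<Sum>i=1..n. \<Sum>a=1..n. if a \<le> i then of_nat (m i) * eps a x else 0)"
    by (intro sum.cong refl sum.mono_neutral_cong_left) auto
  also have "\<dots> = (\<Sum>a=1..n. \<Sum>i=1..n. if a \<le> i then of_nat (m i) * eps a x else 0)"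
    by (rule sum.swap)
  also have "\<dots> = (\<Sum>a=1..n. \<Sum>i=a..n. of_nat (m i) * eps a x)"
    by (intro sum.cong refl sum.mono_neutral_cong_right) auto
  also have "\<dots> = (\<Sum>a=1..n. of_nat (part n m a) *\<^sub>C eps a) x"
    by (simp add: sum_fun_apply part_def sum_distrib_right)
  finally show "highest_weight n m x = (\<Sum>a=1..n. of_nat (part n m a) *\<^sub>C eps a) x" .
qed

context hw_vector
begin

text \<open>Only letters up to n occur in v, and they span an isotropic subspace.\<close>

lemma v_trace_free: "v \<in> trace_free_module n m"
proof -
  have "contraction n p q v w = 0" for p q w
    unfolding contraction_def
  proof (intro sum.neutral ballI)
    fix a b assume ab: "a \<in> {1..2 * n + 1}" "b \<in> {1..2 * n + 1}"
    let ?u = "insert_at q b (insert_at p a w)"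
    show "symp_form n (unit_vec a) (unit_vec b) * v ?u = 0"
    proof (cases "v ?u = 0")
      case False
      have "x \<le> n" if x: "x \<in> set ?u" for x
      proof -
        obtain r where "r < part_size n m" "x = ?u ! r" using x v_length[OF False] by (auto simp: in_set_conv_nth)
        thus ?thesis using v_letters[OF False, of r] height_le[of n m "box_col n m r"] by auto
      qed
      hence "a \<le> n" "b \<le> n" by (auto simp: set_insert_at)
      hence "dual_idx n a \<noteq> b" using ab by (auto simp: dual_idx_def)
      thus ?thesis by (simp add: symp_form_unit[OF ab(1)])
    qed simp
  qed
  thus ?thesis using hw unfolding highest_weight_vector_def trace_free_module_def
    by (auto simp: fun_eq_iff fun_apply)
qed

lemma filt_trace_free: "filt s \<subseteq> trace_free_module n m"
  unfolding pbw_filtration_def ext_n_minus_eq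
proof (rule cfun.span_minimal[OF _ subspace_trace_free])
  have "foldr act xs v \<in> trace_free_module n m" if "set xs \<subseteq> lower_sp n" for xs
    using that by (induction xs) (auto simp: v_trace_free intro!: lie_act_trace_free lower_sp_odd_sp)
  thus "{foldr act xs v |xs. set xs \<subseteq> lower_sp n \<and> length xs \<le> s} \<subseteq> trace_free_module n m" by blast
qed

lemma v_weight:
  assumes H: "H \<in> ext_cartan n"
  shows "act H v = pairing n (highest_weight n m) H *\<^sub>C v"
proof
  fix w
  have p: "pairing n (highest_weight n m) H = (\<Sum>a=1..n. of_nat (part n m a) * H (a, a))"
    unfolding highest_weight_part pairing_sum pairing_scale by (intro sum.cong refl) (simp add: pairing_eps)
  have "(\<Sum>j=1..2 * n + 1. H (w ! r, j) * v (w[r := j])) = H (w ! r, w ! r) * v w" if r: "r < length w" for r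
  proof -
    have "(\<Sum>j=1..2 * n + 1. H (w ! r, j) * v (w[r := j])) =
        (\<Sum>j=1..2 * n + 1. if j = w ! r then H (w ! r, w ! r) * v w else 0)"
      by (rule sum.cong) (use ext_cartanD(1)[OF H, of "w ! r"] in auto)
    thus ?thesis using ext_cartanD(1)[OF H, of "w ! r" "w ! r"] by auto
  qed
  hence "act H v w = (\<Sum>r<length w. H (w ! r, w ! r)) * v w"
    by (simp add: lie_act_def sum_distrib_right)
  thus "act H v w = (pairing n (highest_weight n m) H *\<^sub>C v) w"
    using v_sum_letters[of w "\<lambda>a. H (a, a)"] v_length[of w] p by (cases "v w = 0") auto
qed

lemma mon_weight:
  assumes H: "H \<in> ext_cartan n" and M: "set_mset M \<subseteq> poset n"
  shows "act H (mon M) = pairing n (highest_weight n m - mset_wt n M) H *\<^sub>C mon M"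
proof -
  have main: "act H (mon_list xs) = pairing n (highest_weight n m - mset_wt n (mset xs)) H *\<^sub>C mon_list xs"
    if "set xs \<subseteq> poset n" for xs
    using that
  proof (induction xs)
    case Nil
    show ?case using v_weight[OF H] by (simp add: mon_list_def mset_wt_def)
  next
    case (Cons \<beta> xs)
    have \<beta>: "\<beta> \<in> poset n" using Cons.prems by simp
    let ?c = "pairing n (highest_weight n m - mset_wt n (mset xs)) H"
    have "act H (act (neg_vec n \<beta>) (mon_list xs)) =
        act (neg_vec n \<beta>) (act H (mon_list xs)) + act (bracket (2 * n + 1) H (neg_vec n \<beta>)) (mon_list xs)"
      unfolding lie_act_bracket by simp
    also have "act H (mon_list xs) = ?c *\<^sub>C mon_list xs" using Cons.prems by (intro Cons.IH) simp
    also have "act (neg_vec n \<beta>) (?c *\<^sub>C mon_list xs) + act (bracket (2 * n + 1) H (neg_vec n \<beta>)) (mon_list xs) =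
        (?c - pairing n (elt_weight n \<beta>) H) *\<^sub>C act (neg_vec n \<beta>) (mon_list xs)"
      unfolding bracket_neg_vec[OF H \<beta>] lie_act_scale lie_act_scale_matrix
      by (simp add: fun_eq_iff fun_apply algebra_simps)
    also have "?c - pairing n (elt_weight n \<beta>) H = pairing n (highest_weight n m - mset_wt n (mset (\<beta> # xs))) H"
      by (simp add: mset_wt_def pairing_diff pairing_add)
    finally show ?case by (simp add: mon_list_def)
  qed
  obtain xs where xs: "mset xs = M" "mon M = mon_list xs" by (rule mon_ex)
  have "set xs \<subseteq> poset n" using xs(1) M by auto
  from main[OF this] show ?thesis unfolding xs .
qed

section \<open>The monomial basis and the graded multiplicities\<close>

definition points :: "elt multiset set"
  where "points = {M. set_mset M \<subseteq> poset n \<and> count M \<in> FFLV_int n m}"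

lemma bij_count_points: "bij_betw count points (FFLV_int n m)"
  unfolding bij_betw_def
proof
  show "inj_on count points" by (auto simp: inj_on_def multiset_eq_iff)
  show "count ` points = FFLV_int n m"
  proof safe
    fix s assume "s \<in> FFLV_int n m"
    moreover from FFLV_mset[OF this] obtain M where "set_mset M \<subseteq> poset n" "count M = s" by metis
    ultimately show "s \<in> count ` points" by (auto simp: points_def)
  qed (simp add: points_def)
qed

lemma finite_points: "finite points"
  using bij_count_points finite_FFLV_int bij_betw_finite by blast

text \<open>The relation is evaluated at the test word of the term of least energy with nonzero
  coefficient: all other terms and the whole lower piece vanish there.\<close>

lemma independent_top:
  assumes A: "A \<subseteq> points" "\<And>M. M \<in> A \<Longrightarrow> size M = d"
    and z: "(\<Sum>M\<in>A. c M *\<^sub>C mon M) \<in> lower_filt d" and M: "M \<in> A"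
  shows "c M = 0"
proof (rule ccontr)
  assume "c M \<noteq> 0"
  have finA: "finite A" using A(1) finite_points finite_subset by blast
  let ?A = "{M\<in>A. c M \<noteq> 0}"
  have "finite (elt_energy n ` ?A)" "elt_energy n ` ?A \<noteq> {}" using finA M \<open>c M \<noteq> 0\<close> by auto
  from Min_in[OF this] obtain S where S: "S \<in> A" "c S \<noteq> 0" "elt_energy n S = Min (elt_energy n ` ?A)" by auto
  have min: "elt_energy n S \<le> elt_energy n T" if "T \<in> A" "c T \<noteq> 0" for T
    unfolding S(3) using finA that by (intro Min_le) auto
  interpret fflv_point n m v S
    using S(1) A(1) by unfold_locales (auto simp: points_def)
  let ?u = "spec_word spec"
  have small: "T ?u = 0" if T: "T \<in> lower_filt d" for T
  proof (cases d)
    case 0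
    thus ?thesis using T by (simp add: lower_filt_def fun_apply)
  next
    case (Suc r)
    have "cfun.subspace {T. T ?u = 0}" by (auto simp: cfun.subspace_def fun_apply)
    moreover have "{mon M |M. set_mset M \<subseteq> poset n \<and> size M \<le> r} \<subseteq> {T. T ?u = 0}"
      using coordinate_small A(2)[OF S(1)] Suc by auto
    ultimately have "filt r \<subseteq> {T. T ?u = 0}" using filt_span_mon[of r] cfun.span_minimal by blast
    thus ?thesis using T Suc by (auto simp: lower_filt_def)
  qed
  have "0 = (\<Sum>M\<in>A. c M *\<^sub>C mon M) ?u" using small[OF z] by simp
  also have "\<dots> = (\<Sum>M\<in>A. if M = S then c S * mon S ?u else 0)"
    unfolding sum_fun_apply
  proof (rule sum.cong[OF refl])
    fix T assume T: "T \<in> A"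
    show "(c T *\<^sub>C mon T) ?u = (if T = S then c S * mon S ?u else 0)"
    proof (cases "T = S \<or> c T = 0")
      case False
      have "mon T ?u = 0"
        using False T A S(1) min[OF T] by (intro coordinate_other) (auto simp: points_def)
      thus ?thesis using False by simp
    qed auto
  qed
  also have "\<dots> = c S * mon S ?u" using S(1) finA by simp
  finally show False using S(2) coordinate_self by simp
qed

lemma independent_all:
  assumes A: "A \<subseteq> points" and z: "(\<Sum>M\<in>A. c M *\<^sub>C mon M) = 0" and M: "M \<in> A"
  shows "c M = 0"
proof (rule ccontr)
  assume cM: "c M \<noteq> 0"
  have finA: "finite A" using A finite_points finite_subset by blast
  let ?A = "{M\<in>A. c M \<noteq> 0}"
  define d where "d = Max (size ` ?A)"
  have ne: "finite (size ` ?A)" "size ` ?A \<noteq> {}" using finA M cM by auto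
  from Max_in[OF this] obtain S where S: "S \<in> A" "c S \<noteq> 0" "size S = d" unfolding d_def by auto
  have max: "size T \<le> d" if "T \<in> A" "c T \<noteq> 0" for T unfolding d_def using finA that by (intro Max_ge) auto
  let ?B = "{T\<in>A. size T = d}"
  have "(\<Sum>M\<in>A. c M *\<^sub>C mon M) = (\<Sum>M\<in>?B. c M *\<^sub>C mon M) + (\<Sum>M\<in>A - ?B. c M *\<^sub>C mon M)"
    using finA by (subst sum.subset_diff[of ?B A]) (auto simp: add.commute)
  hence "(\<Sum>M\<in>?B. c M *\<^sub>C mon M) = - (\<Sum>M\<in>A - ?B. c M *\<^sub>C mon M)"
    using z by (simp add: eq_neg_iff_add_eq_0)
  also have "\<dots> \<in> lower_filt d"
  proof (intro cfun.subspace_neg cfun.subspace_sum subspace_lower_filt)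
    fix T assume T: "T \<in> A - ?B"
    show "c T *\<^sub>C mon T \<in> lower_filt d"
    proof (cases "c T = 0")
      case True
      thus ?thesis using cfun.subspace_0[OF subspace_lower_filt] by (simp del: fscale_apply)
    next
      case False
      hence lt: "size T < d" using max[of T] T by auto
      then obtain r where r: "d = Suc r" by (cases d) auto
      have "mon T \<in> filt r" using mon_filt[of T] filt_mono[of "size T" r] lt r T A by (auto simp: points_def)
      thus ?thesis unfolding r lower_filt_def by (simp add: cfun.subspace_scale subspace_filt)
    qed
  qed
  finally have "c S = 0" using A S by (intro independent_top[of ?B d c S]) auto
  thus False using S(2) by simp
qed

text \<open>Needed to pass from families indexed by multisets to sets of tensors, in which spans and
  bases are expressed.\<close>

lemma mon_inj: "inj_on mon points"
proof (rule inj_onI, rule ccontr)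
  fix M M' assume MM: "M \<in> points" "M' \<in> points" "mon M = mon M'" "M \<noteq> M'"
  let ?c = "\<lambda>x. if x = M then 1 else - 1 :: complex"
  have "(\<Sum>x\<in>{M, M'}. ?c x *\<^sub>C mon x) = 0" using MM by (simp add: fun_eq_iff fun_apply)
  hence "?c M = 0" using MM by (intro independent_all[of "{M, M'}"]) auto
  thus False by simp
qed

definition level :: "weight \<Rightarrow> nat \<Rightarrow> elt multiset set"
  where "level \<mu> s = {M\<in>points. size M = s \<and> highest_weight n m - mset_wt n M = \<mu>}"

abbreviation "pws \<mu> s \<equiv> pbw_weight_space n (trace_free_module n m) v \<mu> s"

definition lower_pws :: "weight \<Rightarrow> nat \<Rightarrow> tensor set"
  where "lower_pws \<mu> s = (case s of 0 \<Rightarrow> {0} | Suc r \<Rightarrow> pws \<mu> r)"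

lemma pws_iff: "T \<in> pws \<mu> s \<longleftrightarrow> T \<in> filt s \<and> (\<forall>H\<in>ext_cartan n. act H T = pairing n \<mu> H *\<^sub>C T)"
  using filt_trace_free[of s] by (auto simp: pbw_weight_space_def weight_space_def)

lemma subspace_pws: "cfun.subspace (pws \<mu> s)"
proof (rule cfun.subspaceI)
  show "0 \<in> pws \<mu> s" unfolding pws_iff using cfun.subspace_0[OF subspace_filt] by simp
  fix S T c assume S: "S \<in> pws \<mu> s"
  thus "c *\<^sub>C S \<in> pws \<mu> s" unfolding pws_iff
    using cfun.subspace_scale[OF subspace_filt] by (simp add: lie_act_scale cfun.scale_left_commute del: fscale_apply)
  assume "T \<in> pws \<mu> s"
  thus "S + T \<in> pws \<mu> s" using S unfolding pws_iff
    using cfun.subspace_add[OF subspace_filt] by (simp add: lie_act_add cfun.scale_right_distrib del: fscale_apply)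
qed

lemma lower_pws_sub: "lower_pws \<mu> s \<subseteq> pws \<mu> s"
  using filt_mono[of "s - 1" s] cfun.subspace_0[OF subspace_pws]
  by (auto simp: lower_pws_def pws_iff split: nat.split)

lemma lower_pws_lower_filt: "lower_pws \<mu> s \<subseteq> lower_filt s"
  by (auto simp: lower_pws_def lower_filt_def pws_iff split: nat.split)

lemma mon_pws:
  assumes "M \<in> points" "highest_weight n m - mset_wt n M = \<mu>" "size M \<le> s"
  shows "mon M \<in> pws \<mu> s"
  unfolding pws_iff using mon_filt[of M] mon_weight[of _ M] filt_mono[OF assms(3)] assms by (auto simp: points_def)

text \<open>Monomials are weight vectors. If one of another weight occurred, applying H minus its
  eigenvalue, for an H separating the two weights, would give a nontrivial relation.\<close>

lemma pws_expand:
  assumes \<mu>: "\<mu> \<in> weights n" and T: "T \<in> pws \<mu> s"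
  obtains c where "T = (\<Sum>M\<in>{M\<in>points. size M \<le> s \<and> highest_weight n m - mset_wt n M = \<mu>}. c M *\<^sub>C mon M)"
proof -
  let ?A = "{M\<in>points. size M \<le> s}"
  have finA: "finite ?A" using finite_points by simp
  have "{mon M |M. set_mset M \<subseteq> poset n \<and> size M \<le> s \<and> count M \<in> FFLV_int n m} = mon ` ?A"
    by (auto simp: points_def)
  hence "T \<in> cfun.span (mon ` ?A)"
    using filt_fflv_span[of s] T unfolding pws_iff fflv_span_def by auto
  then obtain u where u: "T = (\<Sum>x\<in>mon ` ?A. u x *\<^sub>C x)"
    using cfun.span_finite[of "mon ` ?A"] finA by auto
  define c where "c = u \<circ> mon"
  have Tc: "T = (\<Sum>M\<in>?A. c M *\<^sub>C mon M)"
    unfolding u c_def using mon_inj by (subst sum.reindex) (auto simp: inj_on_def)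
  have wt: "c M = 0" if M: "M \<in> ?A" "highest_weight n m - mset_wt n M \<noteq> \<mu>" for M
  proof -
    let ?\<nu> = "\<lambda>M. highest_weight n m - mset_wt n M"
    have "?\<nu> M \<in> weights n"
      using M(1) by (intro cfun.subspace_diff subspace_weights highest_weight_weights mset_wt_weights) (auto simp: points_def)
    then obtain H where H: "H \<in> ext_cartan n" "pairing n (?\<nu> M) H \<noteq> pairing n \<mu> H"
      using weights_separated[OF _ \<mu> M(2)] by blast
    have "(\<Sum>M\<in>?A. (c M * (pairing n (?\<nu> M) H - pairing n \<mu> H)) *\<^sub>C mon M) =
        (\<Sum>M\<in>?A. c M *\<^sub>C act H (mon M)) - pairing n \<mu> H *\<^sub>C (\<Sum>M\<in>?A. c M *\<^sub>C mon M)"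
      unfolding cfun.scale_sum_right sum_subtractf[symmetric]
    proof (rule sum.cong[OF refl])
      fix M assume "M \<in> ?A"
      hence "act H (mon M) = pairing n (?\<nu> M) H *\<^sub>C mon M" by (intro mon_weight H) (auto simp: points_def)
      thus "(c M * (pairing n (?\<nu> M) H - pairing n \<mu> H)) *\<^sub>C mon M =
          c M *\<^sub>C act H (mon M) - pairing n \<mu> H *\<^sub>C c M *\<^sub>C mon M"
        by (simp add: fun_eq_iff fun_apply algebra_simps)
    qed
    also have "(\<Sum>M\<in>?A. c M *\<^sub>C act H (mon M)) = act H T" unfolding Tc lie_act_sum lie_act_scale ..
    also have "act H T - pairing n \<mu> H *\<^sub>C (\<Sum>M\<in>?A. c M *\<^sub>C mon M) = 0"
      using T H(1) unfolding Tc[symmetric] pws_iff by simp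
    finally have "c M * (pairing n (?\<nu> M) H - pairing n \<mu> H) = 0"
      by (rule independent_all[rotated]) (use M(1) in auto)
    thus ?thesis using H(2) by simp
  qed
  have "T = (\<Sum>M\<in>{M\<in>points. size M \<le> s \<and> highest_weight n m - mset_wt n M = \<mu>}. c M *\<^sub>C mon M)"
    unfolding Tc using finA wt by (intro sum.mono_neutral_right) (auto simp: fun_eq_iff fun_apply)
  thus ?thesis by (rule that)
qed

lemma level_basis_mod:
  assumes \<mu>: "\<mu> \<in> weights n"
  shows "basis_mod (pws \<mu> s) (lower_pws \<mu> s) (mon ` level \<mu> s)"
  unfolding basis_mod_def
proof (intro conjI allI impI ballI)
  have fin: "finite (level \<mu> s)" using finite_points by (simp add: level_def)
  thus "finite (mon ` level \<mu> s)" by simp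
  show "mon ` level \<mu> s \<subseteq> pws \<mu> s" using mon_pws by (auto simp: level_def)
  have inj: "inj_on mon (level \<mu> s)" using mon_inj by (rule inj_on_subset) (auto simp: level_def)
  fix c x assume z: "(\<Sum>x\<in>mon ` level \<mu> s. c x *\<^sub>C x) \<in> lower_pws \<mu> s" and x: "x \<in> mon ` level \<mu> s"
  obtain M where M: "M \<in> level \<mu> s" "x = mon M" using x by blast
  have "(\<Sum>M\<in>level \<mu> s. c (mon M) *\<^sub>C mon M) \<in> lower_filt s"
    using z lower_pws_lower_filt unfolding sum.reindex[OF inj] comp_def by blast
  thus "c x = 0" unfolding M(2)
    by (rule independent_top[rotated 2, OF _ M(1)]) (auto simp: level_def)
next
  show "pws \<mu> s \<subseteq> {x + y |x y. x \<in> cfun.span (mon ` level \<mu> s) \<and> y \<in> lower_pws \<mu> s}"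
  proof
    fix T assume "T \<in> pws \<mu> s"
    from pws_expand[OF \<mu> this] obtain c where
      T: "T = (\<Sum>M\<in>{M\<in>points. size M \<le> s \<and> highest_weight n m - mset_wt n M = \<mu>}. c M *\<^sub>C mon M)" (is "_ = sum ?f ?A") .
    let ?L = "{M\<in>points. size M < s \<and> highest_weight n m - mset_wt n M = \<mu>}"
    have A: "?A = level \<mu> s \<union> ?L" by (auto simp: level_def)
    have "sum ?f ?A = sum ?f (level \<mu> s) + sum ?f ?L"
      unfolding A using finite_points by (intro sum.union_disjoint) (auto simp: level_def)
    moreover have "sum ?f (level \<mu> s) \<in> cfun.span (mon ` level \<mu> s)"
      by (intro cfun.span_sum cfun.span_scale cfun.span_base) simp
    moreover have "sum ?f ?L \<in> lower_pws \<mu> s"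
    proof (cases s)
      case 0
      have "?L = {}" unfolding 0 by simp
      thus ?thesis unfolding 0 lower_pws_def by (simp only: sum.empty nat.case singleton_iff)
    next
      case (Suc r)
      have "sum ?f ?L \<in> pws \<mu> r"
        unfolding Suc by (intro cfun.subspace_sum cfun.subspace_scale subspace_pws mon_pws) auto
      thus ?thesis unfolding Suc lower_pws_def by (simp only: nat.case)
    qed
    ultimately show "T \<in> {x + y |x y. x \<in> cfun.span (mon ` level \<mu> s) \<and> y \<in> lower_pws \<mu> s}"
      unfolding T by blast
  qed
qed

text \<open>\<open>quot_dim\<close> is a definite description. It and the size of the explicit basis
  solve the same dimension equation, which holds because all pieces lie in the finite-dimensional
  tensor space.\<close>

lemma pbw_multiplicity_eq:
  assumes \<mu>: "\<mu> \<in> weights n"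
  shows "pbw_multiplicity n (trace_free_module n m) v \<mu> s = card (level \<mu> s)"
proof -
  have sub: "cfun.subspace (lower_pws \<mu> s)"
    unfolding lower_pws_def using subspace_pws by (simp split: nat.split)
  let ?F = "unit_vec ` tensor_words (2 * n + 1) (part_size n m)"
  have "pws \<mu> s \<subseteq> tensors (2 * n + 1) (part_size n m)"
    using schur_module_anti col_anti_tensors by (fastforce simp: pbw_weight_space_def weight_space_def trace_free_module_def)
  hence "pws \<mu> s \<subseteq> cfun.span ?F" using tensors_span by (rule subset_trans)
  moreover have "finite ?F" using finite_tensor_words by simp
  ultimately have F: "finite ?F" "pws \<mu> s \<subseteq> cfun.span ?F" by simp_all
  have "inj_on mon (level \<mu> s)" using mon_inj by (rule inj_on_subset) (auto simp: level_def)
  hence "card (mon ` level \<mu> s) = card (level \<mu> s)" by (rule card_image)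
  moreover have "cfun.dim (lower_pws \<mu> s) + card (mon ` level \<mu> s) = cfun.dim (pws \<mu> s)"
    by (rule basis_mod_card[OF sub lower_pws_sub subspace_pws F level_basis_mod[OF \<mu>]])
  moreover have "cfun.dim (lower_pws \<mu> s) + quot_dim (pws \<mu> s) (lower_pws \<mu> s) = cfun.dim (pws \<mu> s)"
    by (rule quot_dim_eq[OF sub lower_pws_sub subspace_pws F])
  ultimately show ?thesis unfolding pbw_multiplicity_def lower_pws_def by simp
qed

text \<open>Lattice points are grouped by weight and degree; the size of each group is the
  multiplicity just computed.\<close>

lemma q_character_eq:
  "q_character n (trace_free_module n m) v =
    (\<Sum>s\<in>FFLV_int n m. char_monom (highest_weight n m - pt_wt n s) (pt_deg n s))"
proof -
  let ?key = "\<lambda>M. (highest_weight n m - mset_wt n M, size M)"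
  let ?ch = "\<lambda>k. char_monom (fst k) (snd k)"
  have wt: "highest_weight n m - mset_wt n M \<in> weights n" if "M \<in> points" for M
    using that by (intro cfun.subspace_diff subspace_weights highest_weight_weights mset_wt_weights) (auto simp: points_def)
  have lev: "level \<mu> s = {M\<in>points. ?key M = (\<mu>, s)}" for \<mu> s by (auto simp: level_def)
  have keys: "{(\<mu>, s). \<mu> \<in> weights n \<and> pbw_multiplicity n (trace_free_module n m) v \<mu> s \<noteq> 0} = ?key ` points"
  proof (intro set_eqI iffI)
    fix k assume "k \<in> {(\<mu>, s). \<mu> \<in> weights n \<and> pbw_multiplicity n (trace_free_module n m) v \<mu> s \<noteq> 0}"
    then obtain \<mu> s where k: "k = (\<mu>, s)" "\<mu> \<in> weights n" "card (level \<mu> s) \<noteq> 0"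
      using pbw_multiplicity_eq by auto
    then obtain M where "M \<in> level \<mu> s" by (metis card.empty ex_in_conv)
    thus "k \<in> ?key ` points" unfolding lev k by auto
  next
    fix k assume "k \<in> ?key ` points"
    then obtain M where M: "M \<in> points" "k = ?key M" by blast
    have "M \<in> level (fst k) (snd k)" using M by (simp add: level_def)
    hence "card (level (fst k) (snd k)) \<noteq> 0" using finite_points by (auto simp: level_def)
    thus "k \<in> {(\<mu>, s). \<mu> \<in> weights n \<and> pbw_multiplicity n (trace_free_module n m) v \<mu> s \<noteq> 0}"
      using wt[OF M(1)] M(2) pbw_multiplicity_eq by auto
  qed
  have "q_character n (trace_free_module n m) v =
      (\<Sum>k\<in>?key ` points. of_nat (card {M\<in>points. ?key M = k}) * ?ch k)"
    unfolding q_character_def keys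
  proof (rule sum.cong[OF refl])
    fix k assume "k \<in> ?key ` points"
    then obtain M where M: "M \<in> points" "k = ?key M" by blast
    thus "(case k of (\<mu>, s) \<Rightarrow> of_nat (pbw_multiplicity n (trace_free_module n m) v \<mu> s) * char_monom \<mu> s) =
        of_nat (card {M\<in>points. ?key M = k}) * ?ch k"
      using wt[OF M(1)] by (simp add: pbw_multiplicity_eq lev)
  qed
  also have "\<dots> = (\<Sum>k\<in>?key ` points. \<Sum>M\<in>{M\<in>points. ?key M = k}. ?ch (?key M))"
  proof (rule sum.cong[OF refl])
    fix k
    have "(\<Sum>M\<in>{M\<in>points. ?key M = k}. ?ch (?key M)) = (\<Sum>M\<in>{M\<in>points. ?key M = k}. ?ch k)"
      by (rule sum.cong) auto
    thus "of_nat (card {M\<in>points. ?key M = k}) * ?ch k = (\<Sum>M\<in>{M\<in>points. ?key M = k}. ?ch (?key M))"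
      by (simp only: sum_constant)
  qed
  also have "\<dots> = (\<Sum>M\<in>points. ?ch (?key M))"
    by (rule sum.image_gen[OF finite_points, symmetric])
  also have "\<dots> = (\<Sum>M\<in>points. char_monom (highest_weight n m - pt_wt n (count M)) (pt_deg n (count M)))"
    by (rule sum.cong) (auto simp: points_def pt_wt_count pt_deg_count)
  also have "\<dots> = (\<Sum>s\<in>FFLV_int n m. char_monom (highest_weight n m - pt_wt n s) (pt_deg n s))"
    by (rule sum.reindex_bij_betw[OF bij_count_points])
  finally show ?thesis .
qed

end

theorem corollary3p4:
  fixes n :: nat and m :: "nat \<Rightarrow> nat" and v :: tensor
  assumes "n \<ge> 1" and "highest_weight_vector n m v"
  shows "q_character n (trace_free_module n m) v =
    (\<Sum>s\<in>FFLV_int n m. char_monom (highest_weight n m - pt_wt n s) (pt_deg n s))"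
proof -
  interpret hw_vector n m v using assms by unfold_locales
  show ?thesis by (rule q_character_eq)
qed

end
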